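(* Let $\Delta=(\Sigma,C,w)$ be a $\mathbb{Q}$-Gorenstein$^*$ simplicial multi-fan in a lattice $N$ of rank $n$, let $1\le k\le n$, and let $x\in H_T^{2k}(\Delta)_{\mathbb{Q}}$. Then $$\bar{x}=\sum_{J\in\Sigma^{(k)}}\mu(x,J)\,\bar{x}_J\qquad\text{in } \mathrm{Rat}(G_{n-k+1}(N_{\mathbb{Q}}))_0\otimes_{\mathbb{Q}}H^{2k}(\Delta)_{\mathbb{Q}}.$$
   Context: Let $N$ be a lattice of rank $n$, $M=\mathrm{Hom}(N,\mathbb{Z})$, with pairing $\langle\ ,\ \rangle$; subscripts $\mathbb{Q},\mathbb{R}$ denote tensoring. Multi-fans. A simplicial multi-fan in $N$ is a triple $\Delta=(\Sigma,C,w)$, where $\Sigma=\bigsqcup_{k=0}^n\Sigma^{(k)}$ is a finite simplicial complex ($\Sigma^{(k)}$ is the set of simplices with $k$ vertices, $\Sigma^{(0)}=\{o\}$, $o=\emptyset$), $C$ assigns to each $J\in\Sigma^{(k)}$ a $k$-dimensional strongly convex rational polyhedral cone $C(J)$ in $N_{\mathbb{R}}$, and $w:\Sigma^{(n)}\to\mathbb{Z}$ is a map. It is required that $\Sigma^{(n)}\neq\emptyset$, every $J\in\Sigma$ is contained in some $I\in\Sigma^{(n)}$, if $J$ is a face of $I$ then $C(J)$ is a face of $C(I)$, and for each $I$ the map $C$ restricted to $\{J\in\Sigma\mid J\subset I\}$ is an isomorphism of ordered sets onto the set of faces of $C(I)$. For $K\in\Sigma$ let $N_K$ be the minimal primitive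 (saturated) sublattice of $N$ containing $N\cap C(K)$, $N^K=N/N_K$, $\Sigma_K=\{J\in\Sigma\mid K\subset J\}$ (graded by $|J|-|K|$), $C_K(J)$ the image of $C(J)$ in $N^K_{\mathbb{R}}$, and restrict $w$ to $\Sigma_K^{(n-|K|)}=\{I\in\Sigma^{(n)}\mid I\supset K\}$; the projected multi-fan is $\Delta_K=(\Sigma_K,C_K,w)$ in $N^K$. A vector is generic if it lies on no linear subspace spanned by a cone of the multi-fan of less than full dimension. $\Delta$ is pre-complete if $\sum_{v\in C(I)}w(I)$ is independent of the generic vector $v$; it is complete if $\Delta_K$ is pre-complete for every $K\in\Sigma$. $\mathbb{Q}$-Gorenstein$^*$. $\Sigma$ is $\mathbb{Q}$-Gorenstein$^*$ if for all $J\in\Sigma^{(k)}$, $0\le k\le n$, the reduced homology of the link satisfies $\widetilde H_i(\mathrm{Lk}\,J)_{\mathbb{Q}}=\mathbb{Q}$ for $i=\dim\mathrm{Lk}\,J$ and $=0$ for $i<\dim\mathrm{Lk}\,J$. A complete simplicial multi-fan $\Delta=(\Sigma,C,w)$ is called $\mathbb{Q}$-Gorenstein$^*$ if $\Sigma$ is $\mathbb{Q}$-Gorenstein$^*$ (so completeness is part of the definition). Notation. For $i\in\Sigma^{(1)}$, $v_i$ is the primitive vector of $N\cap C(i)$. For $J\in\Sigma$, $N_{J,\mathcal V}$ is the sublattice generated by $\{v_j\}_{j\in J}$ and $\{u_j^J\}_{j\in J}$ is the basis of $N_{J,\mathcal V}^*$ dual to $\{v_j\}_{j\in J}$; for $I\in\Sigma^{(n)}$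 the $u_i^I$ are regarded as elements of $M_{\mathbb{Q}}$. $H_T^*(pt)$ is the symmetric algebra of $M$, with $M=H_T^2(pt)$ in degree 2. $H_T^*(\Delta)$ is the Stanley–Reisner ring $\mathbb{Z}[x_i\mid i\in\Sigma^{(1)}]/(\prod_{i\in K}x_i\mid K\notin\Sigma)$, $\deg x_i=2$, an $H_T^*(pt)$-algebra via $u\mapsto\sum_i\langle u,v_i\rangle x_i$ for $u\in M$. Put $x_J=\prod_{j\in J}x_j$. $H^*(\Delta)_{\mathbb{Q}}$ is the quotient of $H_T^*(\Delta)_{\mathbb{Q}}$ by the ideal generated by the image of $H_T^+(pt)_{\mathbb{Q}}$ (positive degree part), and $\bar x$ is the image of $x$ in it. For $I\in\Sigma^{(n)}$, $\iota_I^*:H_T^*(\Delta)_{\mathbb{Q}}\to H_T^*(pt)_{\mathbb{Q}}$ is the ring homomorphism with $\iota_I^*(x_i)=u_i^I$ for $i\in I$, $\iota_I^*(x_i)=0$ for $i\notin I$. The functions $\mu(x,J)$. For $J\in\Sigma^{(k)}$ let $M_J\subset M$ be the annihilator of $N_J$, choose an orientation of $M_J$, and put $\omega_J=u_1\wedge\cdots\wedge u_{n-k}\in\bigwedge^{n-k}M$ for an oriented basis of $M_J$. Define $f^J(x_i)=\iota_I^*(x_i)\wedge\omega_J\in\bigwedge^{n-k+1}M_{\mathbb{Q}}$, where $I\in\Sigma^{(n)}$ is any simplex containing $J$ (independent of $I$), and extend to a ring homomorphism $f^J:H_T^*(\Delta)_{\mathbb{Q}}\to S^*(\bigwedge^{n-k+1}M_{\mathbb{Q}})$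 to the symmetric algebra. For $x$ of degree $2k$, $f^J(x)/f^J(x_J)$ is homogeneous of degree $0$, independent of orientation, and is viewed as a rational function of degree $0$ on $\mathbb{P}(\bigwedge^{n-k+1}N_{\mathbb{Q}})$. Let $\mathrm{Rat}(G_{n-k+1}(N_{\mathbb{Q}}))_0$ be the field of rational functions (of degree $0$) on the Grassmannian $G_{n-k+1}(N_{\mathbb{Q}})$ of $(n-k+1)$-planes in $N_{\mathbb{Q}}$ and $\nu:G_{n-k+1}(N_{\mathbb{Q}})\to\mathbb{P}(\bigwedge^{n-k+1}N_{\mathbb{Q}})$ the Plücker embedding. Then $\mu(x,J)=\nu^*\big(f^J(x)/f^J(x_J)\big)$. *)

theory Defs
  imports
    "HOL-Analysis.Analysis"
    "HOL-Algebra.QuotRing"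
    "HOL-Algebra.Module"
    "HOL-Algebra.Free_Abelian_Groups"
    "HOL-Algebra.Elementary_Groups"
    "Jordan_Normal_Form.Determinant"
begin

section \<open>Lattices\<close>

text \<open>
  The ambient Euclidean space is \<open>N\<^sub>\<real>\<close> and \<open>N\<close> is a lattice of full rank in it, so the rank \<open>n\<close>
  is the dimension of the type. The inner product of the type plays no role.
  Elements of \<open>M\<^sub>\<rat>\<close> are the linear forms on \<open>N\<^sub>\<real>\<close> that are rational on \<open>N\<close>.
\<close>

definition full_lattice :: "'a::euclidean_space set \<Rightarrow> bool" where
  "full_lattice N \<longleftrightarrow>
     (\<exists>B. independent B \<and> span B = UNIV \<and>
          N = {v. \<exists>c :: 'a \<Rightarrow> int. v = (\<Sum>b\<in>B. of_int (c b) *\<^sub>R b)})"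

definition lattice_rat :: "'a::euclidean_space set \<Rightarrow> 'a set" where
  "lattice_rat N = {v. \<exists>m::nat. m \<noteq> 0 \<and> real m *\<^sub>R v \<in> N}"

definition dual_lattice :: "'a::euclidean_space set \<Rightarrow> ('a \<Rightarrow> real) set" where
  "dual_lattice N = {u. linear u \<and> (\<forall>v\<in>N. u v \<in> \<int>)}"

definition dual_rat :: "'a::euclidean_space set \<Rightarrow> ('a \<Rightarrow> real) set" where
  "dual_rat N = {u. linear u \<and> (\<forall>v\<in>N. u v \<in> \<rat>)}"

definition primitive_sublattice :: "'a::euclidean_space set \<Rightarrow> 'a set \<Rightarrow> bool" where
  "primitive_sublattice N L \<longleftrightarrow>
     L \<subseteq> N \<and> 0 \<in> L \<and> (\<forall>v\<in>L. \<forall>w\<in>L. v - w \<in> L) \<and>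
     (\<forall>v\<in>N. \<forall>m::nat. m \<noteq> 0 \<and> real m *\<^sub>R v \<in> L \<longrightarrow> v \<in> L)"

definition is_primitive_vector :: "'a::euclidean_space set \<Rightarrow> 'a \<Rightarrow> bool" where
  "is_primitive_vector N v \<longleftrightarrow>
     v \<in> N \<and> v \<noteq> 0 \<and> (\<forall>w\<in>N. \<forall>m::nat. v = real m *\<^sub>R w \<longrightarrow> m = 1)"

definition int_basis :: "('a \<Rightarrow> real) list \<Rightarrow> ('a \<Rightarrow> real) set \<Rightarrow> bool" where
  "int_basis us A \<longleftrightarrow> set us \<subseteq> A \<and>
     (\<forall>u\<in>A. \<exists>!c :: int list. length c = length us \<and>
        u = (\<lambda>v. \<Sum>i<length us. of_int (c ! i) * (us ! i) v))"


section \<open>Simplicial multi-fans\<close>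

record ('v, 'a) multifan =
  simplices :: "'v set set"
  cone_of :: "'v set \<Rightarrow> 'a set"
  weight :: "'v set \<Rightarrow> int"

definition simplices_of :: "('v, 'a) multifan \<Rightarrow> nat \<Rightarrow> 'v set set" where
  "simplices_of \<Delta> k = {J \<in> simplices \<Delta>. card J = k}"

definition vertices :: "('v, 'a) multifan \<Rightarrow> 'v set" where
  "vertices \<Delta> = {i. {i} \<in> simplices \<Delta>}"

definition finite_complex :: "'v set set \<Rightarrow> bool" where
  "finite_complex S \<longleftrightarrow>
     finite S \<and> {} \<in> S \<and> (\<forall>J\<in>S. finite J \<and> (\<forall>K\<subseteq>J. K \<in> S))"

definition rational_cone :: "'a::euclidean_space set \<Rightarrow> 'a set \<Rightarrow> bool" where
  "rational_cone N C \<longleftrightarrow> (\<exists>S. finite S \<and> S \<subseteq> N \<and> C = convex_cone hull S)"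

definition strongly_convex :: "'a::euclidean_space set \<Rightarrow> bool" where
  "strongly_convex C \<longleftrightarrow> C \<inter> uminus ` C = {0}"

text \<open>The empty set is a face of every set in the sense of \<open>face_of\<close>, but not a face of a cone.\<close>

definition cone_face :: "'a::euclidean_space set \<Rightarrow> 'a set \<Rightarrow> bool" where
  "cone_face F C \<longleftrightarrow> F face_of C \<and> F \<noteq> {}"

definition simplicial_multifan :: "'a::euclidean_space set \<Rightarrow> ('v, 'a) multifan \<Rightarrow> bool" where
  "simplicial_multifan N \<Delta> \<longleftrightarrow>
     full_lattice N \<and>
     finite_complex (simplices \<Delta>) \<and>
     (\<forall>J\<in>simplices \<Delta>. card J \<le> DIM('a)) \<and>
     (\<forall>J\<in>simplices \<Delta>. rational_cone N (cone_of \<Delta> J) \<and> strongly_convex (cone_of \<Delta> J) \<and>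
        dim (cone_of \<Delta> J) = card J) \<and>
     simplices_of \<Delta> DIM('a) \<noteq> {} \<and>
     (\<forall>J\<in>simplices \<Delta>. \<exists>I\<in>simplices_of \<Delta> DIM('a). J \<subseteq> I) \<and>
     (\<forall>I\<in>simplices \<Delta>. \<forall>J\<in>simplices \<Delta>. J \<subseteq> I \<longrightarrow> cone_face (cone_of \<Delta> J) (cone_of \<Delta> I)) \<and>
     (\<forall>I\<in>simplices \<Delta>.
        bij_betw (cone_of \<Delta>) {J \<in> simplices \<Delta>. J \<subseteq> I} {F. cone_face F (cone_of \<Delta> I)} \<and>
        (\<forall>J\<in>simplices \<Delta>. \<forall>K\<in>simplices \<Delta>. J \<subseteq> I \<and> K \<subseteq> I \<longrightarrow>
           (J \<subseteq> K \<longleftrightarrow> cone_of \<Delta> J \<subseteq> cone_of \<Delta> K)))"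


section \<open>Projected multi-fans and completeness\<close>

definition sublattice_of :: "'a::euclidean_space set \<Rightarrow> ('v, 'a) multifan \<Rightarrow> 'v set \<Rightarrow> 'a set" where
  "sublattice_of N \<Delta> K = \<Inter>{L. primitive_sublattice N L \<and> N \<inter> cone_of \<Delta> K \<subseteq> L}"

text \<open>
  Elements of \<open>N\<^sup>K\<^sub>\<real>\<close>, the quotient of \<open>N\<^sub>\<real>\<close> by \<open>(N\<^sub>K)\<^sub>\<real>\<close>, are cosets. The subspace spanned by the
  cone \<open>C\<^sub>K(J)\<close> is the image of \<open>span C(J)\<close>, and it has full dimension iff \<open>J\<close> has \<open>n\<close> elements.
\<close>

definition proj :: "'a::euclidean_space set \<Rightarrow> ('v, 'a) multifan \<Rightarrow> 'v set \<Rightarrow> 'a \<Rightarrow> 'a set" where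
  "proj N \<Delta> K v = {v + u | u. u \<in> span (sublattice_of N \<Delta> K)}"

definition proj_multifan ::
    "'a::euclidean_space set \<Rightarrow> ('v, 'a) multifan \<Rightarrow> 'v set \<Rightarrow> ('v, 'a set) multifan" where
  "proj_multifan N \<Delta> K =
     \<lparr>simplices = {J \<in> simplices \<Delta>. K \<subseteq> J}, cone_of = (\<lambda>J. proj N \<Delta> K ` cone_of \<Delta> J),
      weight = weight \<Delta>\<rparr>"

definition proj_generic ::
    "'a::euclidean_space set \<Rightarrow> ('v, 'a) multifan \<Rightarrow> 'v set \<Rightarrow> 'a set \<Rightarrow> bool" where
  "proj_generic N \<Delta> K v \<longleftrightarrow> v \<in> range (proj N \<Delta> K) \<and>
     (\<forall>J\<in>simplices (proj_multifan N \<Delta> K). card J < DIM('a) \<longrightarrow>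
        v \<notin> proj N \<Delta> K ` span (cone_of \<Delta> J))"

definition proj_pre_complete ::
    "'a::euclidean_space set \<Rightarrow> ('v, 'a) multifan \<Rightarrow> 'v set \<Rightarrow> bool" where
  "proj_pre_complete N \<Delta> K \<longleftrightarrow>
     (\<exists>d. \<forall>v. proj_generic N \<Delta> K v \<longrightarrow>
        (let \<Delta>K = proj_multifan N \<Delta> K in
         (\<Sum>I | I \<in> simplices_of \<Delta>K DIM('a) \<and> v \<in> cone_of \<Delta>K I. weight \<Delta>K I) = d))"

definition complete_multifan :: "'a::euclidean_space set \<Rightarrow> ('v, 'a) multifan \<Rightarrow> bool" where
  "complete_multifan N \<Delta> \<longleftrightarrow> (\<forall>K\<in>simplices \<Delta>. proj_pre_complete N \<Delta> K)"


section \<open>Reduced simplicial homology and the Gorenstein condition\<close>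

text \<open>
  The rational oriented chain complex. A chain \<open>c\<close> assigns to a list \<open>xs\<close> of \<open>p\<close> vertices the
  coefficient of the oriented simplex \<open>[xs]\<close>, so it alternates under transpositions. As
  \<open>[v\<^sub>j, v\<^sub>0, \<dots>]\<close> (the others in order) is \<open>(-1)\<^sup>j [v\<^sub>0, \<dots>]\<close>, the coefficient of \<open>[xs]\<close> in
  \<open>\<partial>c\<close> is the sum of the \<open>c [v, xs]\<close>. Degrees are shifted by one: \<open>p\<close> counts vertices, and
  \<open>p = 0\<close> is the augmentation term spanned by the empty simplex.
\<close>

definition chains :: "'v set set \<Rightarrow> nat \<Rightarrow> ('v list \<Rightarrow> rat) set" where
  "chains L p = {c. (\<forall>xs. c xs \<noteq> 0 \<longrightarrow> length xs = p \<and> distinct xs \<and> set xs \<in> L) \<and>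
     (\<forall>xs i j. i < j \<and> j < length xs \<longrightarrow> c (xs[i := xs ! j, j := xs ! i]) = - c xs)}"

definition bdry :: "'v set set \<Rightarrow> ('v list \<Rightarrow> rat) \<Rightarrow> ('v list \<Rightarrow> rat)" where
  "bdry L c = (\<lambda>xs. \<Sum>v\<in>\<Union>L. c (v # xs))"

definition cycle_group :: "'v set set \<Rightarrow> nat \<Rightarrow> ('v list \<Rightarrow> rat) monoid" where
  "cycle_group L p = \<lparr>carrier = {c \<in> chains L p. bdry L c = (\<lambda>xs. 0)},
     monoid.mult = (\<lambda>c d xs. c xs + d xs), monoid.one = (\<lambda>xs. 0)\<rparr>"

definition shifted_reduced_homology :: "'v set set \<Rightarrow> nat \<Rightarrow> ('v list \<Rightarrow> rat) set monoid" where
  "shifted_reduced_homology L p = cycle_group L p Mod (bdry L ` chains L (Suc p))"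

definition rat_group :: "rat monoid" where
  "rat_group = \<lparr>carrier = UNIV, monoid.mult = (+), monoid.one = 0\<rparr>"

definition link :: "'v set set \<Rightarrow> 'v set \<Rightarrow> 'v set set" where
  "link S J = {L. L \<inter> J = {} \<and> L \<union> J \<in> S}"

text \<open>
  The maximal cardinality below is \<open>dim Lk J + 1\<close>. A group isomorphism between rational vector
  spaces is automatically \<open>\<rat>\<close>-linear.
\<close>

definition Q_Gorenstein_star :: "'v set set \<Rightarrow> bool" where
  "Q_Gorenstein_star S \<longleftrightarrow>
     (\<forall>J\<in>S. let d = Max (card ` link S J) in
        shifted_reduced_homology (link S J) d \<cong> rat_group \<and>
        (\<forall>p<d. trivial_group (shifted_reduced_homology (link S J) p)))"

definition Q_Gorenstein_star_multifan ::
    "'a::euclidean_space set \<Rightarrow> ('v, 'a) multifan \<Rightarrow> bool" where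
  "Q_Gorenstein_star_multifan N \<Delta> \<longleftrightarrow>
     simplicial_multifan N \<Delta> \<and> complete_multifan N \<Delta> \<and> Q_Gorenstein_star (simplices \<Delta>)"


section \<open>Stanley--Reisner ring and cohomology\<close>

type_synonym 'v rpoly = "('v \<Rightarrow>\<^sub>0 nat) \<Rightarrow>\<^sub>0 rat"

definition poly_ring :: "'v set \<Rightarrow> 'v rpoly ring" where
  "poly_ring V = \<lparr>carrier = {p. \<forall>m\<in>Poly_Mapping.keys p. Poly_Mapping.keys m \<subseteq> V},
     monoid.mult = (*), monoid.one = 1, ring.zero = 0, ring.add = (+)\<rparr>"

definition poly_const :: "rat \<Rightarrow> 'v rpoly" where
  "poly_const c = Poly_Mapping.single 0 c"

definition poly_var :: "'v \<Rightarrow> 'v rpoly" where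
  "poly_var i = Poly_Mapping.single (Poly_Mapping.single i 1) 1"

definition poly_homogeneous :: "nat \<Rightarrow> 'v rpoly \<Rightarrow> bool" where
  "poly_homogeneous k p \<longleftrightarrow>
     (\<forall>m\<in>Poly_Mapping.keys p. (\<Sum>i\<in>Poly_Mapping.keys m. Poly_Mapping.lookup m i) = k)"

definition poly_eval :: "('v \<Rightarrow> real) \<Rightarrow> 'v rpoly \<Rightarrow> real" where
  "poly_eval a p = (\<Sum>m\<in>Poly_Mapping.keys p. of_rat (Poly_Mapping.lookup p m) *
     (\<Prod>i\<in>Poly_Mapping.keys m. a i ^ Poly_Mapping.lookup m i))"

definition SR_ideal :: "('v, 'a) multifan \<Rightarrow> 'v rpoly set" where
  "SR_ideal \<Delta> = genideal (poly_ring (vertices \<Delta>))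
     {\<Prod>i\<in>K. poly_var i | K. K \<subseteq> vertices \<Delta> \<and> K \<notin> simplices \<Delta>}"

definition HT :: "('v, 'a) multifan \<Rightarrow> 'v rpoly set ring" where
  "HT \<Delta> = poly_ring (vertices \<Delta>) Quot SR_ideal \<Delta>"

definition HT_class :: "('v, 'a) multifan \<Rightarrow> 'v rpoly \<Rightarrow> 'v rpoly set" where
  "HT_class \<Delta> p = SR_ideal \<Delta> +>\<^bsub>poly_ring (vertices \<Delta>)\<^esub> p"

definition HT_face :: "('v, 'a) multifan \<Rightarrow> 'v set \<Rightarrow> 'v rpoly set" where
  "HT_face \<Delta> J = HT_class \<Delta> (\<Prod>j\<in>J. poly_var j)"

text \<open>\<open>HT_deg \<Delta> k\<close> is \<open>H\<^sub>T\<^sup>2\<^sup>k(\<Delta>)\<^sub>\<rat>\<close>: polynomial degree is half the cohomological degree.\<close>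

definition HT_deg :: "('v, 'a) multifan \<Rightarrow> nat \<Rightarrow> 'v rpoly set set" where
  "HT_deg \<Delta> k =
     HT_class \<Delta> ` {p \<in> carrier (poly_ring (vertices \<Delta>)). poly_homogeneous k p}"

definition ray_vector :: "'a::euclidean_space set \<Rightarrow> ('v, 'a) multifan \<Rightarrow> 'v \<Rightarrow> 'a" where
  "ray_vector N \<Delta> i = (THE v. is_primitive_vector N v \<and> v \<in> cone_of \<Delta> {i})"

definition HT_linear ::
    "'a::euclidean_space set \<Rightarrow> ('v, 'a) multifan \<Rightarrow> ('a \<Rightarrow> real) \<Rightarrow> 'v rpoly set" where
  "HT_linear N \<Delta> u = HT_class \<Delta>
     (\<Sum>i\<in>vertices \<Delta>. poly_const (the_inv of_rat (u (ray_vector N \<Delta> i))) * poly_var i)"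

text \<open>The image of the positive-degree part of the symmetric algebra of \<open>M\<^sub>\<rat>\<close>.\<close>

inductive_set HT_plus ::
    "'a::euclidean_space set \<Rightarrow> ('v, 'a) multifan \<Rightarrow> 'v rpoly set set"
  for N :: "'a set" and \<Delta> :: "('v, 'a) multifan" where
  lin: "u \<in> dual_rat N \<Longrightarrow> HT_linear N \<Delta> u \<in> HT_plus N \<Delta>"
| add: "X \<in> HT_plus N \<Delta> \<Longrightarrow> Y \<in> HT_plus N \<Delta> \<Longrightarrow> X \<oplus>\<^bsub>HT \<Delta>\<^esub> Y \<in> HT_plus N \<Delta>"
| mult: "X \<in> HT_plus N \<Delta> \<Longrightarrow> Y \<in> HT_plus N \<Delta> \<Longrightarrow> X \<otimes>\<^bsub>HT \<Delta>\<^esub> Y \<in> HT_plus N \<Delta>"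

definition HT_plus_ideal ::
    "'a::euclidean_space set \<Rightarrow> ('v, 'a) multifan \<Rightarrow> 'v rpoly set set" where
  "HT_plus_ideal N \<Delta> = genideal (HT \<Delta>) (HT_plus N \<Delta>)"

definition H :: "'a::euclidean_space set \<Rightarrow> ('v, 'a) multifan \<Rightarrow> 'v rpoly set set ring" where
  "H N \<Delta> = HT \<Delta> Quot HT_plus_ideal N \<Delta>"

definition bar ::
    "'a::euclidean_space set \<Rightarrow> ('v, 'a) multifan \<Rightarrow> 'v rpoly set \<Rightarrow> 'v rpoly set set" where
  "bar N \<Delta> X = HT_plus_ideal N \<Delta> +>\<^bsub>HT \<Delta>\<^esub> X"

text \<open>
  \<open>H\<^sup>2\<^sup>k(\<Delta>)\<^sub>\<rat>\<close> as a \<open>\<rat>\<close>-module. The \<open>mult\<close> and \<open>one\<close> fields of the record are not part of the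
  module structure (\<open>H\<^sup>2\<^sup>k\<close> is not closed under multiplication).
\<close>

definition H_deg ::
    "'a::euclidean_space set \<Rightarrow> ('v, 'a) multifan \<Rightarrow> nat \<Rightarrow> (rat, 'v rpoly set set) module" where
  "H_deg N \<Delta> k = \<lparr>carrier = bar N \<Delta> ` HT_deg \<Delta> k,
     monoid.mult = monoid.mult (H N \<Delta>), monoid.one = monoid.one (H N \<Delta>),
     ring.zero = ring.zero (H N \<Delta>), ring.add = ring.add (H N \<Delta>),
     module.smult = (\<lambda>c X. bar N \<Delta> (HT_class \<Delta> (poly_const c)) \<otimes>\<^bsub>H N \<Delta>\<^esub> X)\<rparr>"


section \<open>Exterior powers, symmetric algebras and the Grassmannian\<close>

text \<open>
  \<open>u\<^sub>1 \<and> \<dots> \<and> u\<^sub>r\<close> is the alternating form with value \<open>det (u\<^sub>i(w\<^sub>j))\<close> at \<open>(w\<^sub>1, \<dots>, w\<^sub>r)\<close>;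
  \<open>ext_power N r\<close> is the \<open>r\<close>-th exterior power of \<open>M\<^sub>\<rat>\<close>.
\<close>

type_synonym 'a form = "'a list \<Rightarrow> real"

definition wedge :: "('a \<Rightarrow> real) list \<Rightarrow> 'a form" where
  "wedge us = (\<lambda>ws. if length ws = length us
     then Determinant.det (Matrix.mat (length us) (length us) (\<lambda>(i, j). (us ! i) (ws ! j)))
     else 0)"

definition ext_power :: "'a::euclidean_space set \<Rightarrow> nat \<Rightarrow> 'a form set" where
  "ext_power N r = {\<omega>. \<exists>S c. finite S \<and> S \<subseteq> {us. length us = r \<and> set us \<subseteq> dual_rat N} \<and>
     \<omega> = (\<lambda>ws. \<Sum>us\<in>S. of_rat (c us) * wedge us ws)}"

definition dual_space :: "'a form set \<Rightarrow> ('a form \<Rightarrow> real) set" where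
  "dual_space V = {\<xi> \<in> extensional V. (\<forall>\<omega>\<in>V. \<xi> \<omega> \<in> \<rat>) \<and>
     (\<forall>\<omega>\<in>V. \<forall>\<eta>\<in>V. \<forall>a b. \<xi> (\<lambda>ws. of_rat a * \<omega> ws + of_rat b * \<eta> ws) =
        of_rat a * \<xi> \<omega> + of_rat b * \<xi> \<eta>)}"

text \<open>
  \<open>S\<^sup>*(V)\<close>, for a finite-dimensional \<open>\<rat>\<close>-vector space \<open>V\<close>, is the algebra of polynomial functions on
  the dual space of \<open>V\<close> (\<open>\<rat>\<close> is infinite); \<open>sym_power V d\<close> is its part of degree \<open>d\<close>.
  For \<open>V = \<And>\<^sup>rM\<^sub>\<rat>\<close> the dual space is \<open>\<And>\<^sup>rN\<^sub>\<rat>\<close>.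
\<close>

definition sym_power :: "'a form set \<Rightarrow> nat \<Rightarrow> (('a form \<Rightarrow> real) \<Rightarrow> real) set" where
  "sym_power V d = {p. \<exists>S c. finite S \<and> S \<subseteq> {\<omega>s. length \<omega>s = d \<and> set \<omega>s \<subseteq> V} \<and>
     p = (\<lambda>\<xi>\<in>dual_space V. \<Sum>\<omega>s\<in>S. of_rat (c \<omega>s) * prod_list (map \<xi> \<omega>s))}"

text \<open>
  The image under \<open>\<nu>\<close> of the plane in \<open>N\<^sub>\<rat>\<close> with basis \<open>w\<^sub>1, \<dots>, w\<^sub>r\<close> is the line through
  \<open>w\<^sub>1 \<and> \<dots> \<and> w\<^sub>r\<close>, which as a functional on \<open>\<And>\<^sup>rM\<^sub>\<rat>\<close> is evaluation at \<open>(w\<^sub>1, \<dots>, w\<^sub>r)\<close>.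
  \<open>grass_cone N r\<close> consists of the nonzero points on these lines. For vectors of \<open>N\<^sub>\<rat>\<close>, linear
  independence over \<open>\<rat>\<close> and over \<open>\<real>\<close> agree.
\<close>

definition plucker :: "'a::euclidean_space set \<Rightarrow> nat \<Rightarrow> 'a list \<Rightarrow> 'a form \<Rightarrow> real" where
  "plucker N r ws = (\<lambda>\<omega>\<in>ext_power N r. \<omega> ws)"

definition grass_cone :: "'a::euclidean_space set \<Rightarrow> nat \<Rightarrow> ('a form \<Rightarrow> real) set" where
  "grass_cone N r = plucker N r `
     {ws. length ws = r \<and> set ws \<subseteq> lattice_rat N \<and> distinct ws \<and> independent (set ws)}"

text \<open>
  Rational functions on the Grassmannian: fractions \<open>p/q\<close> of homogeneous elements of the same
  degree in the coordinate ring of \<open>\<P>(\<And>\<^sup>rN\<^sub>\<rat>)\<close> with \<open>q\<close> not identically zero on the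
  image of the Grassmannian, two fractions being identified when they agree there. The rational
  points are Zariski dense in the Grassmannian, so it suffices to test on them.
\<close>

type_synonym 'a frac = "(('a form \<Rightarrow> real) \<Rightarrow> real) \<times> (('a form \<Rightarrow> real) \<Rightarrow> real)"

definition fractions :: "'a::euclidean_space set \<Rightarrow> nat \<Rightarrow> 'a frac set" where
  "fractions N r = {(p, q). \<exists>d. p \<in> sym_power (ext_power N r) d \<and>
     q \<in> sym_power (ext_power N r) d \<and> (\<exists>\<xi>\<in>grass_cone N r. q \<xi> \<noteq> 0)}"

definition fraction_rel :: "'a::euclidean_space set \<Rightarrow> nat \<Rightarrow> ('a frac \<times> 'a frac) set" where
  "fraction_rel N r = {((p, q), (p', q')). (p, q) \<in> fractions N r \<and> (p', q') \<in> fractions N r \<and>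
     (\<forall>\<xi>\<in>grass_cone N r. p \<xi> * q' \<xi> = p' \<xi> * q \<xi>)}"

definition ratfun ::
    "'a::euclidean_space set \<Rightarrow> nat \<Rightarrow> (('a form \<Rightarrow> real) \<Rightarrow> real) \<Rightarrow>
     (('a form \<Rightarrow> real) \<Rightarrow> real) \<Rightarrow> 'a frac set" where
  "ratfun N r p q = fraction_rel N r `` {(p, q)}"

definition Rat_Grass :: "'a::euclidean_space set \<Rightarrow> nat \<Rightarrow> (rat, 'a frac set) module" where
  "Rat_Grass N r = (let D = dual_space (ext_power N r) in
     \<lparr>carrier = fractions N r // fraction_rel N r,
      monoid.mult = (\<lambda>X Y. \<Union>(p, q)\<in>X. \<Union>(p', q')\<in>Y.
        ratfun N r (\<lambda>\<xi>\<in>D. p \<xi> * p' \<xi>) (\<lambda>\<xi>\<in>D. q \<xi> * q' \<xi>)),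
      monoid.one = ratfun N r (\<lambda>\<xi>\<in>D. 1) (\<lambda>\<xi>\<in>D. 1),
      ring.zero = ratfun N r (\<lambda>\<xi>\<in>D. 0) (\<lambda>\<xi>\<in>D. 1),
      ring.add = (\<lambda>X Y. \<Union>(p, q)\<in>X. \<Union>(p', q')\<in>Y.
        ratfun N r (\<lambda>\<xi>\<in>D. p \<xi> * q' \<xi> + p' \<xi> * q \<xi>) (\<lambda>\<xi>\<in>D. q \<xi> * q' \<xi>)),
      module.smult = (\<lambda>c X. \<Union>(p, q)\<in>X. ratfun N r (\<lambda>\<xi>\<in>D. of_rat c * p \<xi>) q)\<rparr>)"


section \<open>Tensor products\<close>

definition rat_ring :: "rat ring" where
  "rat_ring = \<lparr>carrier = UNIV, monoid.mult = (*), monoid.one = 1, ring.zero = 0, ring.add = (+)\<rparr>"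

definition tensor_relations ::
    "('r, 's) ring_scheme \<Rightarrow> ('r, 'a) module \<Rightarrow> ('r, 'b) module \<Rightarrow> ('a \<times> 'b \<Rightarrow>\<^sub>0 int) set" where
  "tensor_relations R A B = generate (free_Abelian_group (carrier A \<times> carrier B))
     ({frag_of (a \<oplus>\<^bsub>A\<^esub> a', b) - frag_of (a, b) - frag_of (a', b) | a a' b.
         a \<in> carrier A \<and> a' \<in> carrier A \<and> b \<in> carrier B} \<union>
      {frag_of (a, b \<oplus>\<^bsub>B\<^esub> b') - frag_of (a, b) - frag_of (a, b') | a b b'.
         a \<in> carrier A \<and> b \<in> carrier B \<and> b' \<in> carrier B} \<union>
      {frag_of (c \<odot>\<^bsub>A\<^esub> a, b) - frag_of (a, c \<odot>\<^bsub>B\<^esub> b) | c a b.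
         c \<in> carrier R \<and> a \<in> carrier A \<and> b \<in> carrier B})"

text \<open>The addition of the tensor product is the operation of the quotient group.\<close>

definition tensor_product ::
    "('r, 's) ring_scheme \<Rightarrow> ('r, 'a) module \<Rightarrow> ('r, 'b) module \<Rightarrow> ('a \<times> 'b \<Rightarrow>\<^sub>0 int) set monoid" where
  "tensor_product R A B =
     free_Abelian_group (carrier A \<times> carrier B) Mod tensor_relations R A B"

definition tensor ::
    "('r, 's) ring_scheme \<Rightarrow> ('r, 'a) module \<Rightarrow> ('r, 'b) module \<Rightarrow> 'a \<Rightarrow> 'b \<Rightarrow>
     ('a \<times> 'b \<Rightarrow>\<^sub>0 int) set" where
  "tensor R A B a b =
     tensor_relations R A B #>\<^bsub>free_Abelian_group (carrier A \<times> carrier B)\<^esub> frag_of (a, b)"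


section \<open>The functions \<open>\<mu>(x, J)\<close>\<close>

definition dual_vector ::
    "'a::euclidean_space set \<Rightarrow> ('v, 'a) multifan \<Rightarrow> 'v set \<Rightarrow> 'v \<Rightarrow> 'a \<Rightarrow> real" where
  "dual_vector N \<Delta> I i = (THE u. u \<in> dual_rat N \<and>
     (\<forall>j\<in>I. u (ray_vector N \<Delta> j) = (if j = i then 1 else 0)))"

text \<open>\<open>iota_var N \<Delta> I i\<close> is \<open>\<iota>\<^sub>I\<^sup>*(x\<^sub>i)\<close>, an element of \<open>M\<^sub>\<rat>\<close>.\<close>

definition iota_var ::
    "'a::euclidean_space set \<Rightarrow> ('v, 'a) multifan \<Rightarrow> 'v set \<Rightarrow> 'v \<Rightarrow> 'a \<Rightarrow> real" where
  "iota_var N \<Delta> I i = (if i \<in> I then dual_vector N \<Delta> I i else (\<lambda>v. 0))"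

definition annihilator ::
    "'a::euclidean_space set \<Rightarrow> ('v, 'a) multifan \<Rightarrow> 'v set \<Rightarrow> ('a \<Rightarrow> real) set" where
  "annihilator N \<Delta> J = {u \<in> dual_lattice N. \<forall>v\<in>sublattice_of N \<Delta> J. u v = 0}"

text \<open>
  The orientation of \<open>M\<^sub>J\<close> is given by a basis \<open>us = [u\<^sub>1, \<dots>, u\<^sub>n\<^sub>-\<^sub>k]\<close>, on which the objects below depend
  only through \<open>\<omega>\<^sub>J = u\<^sub>1 \<and> \<dots> \<and> u\<^sub>n\<^sub>-\<^sub>k\<close>.
\<close>

definition annihilator_basis ::
    "'a::euclidean_space set \<Rightarrow> ('v, 'a) multifan \<Rightarrow> 'v set \<Rightarrow> ('a \<Rightarrow> real) list \<Rightarrow> bool" where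
  "annihilator_basis N \<Delta> J us \<longleftrightarrow>
     length us = DIM('a) - card J \<and> int_basis us (annihilator N \<Delta> J)"

definition f_var ::
    "'a::euclidean_space set \<Rightarrow> ('v, 'a) multifan \<Rightarrow> ('a \<Rightarrow> real) list \<Rightarrow> 'v set \<Rightarrow> 'v \<Rightarrow> 'a form" where
  "f_var N \<Delta> us J i =
     wedge (iota_var N \<Delta> (SOME I. I \<in> simplices_of \<Delta> DIM('a) \<and> J \<subseteq> I) i # us)"

definition f_poly ::
    "'a::euclidean_space set \<Rightarrow> ('v, 'a) multifan \<Rightarrow> ('a \<Rightarrow> real) list \<Rightarrow> 'v set \<Rightarrow> 'v rpoly \<Rightarrow>
     ('a form \<Rightarrow> real) \<Rightarrow> real" where
  "f_poly N \<Delta> us J p = (\<lambda>\<xi>\<in>dual_space (ext_power N (DIM('a) - card J + 1)).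
     poly_eval (\<lambda>i. \<xi> (f_var N \<Delta> us J i)) p)"

text \<open>
  \<open>f_poly\<close> is constant on the classes modulo the Stanley--Reisner ideal; \<open>f_hom\<close> is the ring
  homomorphism \<open>f\<^sup>J\<close> it induces.
\<close>

definition f_hom ::
    "'a::euclidean_space set \<Rightarrow> ('v, 'a) multifan \<Rightarrow> ('a \<Rightarrow> real) list \<Rightarrow> 'v set \<Rightarrow> 'v rpoly set \<Rightarrow>
     ('a form \<Rightarrow> real) \<Rightarrow> real" where
  "f_hom N \<Delta> us J x = the_elem (f_poly N \<Delta> us J ` x)"

definition mu ::
    "'a::euclidean_space set \<Rightarrow> ('v, 'a) multifan \<Rightarrow> ('a \<Rightarrow> real) list \<Rightarrow> 'v rpoly set \<Rightarrow> 'v set \<Rightarrow>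
     'a frac set" where
  "mu N \<Delta> us x J = ratfun N (DIM('a) - card J + 1)
     (f_hom N \<Delta> us J x) (f_hom N \<Delta> us J (HT_face \<Delta> J))"

end

theory Submission
  imports Defs
begin

text \<open>
  Put \<open>n = DIM('a)\<close>, \<open>r = n - k + 1\<close>, and let \<open>L\<close> be an \<open>r\<close>-dimensional subspace of \<open>N\<^sub>\<rat>\<close>. For a
  \<open>k\<close>-element simplex \<open>J\<close>, the intersection of a generic \<open>L\<close> with the span of \<open>C(J)\<close> is a line. Let
  \<open>e\<^sub>J\<close> span it. Contracting \<open>\<omega>\<^sub>J\<close> with a basis of \<open>L\<close> produces such a vector, so Laplace expansion
  shows that the value of \<open>f\<^sup>J(x\<^sub>i)\<close> at \<open>L\<close> is the coordinate of \<open>e\<^sub>J\<close> along \<open>v\<^sub>i\<close>, which is \<open>0\<close>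
  for \<open>i \<notin> J\<close>. Hence \<open>\<mu>(x, J)\<close> takes at \<open>L\<close> the value \<open>x(e\<^sub>J) / x\<^sub>J(e\<^sub>J)\<close>, where \<open>x\<close> is read as a
  piecewise polynomial function.

  For a fixed generic rational \<open>L\<close> the theorem therefore says that \<open>x\<close> and
  \<open>\<Sum>\<^sub>J (x(e\<^sub>J) / x\<^sub>J(e\<^sub>J)) x\<^sub>J\<close> have the same class in \<open>H\<^sup>2\<^sup>k(\<Delta>)\<close>. Both sides are linear in \<open>x\<close>, so
  \<open>x\<close> may be a monomial. The two sides agree for the squarefree monomials \<open>x\<^sub>J\<close>, and both vanish if
  the support \<open>K\<close> of \<open>x\<close> is not a simplex. Otherwise \<open>K\<close> is a simplex with fewer than \<open>k\<close>
  elements, some variable \<open>x\<^sub>i\<close> occurs at least twice, and \<open>L\<close> meets the span of \<open>C(K)\<close> only in \<open>0\<close>.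
  So there is a linear form \<open>\<eta>\<close> that vanishes on \<open>L\<close> and satisfies \<open>\<eta>(v\<^sub>i) = 1\<close> and \<open>\<eta>(v\<^sub>j) = 0\<close> for
  the other \<open>j \<in> K\<close> (\<open>form_vanishing_on_plane\<close>). The multiples of \<open>\<eta>\<close> have class \<open>0\<close>, and they
  vanish at every \<open>e\<^sub>J\<close> because \<open>e\<^sub>J \<in> L\<close>. Hence one factor \<open>x\<^sub>i\<close> may be replaced by \<open>x\<^sub>i - \<eta>\<close>, which
  involves only variables outside \<open>K\<close>, so that the support grows. This induction is
  \<open>localization_in_ideal\<close>.

  To pass from points to the function field, choose a basis of the span of the classes of the \<open>x\<^sub>J\<close>
  and compare coefficients. The coefficients on both sides are rational functions on the
  Grassmannian that agree at generic rational points, so they are equal. The required density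
  statement is obtained along lines in the space of \<open>r\<close>-tuples of vectors of \<open>N\<^sub>\<rat>\<close>, where everything is
  a polynomial in one rational parameter (\<open>zero_of_generic_zero\<close>, \<open>zero_on_grass_cone\<close>). Bilinearity
  of the tensor product then gives the theorem (\<open>tensor_expansion\<close>).
\<close>


section \<open>Polynomials\<close>

lemma poly_mapping_decompose:
  fixes p :: "'b \<Rightarrow>\<^sub>0 'c::comm_monoid_add"
  shows "p = (\<Sum>m\<in>Poly_Mapping.keys p. Poly_Mapping.single m (Poly_Mapping.lookup p m))"
proof (rule poly_mapping_eqI)
  fix m
  have "(\<Sum>l\<in>Poly_Mapping.keys p. Poly_Mapping.lookup p l when l = m)
      = (\<Sum>l\<in>Poly_Mapping.keys p. if l = m then Poly_Mapping.lookup p l else 0)"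
    by (intro sum.cong) (auto simp: when_def)
  then show "Poly_Mapping.lookup p m = Poly_Mapping.lookup
      (\<Sum>m\<in>Poly_Mapping.keys p. Poly_Mapping.single m (Poly_Mapping.lookup p m)) m"
    by (simp add: lookup_sum lookup_single sum.delta in_keys_iff)
qed

lemma lookup_const_mult [simp]:
  "Poly_Mapping.lookup (poly_const c * p) m = c * Poly_Mapping.lookup p m"
  unfolding poly_const_def mult_map_scale_conv_mult [symmetric]
  by (simp add: Poly_Mapping.map.rep_eq when_def)

lemma poly_const_mult: "poly_const c * poly_const d = poly_const (c * d)"
  by (simp add: poly_const_def mult_single)

lemma poly_const_add: "poly_const c + poly_const d = poly_const (c + d)"
  by (simp add: poly_const_def single_add)

lemma poly_const_diff: "poly_const c - poly_const d = poly_const (c - d)"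
  by (simp add: poly_const_def single_diff)

lemma poly_const_uminus: "poly_const (- c) = - poly_const c"
  by (simp add: poly_const_def single_uminus)

lemma poly_const_0 [simp]: "poly_const 0 = 0"
  by (simp add: poly_const_def)

lemma poly_const_1 [simp]: "poly_const 1 = 1"
  by (simp add: poly_const_def)

subsection \<open>Evaluation\<close>

definition monomial_eval :: "('v \<Rightarrow> real) \<Rightarrow> ('v \<Rightarrow>\<^sub>0 nat) \<Rightarrow> real" where
  "monomial_eval a m = (\<Prod>i\<in>Poly_Mapping.keys m. a i ^ Poly_Mapping.lookup m i)"

lemma monomial_eval_superset:
  assumes "finite A" "Poly_Mapping.keys m \<subseteq> A"
  shows "monomial_eval a m = (\<Prod>i\<in>A. a i ^ Poly_Mapping.lookup m i)"
  unfolding monomial_eval_def using assms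
  by (intro prod.mono_neutral_left) (auto simp: in_keys_iff)

lemma monomial_eval_add: "monomial_eval a (m + m') = monomial_eval a m * monomial_eval a m'"
proof -
  define A where "A = Poly_Mapping.keys m \<union> Poly_Mapping.keys m'"
  have A: "finite A" "Poly_Mapping.keys m \<subseteq> A" "Poly_Mapping.keys m' \<subseteq> A" "Poly_Mapping.keys (m + m') \<subseteq> A"
    using keys_add [of m m'] by (auto simp: A_def)
  then show ?thesis
    by (simp add: monomial_eval_superset lookup_add power_add prod.distrib)
qed

lemma monomial_eval_0 [simp]: "monomial_eval a 0 = 1"
  by (simp add: monomial_eval_def)

lemma poly_eval_superset:
  assumes "finite A" "Poly_Mapping.keys p \<subseteq> A"
  shows "poly_eval a p = (\<Sum>m\<in>A. of_rat (Poly_Mapping.lookup p m) * monomial_eval a m)"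
  unfolding poly_eval_def monomial_eval_def [symmetric] using assms
  by (intro sum.mono_neutral_left) (auto simp: in_keys_iff)

lemma poly_eval_add: "poly_eval a (p + q) = poly_eval a p + poly_eval a q"
proof -
  define A where "A = Poly_Mapping.keys p \<union> Poly_Mapping.keys q"
  have A: "finite A" "Poly_Mapping.keys p \<subseteq> A" "Poly_Mapping.keys q \<subseteq> A" "Poly_Mapping.keys (p + q) \<subseteq> A"
    using keys_add [of p q] by (auto simp: A_def)
  then show ?thesis
    by (simp add: poly_eval_superset lookup_add of_rat_add algebra_simps sum.distrib)
qed

lemma poly_eval_0 [simp]: "poly_eval a 0 = 0"
  by (simp add: poly_eval_def)

lemma poly_eval_sum: "poly_eval a (sum f A) = (\<Sum>x\<in>A. poly_eval a (f x))"
  by (induction A rule: infinite_finite_induct) (simp_all add: poly_eval_add)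

lemma poly_eval_single: "poly_eval a (Poly_Mapping.single m c) = of_rat c * monomial_eval a m"
  by (simp add: poly_eval_def monomial_eval_def)

lemma poly_eval_mult: "poly_eval a (p * q) = poly_eval a p * poly_eval a q"
proof -
  let ?s = "\<lambda>p m. Poly_Mapping.single m (Poly_Mapping.lookup p m)"
  have "p * q = (\<Sum>m\<in>Poly_Mapping.keys p. ?s p m) * (\<Sum>m\<in>Poly_Mapping.keys q. ?s q m)"
    by (simp flip: poly_mapping_decompose)
  also have "\<dots> = (\<Sum>m\<in>Poly_Mapping.keys p. \<Sum>m'\<in>Poly_Mapping.keys q.
      Poly_Mapping.single (m + m') (Poly_Mapping.lookup p m * Poly_Mapping.lookup q m'))"
    by (simp add: sum_product mult_single)
  also have "poly_eval a \<dots> = (\<Sum>m\<in>Poly_Mapping.keys p. \<Sum>m'\<in>Poly_Mapping.keys q.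
      (of_rat (Poly_Mapping.lookup p m) * monomial_eval a m) *
      (of_rat (Poly_Mapping.lookup q m') * monomial_eval a m'))"
    by (simp add: poly_eval_sum poly_eval_single monomial_eval_add of_rat_mult mult_ac)
  also have "\<dots> = poly_eval a p * poly_eval a q"
    by (simp add: poly_eval_def monomial_eval_def sum_product)
  finally show ?thesis .
qed

lemma poly_eval_const [simp]: "poly_eval a (poly_const c) = of_rat c"
  by (simp add: poly_const_def poly_eval_single)

lemma poly_eval_1 [simp]: "poly_eval a 1 = 1"
  by (simp flip: poly_const_1)

lemma poly_eval_var [simp]: "poly_eval a (poly_var i) = a i"
  by (simp add: poly_var_def poly_eval_single monomial_eval_def)

lemma poly_eval_prod: "poly_eval a (prod f A) = (\<Prod>x\<in>A. poly_eval a (f x))"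
  by (induction A rule: infinite_finite_induct) (simp_all add: poly_eval_mult)

subsection \<open>Polynomials in a set of variables\<close>

lemma poly_ring_simps [simp]:
  "monoid.mult (poly_ring V) = (*)" "monoid.one (poly_ring V) = 1"
  "ring.zero (poly_ring V) = 0" "ring.add (poly_ring V) = (+)"
  by (simp_all add: poly_ring_def)

lemma in_poly_ring:
  "p \<in> carrier (poly_ring V) \<longleftrightarrow> (\<forall>m\<in>Poly_Mapping.keys p. Poly_Mapping.keys m \<subseteq> V)"
  by (simp add: poly_ring_def)

lemma poly_ring_add: "p \<in> carrier (poly_ring V) \<Longrightarrow> q \<in> carrier (poly_ring V) \<Longrightarrow> p + q \<in> carrier (poly_ring V)"
  using keys_add [of p q] by (auto simp: in_poly_ring)

lemma poly_ring_mult: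
  assumes "p \<in> carrier (poly_ring V)" "q \<in> carrier (poly_ring V)"
  shows "p * q \<in> carrier (poly_ring V)"
  unfolding in_poly_ring
proof
  fix m assume "m \<in> Poly_Mapping.keys (p * q)"
  then obtain a b where "m = a + b" "a \<in> Poly_Mapping.keys p" "b \<in> Poly_Mapping.keys q"
    using keys_mult [of p q] by blast
  then have "Poly_Mapping.keys m \<subseteq> Poly_Mapping.keys a \<union> Poly_Mapping.keys b"
      "Poly_Mapping.keys a \<subseteq> V" "Poly_Mapping.keys b \<subseteq> V"
    using assms keys_add [of a b] by (simp_all add: in_poly_ring)
  then show "Poly_Mapping.keys m \<subseteq> V" by blast
qed

lemma poly_ring_single: "Poly_Mapping.keys m \<subseteq> V \<Longrightarrow> Poly_Mapping.single m c \<in> carrier (poly_ring V)"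
  by (simp add: in_poly_ring)

lemma poly_ring_const: "poly_const c \<in> carrier (poly_ring V)"
  by (simp add: poly_const_def poly_ring_single)

lemma poly_ring_var: "i \<in> V \<Longrightarrow> poly_var i \<in> carrier (poly_ring V)"
  by (simp add: poly_var_def poly_ring_single)

lemma poly_ring_0: "0 \<in> carrier (poly_ring V)"
  by (simp add: in_poly_ring)

lemma poly_ring_1: "1 \<in> carrier (poly_ring V)"
  using poly_ring_const [of 1] by simp

lemma poly_ring_uminus: "p \<in> carrier (poly_ring V) \<Longrightarrow> - p \<in> carrier (poly_ring V)"
  by (simp add: in_poly_ring in_keys_iff)

lemma poly_ring_sum: "(\<And>x. x \<in> A \<Longrightarrow> f x \<in> carrier (poly_ring V)) \<Longrightarrow> sum f A \<in> carrier (poly_ring V)"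
  by (induction A rule: infinite_finite_induct) (auto intro: poly_ring_0 poly_ring_add)

lemma poly_ring_prod: "(\<And>x. x \<in> A \<Longrightarrow> f x \<in> carrier (poly_ring V)) \<Longrightarrow> prod f A \<in> carrier (poly_ring V)"
  by (induction A rule: infinite_finite_induct) (auto intro: poly_ring_1 poly_ring_mult)

lemma cring_poly_ring: "cring (poly_ring V)"
proof (rule cringI)
  show "abelian_group (poly_ring V)"
  proof (rule abelian_groupI)
    fix p assume "p \<in> carrier (poly_ring V)"
    then show "\<exists>q\<in>carrier (poly_ring V). q \<oplus>\<^bsub>poly_ring V\<^esub> p = \<zero>\<^bsub>poly_ring V\<^esub>"
      by (intro bexI [of _ "- p"]) (auto intro: poly_ring_uminus)
  qed (auto intro: poly_ring_add poly_ring_0 simp: add_ac)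
  show "Group.comm_monoid (poly_ring V)"
    by (rule comm_monoidI) (auto intro: poly_ring_mult poly_ring_1 simp: mult_ac)
qed (simp add: algebra_simps)

subsection \<open>Monomials\<close>

abbreviation monomial :: "('v \<Rightarrow>\<^sub>0 nat) \<Rightarrow> 'v rpoly" where
  "monomial m \<equiv> Poly_Mapping.single m 1"

definition monomial_degree :: "('v \<Rightarrow>\<^sub>0 nat) \<Rightarrow> nat" where
  "monomial_degree m = (\<Sum>i\<in>Poly_Mapping.keys m. Poly_Mapping.lookup m i)"

lemma monomial_degree_add_single:
  "monomial_degree (m + Poly_Mapping.single j 1) = Suc (monomial_degree m)"
proof -
  define A where "A = insert j (Poly_Mapping.keys m)"
  have *: "monomial_degree l = (\<Sum>i\<in>A. Poly_Mapping.lookup l i)" if "Poly_Mapping.keys l \<subseteq> A" for l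
    unfolding monomial_degree_def using that
    by (intro sum.mono_neutral_left) (auto simp: A_def in_keys_iff)
  have "Poly_Mapping.keys (m + Poly_Mapping.single j 1) \<subseteq> A" "Poly_Mapping.keys m \<subseteq> A"
    using keys_add [of m "Poly_Mapping.single j 1"] by (auto simp: A_def)
  then show ?thesis
    by (simp add: * lookup_add sum.distrib lookup_single when_def sum.delta A_def)
qed

lemma keys_add_nat: "Poly_Mapping.keys (m + m' :: 'v \<Rightarrow>\<^sub>0 nat) = Poly_Mapping.keys m \<union> Poly_Mapping.keys m'"
  by (auto simp: in_keys_iff lookup_add)

lemma monomial_mult_var: "monomial m * poly_var j = monomial (m + Poly_Mapping.single j 1)"
  by (simp add: poly_var_def mult_single)

lemma prod_var_eq_monomial:
  assumes "finite K"
  shows "(\<Prod>i\<in>K. poly_var i) = monomial (\<Sum>i\<in>K. Poly_Mapping.single i 1)"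
  using assms by (induction K) (simp_all add: poly_var_def mult_single)

lemma lookup_sum_single:
  assumes "finite K"
  shows "Poly_Mapping.lookup (\<Sum>i\<in>K. Poly_Mapping.single i (1::nat)) j = (if j \<in> K then 1 else 0)"
  using assms by (simp add: lookup_sum lookup_single when_def sum.delta)

lemma squarefree_monomial:
  assumes "finite K" "Poly_Mapping.keys m = K" "monomial_degree m = card K"
  shows "monomial m = (\<Prod>i\<in>K. poly_var i)"
proof -
  have "Poly_Mapping.lookup m i = 1" if "i \<in> K" for i
  proof (rule ccontr)
    assume "Poly_Mapping.lookup m i \<noteq> 1"
    then have "1 < Poly_Mapping.lookup m i" and ge: "\<And>j. j \<in> K \<Longrightarrow> 1 \<le> Poly_Mapping.lookup m j"
      using that assms(2) by (auto simp: in_keys_iff Suc_le_eq nat_neq_iff)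
    then have "(\<Sum>j\<in>K. 1) < (\<Sum>j\<in>K. Poly_Mapping.lookup m j)"
      using assms(1) that by (intro sum_strict_mono_ex1) auto
    then show False using assms by (simp add: monomial_degree_def)
  qed
  then have "m = (\<Sum>i\<in>K. Poly_Mapping.single i 1)"
    using assms
    by (intro poly_mapping_eqI) (auto simp: lookup_sum_single in_keys_iff simp del: One_nat_def)
  then show ?thesis by (simp add: prod_var_eq_monomial assms)
qed

lemma monomial_eq_multiple:
  assumes "Poly_Mapping.keys m = K"
  shows "\<exists>m'. monomial m = (\<Prod>i\<in>K. poly_var i) * monomial m' \<and> Poly_Mapping.keys m' \<subseteq> K"
proof -
  have fin: "finite K" using assms finite_keys by metis
  define e where "e = (\<Sum>i\<in>K. Poly_Mapping.single i (1::nat))"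
  have "m = e + (m - e)"
    by (rule poly_mapping_eqI)
      (use assms fin in \<open>auto simp: e_def lookup_add lookup_minus lookup_sum_single in_keys_iff simp del: One_nat_def\<close>)
  moreover have "Poly_Mapping.keys (m - e) \<subseteq> K"
    using assms by (auto simp: in_keys_iff lookup_minus)
  ultimately show ?thesis
    by (intro exI [of _ "m - e"])
      (simp add: prod_var_eq_monomial fin mult_single del: One_nat_def flip: e_def)
qed

subsection \<open>Localization along a generic plane\<close>

text \<open>
  The induction on the support of a monomial. The ideal \<open>W\<close> stands for the kernel of the map from
  polynomials to cohomology, and \<open>a J\<close> for the coordinates of the vector \<open>e\<^sub>J\<close> along the rays. The
  hypothesis \<open>linear_form\<close> supplies the coefficients \<open>\<eta>(v\<^sub>j)\<close> of a linear form that vanishes on the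
  plane, hence at every \<open>e\<^sub>J\<close>, and that restricts to the coordinate \<open>x\<^sub>i\<close> on the simplex \<open>K\<close>.
\<close>

lemma localization_in_ideal:
  fixes W :: "'v rpoly set" and a :: "'v set \<Rightarrow> 'v \<Rightarrow> real"
  assumes "finite V" "finite S"
    and W_add: "\<And>p q. p \<in> W \<Longrightarrow> q \<in> W \<Longrightarrow> p + q \<in> W"
    and W_mult: "\<And>p q. p \<in> W \<Longrightarrow> q \<in> carrier (poly_ring V) \<Longrightarrow> q * p \<in> W"
    and W_0: "0 \<in> W"
    and nonface: "\<And>K. K \<subseteq> V \<Longrightarrow> K \<notin> S \<Longrightarrow> (\<Prod>i\<in>K. poly_var i) \<in> W"
    and S_subset: "\<And>J K. J \<in> S \<Longrightarrow> K \<subseteq> J \<Longrightarrow> K \<in> S"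
    and S_le: "\<And>K. K \<in> S \<Longrightarrow> card K < k \<Longrightarrow> \<exists>J\<in>S. card J = k \<and> K \<subseteq> J"
    and SV: "\<And>J. J \<in> S \<Longrightarrow> J \<subseteq> V"
    and a_0: "\<And>J i. J \<in> S \<Longrightarrow> card J = k \<Longrightarrow> i \<in> V - J \<Longrightarrow> a J i = 0"
    and a_nz: "\<And>J i. J \<in> S \<Longrightarrow> card J = k \<Longrightarrow> i \<in> J \<Longrightarrow> a J i \<noteq> 0"
    and linear_form: "\<And>K i. K \<in> S \<Longrightarrow> card K < k \<Longrightarrow> i \<in> K \<Longrightarrow>
      \<exists>c. (\<Sum>j\<in>V. poly_const (c j) * poly_var j) \<in> W \<and>
        (\<forall>j\<in>K. c j = (if j = i then 1 else 0)) \<and>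
        (\<forall>J\<in>S. card J = k \<longrightarrow> (\<Sum>j\<in>V. of_rat (c j) * a J j) = 0)"
    and p: "p \<in> carrier (poly_ring V)" "poly_homogeneous k p"
  shows "\<exists>c. (\<forall>J\<in>S. card J = k \<longrightarrow> of_rat (c J) * (\<Prod>j\<in>J. a J j) = poly_eval (a J) p) \<and>
    p - (\<Sum>J | J \<in> S \<and> card J = k. poly_const (c J) * (\<Prod>j\<in>J. poly_var j)) \<in> W"
proof -
  define X where "X J = (\<Prod>j\<in>J. poly_var j :: 'v rpoly)" for J
  define Sk where "Sk = {J \<in> S. card J = k}"
  have finSk: "finite Sk" using \<open>finite S\<close> by (simp add: Sk_def)
  \<comment> \<open>The coefficients are pinned down by products, not quotients, so that sums and multiples are immediate.\<close>
  define good where "good p \<longleftrightarrow> (\<exists>c. (\<forall>J\<in>Sk. of_rat (c J) * poly_eval (a J) (X J) = poly_eval (a J) p) \<and>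
    p - (\<Sum>J\<in>Sk. poly_const (c J) * X J) \<in> W)" for p
  have good_add: "good (p + q)" if "good p" "good q" for p q
  proof -
    from that obtain c d where
      "\<forall>J\<in>Sk. of_rat (c J) * poly_eval (a J) (X J) = poly_eval (a J) p"
      "\<forall>J\<in>Sk. of_rat (d J) * poly_eval (a J) (X J) = poly_eval (a J) q"
      and W: "p - (\<Sum>J\<in>Sk. poly_const (c J) * X J) \<in> W" "q - (\<Sum>J\<in>Sk. poly_const (d J) * X J) \<in> W"
      unfolding good_def by blast
    then have "\<forall>J\<in>Sk. of_rat (c J + d J) * poly_eval (a J) (X J) = poly_eval (a J) (p + q)"
      by (simp add: of_rat_add distrib_right poly_eval_add)
    moreover have "p + q - (\<Sum>J\<in>Sk. poly_const (c J + d J) * X J) \<in> W"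
      using W_add [OF W] by (simp add: algebra_simps sum.distrib flip: poly_const_add)
    ultimately show ?thesis unfolding good_def by (intro exI [of _ "\<lambda>J. c J + d J"]) blast
  qed
  have good_scale: "good (poly_const e * p)" if "good p" for e p
  proof -
    from that obtain c where
      "\<forall>J\<in>Sk. of_rat (c J) * poly_eval (a J) (X J) = poly_eval (a J) p"
      and W: "p - (\<Sum>J\<in>Sk. poly_const (c J) * X J) \<in> W"
      unfolding good_def by blast
    then have "\<forall>J\<in>Sk. of_rat (e * c J) * poly_eval (a J) (X J) = poly_eval (a J) (poly_const e * p)"
      by (simp add: of_rat_mult poly_eval_mult)
    moreover have "poly_const e * p - (\<Sum>J\<in>Sk. poly_const (e * c J) * X J) \<in> W"
      using W_mult [OF W poly_ring_const [of e]]
      by (simp add: right_diff_distrib sum_distrib_left mult_ac flip: poly_const_mult)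
    ultimately show ?thesis unfolding good_def by (intro exI [of _ "\<lambda>J. e * c J"]) blast
  qed
  have good_W: "good p" if "p \<in> W" "\<And>J. J \<in> Sk \<Longrightarrow> poly_eval (a J) p = 0" for p
    unfolding good_def using that by (intro exI [of _ "\<lambda>J. 0"]) auto
  have good_sum: "good (sum f A)" if "\<And>x. x \<in> A \<Longrightarrow> good (f x)" for f :: "'b \<Rightarrow> _" and A
    using that
    by (induction A rule: infinite_finite_induct) (auto intro: good_W W_0 good_add)
  have evalX: "poly_eval (a J) (X K) = 0" if "J \<in> Sk" "K \<subseteq> V" "\<not> K \<subseteq> J" for J K
  proof -
    obtain i where "i \<in> K" "i \<in> V - J"
      using \<open>K \<subseteq> V\<close> \<open>\<not> K \<subseteq> J\<close> by blast
    moreover have "finite K" using \<open>K \<subseteq> V\<close> \<open>finite V\<close> finite_subset by blast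
    ultimately show ?thesis
      using a_0 [of J i] that(1) by (auto simp: X_def poly_eval_prod Sk_def)
  qed
  have good_monomial: "good (monomial m)" if "Poly_Mapping.keys m \<subseteq> V" "monomial_degree m = k" for m
    using that
  proof (induction "k - card (Poly_Mapping.keys m)" arbitrary: m rule: less_induct)
    case less
    define K where "K = Poly_Mapping.keys m"
    have K: "K \<subseteq> V" "finite K" using less.prems by (auto simp: K_def)
    have "card K = (\<Sum>i\<in>K. 1)" by simp
    also have "\<dots> \<le> k"
      unfolding less.prems(2) [symmetric] monomial_degree_def K_def [symmetric]
      by (rule sum_mono) (auto simp: K_def in_keys_iff)
    finally have le: "card K \<le> k" .
    consider "K \<notin> S" | "K \<in> S" "card K = k" | "K \<in> S" "card K < k" using le by linarith
    then show ?case
    proof cases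
      case 1
      obtain m' where m': "monomial m = X K * monomial m'" "Poly_Mapping.keys m' \<subseteq> K"
        using monomial_eq_multiple [of m K] unfolding X_def K_def by auto
      have "X K \<in> W" unfolding X_def using 1 K nonface by blast
      then have "monomial m \<in> W"
        using W_mult [of "X K" "monomial m'"] m' K by (simp add: poly_ring_single mult.commute)
      moreover have "poly_eval (a J) (monomial m) = 0" if "J \<in> Sk" for J
        using evalX [of J K] that 1 K S_subset unfolding m' by (auto simp: poly_eval_mult Sk_def)
      ultimately show ?thesis by (rule good_W)
    next
      case 2
      then have "K \<in> Sk" by (simp add: Sk_def)
      have mX: "monomial m = X K"
        unfolding X_def using K 2 less.prems by (intro squarefree_monomial) (auto simp: K_def)
      have eval0: "poly_eval (a J) (X K) = 0" if "J \<in> Sk" "J \<noteq> K" for J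
      proof (rule evalX [OF that(1) K(1)])
        show "\<not> K \<subseteq> J"
          using that 2 SV [of J] \<open>finite V\<close> card_subset_eq [of J K] finite_subset [of J V]
          by (auto simp: Sk_def)
      qed
      have sum: "(\<Sum>J\<in>Sk. poly_const (if J = K then 1 else 0) * X J) = X K"
        using finSk \<open>K \<in> Sk\<close> by (simp add: if_distrib if_distribR sum.delta cong: if_cong)
      show ?thesis
        unfolding good_def mX
        by (intro exI [of _ "\<lambda>J. if J = K then 1 else 0"]) (use sum W_0 eval0 in auto)
    next
      case 3
      \<comment> \<open>The degree exceeds the size of the support, so a variable is repeated and one copy of it can be traded.\<close>
      have "\<exists>i\<in>K. Poly_Mapping.lookup m i \<noteq> 1"
      proof (rule ccontr)
        assume "\<not> ?thesis"
        then have "monomial_degree m = card K" by (simp add: monomial_degree_def K_def)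
        then show False using 3 less.prems by simp
      qed
      then obtain i where i: "i \<in> K" "Poly_Mapping.lookup m i \<noteq> 1" by blast
      then have i2: "Poly_Mapping.lookup m i \<ge> 2"
        unfolding K_def in_keys_iff by linarith
      define m' where "m' = m - Poly_Mapping.single i 1"
      have m: "m = m' + Poly_Mapping.single i 1"
        by (rule poly_mapping_eqI) (use i2 in \<open>auto simp: m'_def lookup_add lookup_minus lookup_single when_def\<close>)
      have km': "Poly_Mapping.keys m' = K"
        using i i2 by (auto simp: m'_def K_def in_keys_iff lookup_minus lookup_single when_def split: if_splits)
      have dm': "Suc (monomial_degree m') = k"
        using less.prems(2) monomial_degree_add_single [of m' i, folded m] by simp
      from linear_form [OF 3 i(1)] obtain c where
        cW: "(\<Sum>j\<in>V. poly_const (c j) * poly_var j) \<in> W" (is "?l \<in> W")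
        and cK: "\<And>j. j \<in> K \<Longrightarrow> c j = (if j = i then 1 else 0)"
        and ca: "\<And>J. J \<in> Sk \<Longrightarrow> (\<Sum>j\<in>V. of_rat (c j) * a J j) = 0"
        by (force simp: Sk_def)
      have "V = K \<union> (V - K)" using K by blast
      then have "?l = (\<Sum>j\<in>K. poly_const (c j) * poly_var j) + (\<Sum>j\<in>V - K. poly_const (c j) * poly_var j)"
        using K \<open>finite V\<close> by (metis (no_types, lifting) add.commute sum.subset_diff)
      also have "(\<Sum>j\<in>K. poly_const (c j) * poly_var j) = (\<Sum>j\<in>K. if j = i then poly_var j else 0)"
        by (intro sum.cong) (auto simp: cK)
      also have "\<dots> = poly_var i" using K i by (simp add: sum.delta)
      finally have l: "?l = poly_var i + (\<Sum>j\<in>V - K. poly_const (c j) * poly_var j)" .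
      have "?l * monomial m' = monomial m' * poly_var i +
          (\<Sum>j\<in>V - K. poly_const (c j) * (monomial m' * poly_var j))"
        unfolding l by (simp add: algebra_simps sum_distrib_left)
      also have "\<dots> = monomial m + (\<Sum>j\<in>V - K. poly_const (c j) * monomial (m' + Poly_Mapping.single j 1))"
        unfolding monomial_mult_var m [symmetric] by (rule refl)
      finally have eq: "monomial m = ?l * monomial m' +
          (\<Sum>j\<in>V - K. poly_const (- c j) * monomial (m' + Poly_Mapping.single j 1))"
        by (simp add: poly_const_uminus sum_negf)
      have g1: "good (?l * monomial m')"
      proof (rule good_W)
        show "?l * monomial m' \<in> W"
          using W_mult [OF cW, of "monomial m'"] km' K by (simp add: poly_ring_single mult.commute)
        show "poly_eval (a J) (?l * monomial m') = 0" if "J \<in> Sk" for J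
          using ca [OF that] by (simp add: poly_eval_mult poly_eval_sum)
      qed
      have g2: "good (\<Sum>j\<in>V - K. poly_const (- c j) * monomial (m' + Poly_Mapping.single j 1))"
      proof (intro good_sum good_scale)
        fix j assume j: "j \<in> V - K"
        have k': "Poly_Mapping.keys (m' + Poly_Mapping.single j (1::nat)) = insert j K"
          by (simp add: keys_add_nat km')
        show "good (monomial (m' + Poly_Mapping.single j 1))"
          using j K 3 dm' unfolding K_def [symmetric]
          by (intro less.hyps) (auto simp: k' monomial_degree_add_single simp del: One_nat_def simp flip: K_def)
      qed
      show ?thesis
        by (subst eq) (rule good_add [OF g1 g2])
    qed
  qed
  have "good p"
  proof -
    have "p = (\<Sum>m\<in>Poly_Mapping.keys p. poly_const (Poly_Mapping.lookup p m) * monomial m)"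
      by (subst poly_mapping_decompose) (simp add: poly_const_def mult_single)
    also have "good \<dots>"
      using p by (intro good_sum good_scale good_monomial)
        (auto simp: in_poly_ring poly_homogeneous_def monomial_degree_def)
    finally show ?thesis .
  qed
  then obtain c where c: "\<And>J. J \<in> Sk \<Longrightarrow> of_rat (c J) * poly_eval (a J) (X J) = poly_eval (a J) p"
      "p - (\<Sum>J\<in>Sk. poly_const (c J) * X J) \<in> W"
    unfolding good_def by blast
  have "poly_eval (a J) (X J) = (\<Prod>j\<in>J. a J j)" for J
    by (simp add: X_def poly_eval_prod)
  then have "\<forall>J\<in>S. card J = k \<longrightarrow> of_rat (c J) * (\<Prod>j\<in>J. a J j) = poly_eval (a J) p"
    using c(1) by (simp add: Sk_def)
  moreover have "p - (\<Sum>J | J \<in> S \<and> card J = k. poly_const (c J) * (\<Prod>j\<in>J. poly_var j)) \<in> W"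
    using c(2) by (simp only: X_def Sk_def)
  ultimately show ?thesis by blast
qed


section \<open>The cohomology ring as a quotient of the polynomial ring\<close>

text \<open>
  The composite of both quotient maps. Working with representatives reduces every equation in
  cohomology to membership of a polynomial in one ideal.
\<close>

definition coh :: "'a::euclidean_space set \<Rightarrow> ('v, 'a) multifan \<Rightarrow> 'v rpoly \<Rightarrow> 'v rpoly set set" where
  "coh N \<Delta> p = bar N \<Delta> (HT_class \<Delta> p)"

definition coh_kernel :: "'a::euclidean_space set \<Rightarrow> ('v, 'a) multifan \<Rightarrow> 'v rpoly set" where
  "coh_kernel N \<Delta> = {p \<in> carrier (poly_ring (vertices \<Delta>)). coh N \<Delta> p = \<zero>\<^bsub>H N \<Delta>\<^esub>}"

lemma SR_generators:
  "{\<Prod>i\<in>K. poly_var i | K. K \<subseteq> vertices \<Delta> \<and> K \<notin> simplices \<Delta>} \<subseteq> carrier (poly_ring (vertices \<Delta>))"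
  by (auto intro!: poly_ring_prod poly_ring_var)

lemma ideal_SR_ideal: "ideal (SR_ideal \<Delta>) (poly_ring (vertices \<Delta>))"
  unfolding SR_ideal_def
  using SR_generators by (rule ring.genideal_ideal [OF cring.axioms(1) [OF cring_poly_ring]])

lemma SR_ideal_nonface:
  assumes "K \<subseteq> vertices \<Delta>" "K \<notin> simplices \<Delta>"
  shows "(\<Prod>i\<in>K. poly_var i) \<in> SR_ideal \<Delta>"
  unfolding SR_ideal_def
  using ring.genideal_self [OF cring.axioms(1) [OF cring_poly_ring] SR_generators [of \<Delta>]] assms by auto

lemma cring_HT: "cring (HT \<Delta>)"
  unfolding HT_def by (rule ideal.quotient_is_cring [OF ideal_SR_ideal cring_poly_ring])

lemma HT_class_hom: "HT_class \<Delta> \<in> Ring.ring_hom (poly_ring (vertices \<Delta>)) (HT \<Delta>)"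
proof -
  have "HT_class \<Delta> = (+>\<^bsub>poly_ring (vertices \<Delta>)\<^esub>) (SR_ideal \<Delta>)"
    by (simp add: HT_class_def fun_eq_iff)
  then show ?thesis
    unfolding HT_def using ideal.rcos_ring_hom [OF ideal_SR_ideal] by simp
qed

lemma HT_class_closed: "p \<in> carrier (poly_ring (vertices \<Delta>)) \<Longrightarrow> HT_class \<Delta> p \<in> carrier (HT \<Delta>)"
  using ring_hom_closed [OF HT_class_hom] .

lemma linear_form_in_poly_ring:
  "(\<Sum>i\<in>vertices \<Delta>. poly_const (c i) * poly_var i) \<in> carrier (poly_ring (vertices \<Delta>))"
  by (intro poly_ring_sum poly_ring_mult poly_ring_const poly_ring_var)

lemma HT_plus_closed: "HT_plus N \<Delta> \<subseteq> carrier (HT \<Delta>)"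
proof
  interpret cring "HT \<Delta>" by (rule cring_HT)
  show "X \<in> carrier (HT \<Delta>)" if "X \<in> HT_plus N \<Delta>" for X
    using that
    by induction (auto simp: HT_linear_def intro!: HT_class_closed linear_form_in_poly_ring)
qed

lemma ideal_HT_plus_ideal: "ideal (HT_plus_ideal N \<Delta>) (HT \<Delta>)"
  unfolding HT_plus_ideal_def
  using HT_plus_closed by (rule ring.genideal_ideal [OF cring.axioms(1) [OF cring_HT]])

lemma cring_H: "cring (H N \<Delta>)"
  unfolding H_def by (rule ideal.quotient_is_cring [OF ideal_HT_plus_ideal cring_HT])

lemma bar_hom: "bar N \<Delta> \<in> Ring.ring_hom (HT \<Delta>) (H N \<Delta>)"
proof -
  have "bar N \<Delta> = (+>\<^bsub>HT \<Delta>\<^esub>) (HT_plus_ideal N \<Delta>)"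
    by (simp add: bar_def fun_eq_iff)
  then show ?thesis
    unfolding H_def using ideal.rcos_ring_hom [OF ideal_HT_plus_ideal] by simp
qed

lemma coh_hom: "ring_hom_cring (poly_ring (vertices \<Delta>)) (H N \<Delta>) (coh N \<Delta>)"
proof -
  have "coh N \<Delta> = bar N \<Delta> \<circ> HT_class \<Delta>" by (simp add: coh_def fun_eq_iff)
  then have "coh N \<Delta> \<in> Ring.ring_hom (poly_ring (vertices \<Delta>)) (H N \<Delta>)"
    using ring_hom_trans [OF HT_class_hom bar_hom] by simp
  then show ?thesis
    by (simp add: ring_hom_cring_def ring_hom_cring_axioms_def cring_poly_ring cring_H)
qed

lemma SR_ideal_subset: "SR_ideal \<Delta> \<subseteq> coh_kernel N \<Delta>"
proof
  fix p assume p: "p \<in> SR_ideal \<Delta>"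
  interpret ideal "SR_ideal \<Delta>" "poly_ring (vertices \<Delta>)" by (rule ideal_SR_ideal)
  have "p \<in> carrier (poly_ring (vertices \<Delta>))" using p a_subset by blast
  moreover have "HT_class \<Delta> p = \<zero>\<^bsub>HT \<Delta>\<^esub>"
    using a_rcos_const [OF p] by (simp add: HT_class_def HT_def FactRing_def)
  ultimately show "p \<in> coh_kernel N \<Delta>"
    using ring_hom_zero [OF bar_hom cring.axioms(1) [OF cring_HT] cring.axioms(1) [OF cring_H]]
    by (simp add: coh_kernel_def coh_def)
qed

lemma linear_form_in_coh_kernel:
  assumes "u \<in> dual_rat N"
    and c: "\<And>i. i \<in> vertices \<Delta> \<Longrightarrow> u (ray_vector N \<Delta> i) = of_rat (c i)"
  shows "(\<Sum>i\<in>vertices \<Delta>. poly_const (c i) * poly_var i) \<in> coh_kernel N \<Delta>"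
proof -
  interpret ideal "HT_plus_ideal N \<Delta>" "HT \<Delta>" by (rule ideal_HT_plus_ideal)
  have "the_inv of_rat (u (ray_vector N \<Delta> i)) = c i" if "i \<in> vertices \<Delta>" for i
    unfolding c [OF that] by (rule the_inv_f_f) (auto simp: inj_def)
  then have "HT_linear N \<Delta> u = HT_class \<Delta> (\<Sum>i\<in>vertices \<Delta>. poly_const (c i) * poly_var i)"
    by (simp add: HT_linear_def)
  moreover have "HT_linear N \<Delta> u \<in> HT_plus_ideal N \<Delta>"
    using ring.genideal_self [OF cring.axioms(1) [OF cring_HT] HT_plus_closed] HT_plus.lin [OF assms(1)]
    by (auto simp: HT_plus_ideal_def)
  ultimately show ?thesis
    using a_rcos_const linear_form_in_poly_ring [of c \<Delta>]
    by (simp add: coh_kernel_def coh_def bar_def H_def FactRing_def)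
qed

context
  fixes N :: "'a::euclidean_space set" and \<Delta> :: "('v, 'a) multifan"
begin

interpretation coh: ring_hom_cring "poly_ring (vertices \<Delta>)" "H N \<Delta>" "coh N \<Delta>"
  by (rule coh_hom)

lemma coh_add:
  "p \<in> carrier (poly_ring (vertices \<Delta>)) \<Longrightarrow> q \<in> carrier (poly_ring (vertices \<Delta>)) \<Longrightarrow>
    coh N \<Delta> (p + q) = coh N \<Delta> p \<oplus>\<^bsub>H N \<Delta>\<^esub> coh N \<Delta> q"
  using coh.hom_add [of p q] by simp

lemma coh_const_mult:
  "p \<in> carrier (poly_ring (vertices \<Delta>)) \<Longrightarrow>
    coh N \<Delta> (poly_const c * p) = coh N \<Delta> (poly_const c) \<otimes>\<^bsub>H N \<Delta>\<^esub> coh N \<Delta> p"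
  using coh.hom_mult [of "poly_const c" p] by (simp add: poly_ring_const)

lemma coh_kernel_add: "p \<in> coh_kernel N \<Delta> \<Longrightarrow> q \<in> coh_kernel N \<Delta> \<Longrightarrow> p + q \<in> coh_kernel N \<Delta>"
  by (simp add: coh_kernel_def poly_ring_add coh_add)

lemma coh_kernel_mult:
  "p \<in> coh_kernel N \<Delta> \<Longrightarrow> q \<in> carrier (poly_ring (vertices \<Delta>)) \<Longrightarrow> q * p \<in> coh_kernel N \<Delta>"
  using coh.hom_mult [of q p] by (simp add: coh_kernel_def poly_ring_mult)

lemma coh_kernel_0: "0 \<in> coh_kernel N \<Delta>"
  using coh.hom_zero by (simp add: coh_kernel_def poly_ring_0)

lemma coh_eqI:
  assumes "p \<in> carrier (poly_ring (vertices \<Delta>))" "q \<in> carrier (poly_ring (vertices \<Delta>))"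
    and "p - q \<in> coh_kernel N \<Delta>"
  shows "coh N \<Delta> p = coh N \<Delta> q"
  using coh_add [of "p - q" q] assms by (simp add: coh_kernel_def)

end

text \<open>
  Evaluation at \<open>a\<close> factors through the Stanley--Reisner ring when \<open>a\<close> kills all monomials of
  non-faces. This makes \<open>f\<^sup>J\<close> well defined.
\<close>

lemma HT_class_eval_const:
  assumes "p \<in> carrier (poly_ring (vertices \<Delta>))"
    and "\<And>K. K \<subseteq> vertices \<Delta> \<Longrightarrow> K \<notin> simplices \<Delta> \<Longrightarrow> (\<Prod>i\<in>K. a i) = 0"
    and "q \<in> HT_class \<Delta> p"
  shows "poly_eval a q = poly_eval a p"
proof -
  let ?R = "poly_ring (vertices \<Delta>)"
  let ?Z = "{p \<in> carrier ?R. poly_eval a p = 0}"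
  interpret R: cring ?R by (rule cring_poly_ring)
  have inv: "\<ominus>\<^bsub>?R\<^esub> p = - p" if "p \<in> carrier ?R" for p
    by (rule R.minus_equality) (use that in \<open>auto simp: poly_ring_uminus\<close>)
  have "ideal ?Z ?R"
  proof (rule idealI)
    show "subgroup ?Z (add_monoid ?R)"
    proof (rule group.subgroupI)
      show "group (add_monoid ?R)" by (rule R.a_group)
      show "?Z \<noteq> {}" using poly_ring_0 [of "vertices \<Delta>"] by (auto intro: exI [of _ 0])
      fix p assume p: "p \<in> ?Z"
      have "poly_eval a (- p) = 0" using p poly_eval_add [of a p "- p"] by simp
      moreover have "inv\<^bsub>add_monoid ?R\<^esub> p = - p"
        using inv p by (simp only: a_inv_def mem_Collect_eq)
      ultimately show "inv\<^bsub>add_monoid ?R\<^esub> p \<in> ?Z"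
        using p by (simp only: mem_Collect_eq poly_ring_uminus simp_thms)
    qed (auto simp: poly_eval_add poly_ring_add)
  qed (auto simp: R.ring_axioms poly_eval_mult poly_ring_mult)
  moreover have "{\<Prod>i\<in>K. poly_var i | K. K \<subseteq> vertices \<Delta> \<and> K \<notin> simplices \<Delta>} \<subseteq> ?Z"
    using SR_generators [of \<Delta>] assms(2) by (auto simp: poly_eval_prod)
  ultimately have Z: "SR_ideal \<Delta> \<subseteq> ?Z"
    unfolding SR_ideal_def by (rule R.genideal_minimal)
  from assms(3) obtain h where "h \<in> SR_ideal \<Delta>" "q = h + p"
    by (auto simp: HT_class_def a_r_coset_def r_coset_def)
  then show ?thesis using Z by (auto simp: poly_eval_add)
qed

lemma HT_class_self:
  assumes "p \<in> carrier (poly_ring (vertices \<Delta>))"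
  shows "p \<in> HT_class \<Delta> p"
proof -
  interpret ideal "SR_ideal \<Delta>" "poly_ring (vertices \<Delta>)" by (rule ideal_SR_ideal)
  show ?thesis unfolding HT_class_def by (rule a_rcos_self [OF assms])
qed

subsection \<open>The module structure on a graded piece\<close>

lemma H_deg_simps [simp]:
  "ring.add (H_deg N \<Delta> k) = ring.add (H N \<Delta>)"
  "c \<odot>\<^bsub>H_deg N \<Delta> k\<^esub> X = coh N \<Delta> (poly_const c) \<otimes>\<^bsub>H N \<Delta>\<^esub> X"
  by (simp_all add: H_deg_def coh_def)

lemma coh_in_H_deg:
  "p \<in> carrier (poly_ring (vertices \<Delta>)) \<Longrightarrow> poly_homogeneous k p \<Longrightarrow> coh N \<Delta> p \<in> carrier (H_deg N \<Delta> k)"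
  by (auto simp: H_deg_def HT_deg_def coh_def)

lemma poly_homogeneous_add:
  "poly_homogeneous k p \<Longrightarrow> poly_homogeneous k q \<Longrightarrow> poly_homogeneous k (p + q)"
  using keys_add [of p q] unfolding poly_homogeneous_def by blast

lemma poly_homogeneous_const_mult:
  assumes "poly_homogeneous k p" shows "poly_homogeneous k (poly_const c * p)"
  using assms by (simp add: poly_homogeneous_def in_keys_iff)

lemma poly_homogeneous_0: "poly_homogeneous k 0"
  by (simp add: poly_homogeneous_def)

lemma poly_homogeneous_face:
  assumes "finite J" shows "poly_homogeneous (card J) (\<Prod>j\<in>J. poly_var j)"
proof -
  have "Poly_Mapping.keys (\<Sum>i\<in>J. Poly_Mapping.single i (1::nat)) = J"
    unfolding set_eq_iff in_keys_iff lookup_sum_single [OF assms] by simp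
  then show ?thesis
    using assms by (simp add: poly_homogeneous_def prod_var_eq_monomial lookup_sum_single del: One_nat_def)
qed


section \<open>Lattices and primitive vectors\<close>

text \<open>
  The ambient space over the rationals: that a dual basis takes rational values on the lattice is a
  statement about rational spans.
\<close>

interpretation rat_scaled: vector_space "\<lambda>(q::rat) (x::'a::real_vector). of_rat q *\<^sub>R x"
  by unfold_locales (simp_all add: of_rat_add of_rat_mult algebra_simps)

lemma independent_imp_rat_independent:
  assumes "independent (S::'a::real_vector set)" shows "rat_scaled.independent S"
  unfolding rat_scaled.independent_explicit_module
proof (intro allI impI)
  fix t u v assume t: "finite t" "t \<subseteq> S" "(\<Sum>v\<in>t. real_of_rat (u v) *\<^sub>R v) = 0" "v \<in> t"
  have "real_of_rat (u v) = 0"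
    by (rule independentD [OF assms t(1,2,3,4)])
  then show "u v = 0" by simp
qed

lemma linear_rational_on_rat_span:
  assumes "linear f" "\<And>x. x \<in> S \<Longrightarrow> f x \<in> \<rat>" "x \<in> rat_scaled.span S"
  shows "f x \<in> (\<rat>::real set)"
  using assms(3)
proof (induction rule: rat_scaled.span_induct_alt)
  case base then show ?case using linear_0 [OF assms(1)] by simp
next
  case (step c x y)
  then show ?case using assms by (simp add: linear_add linear_cmul)
qed

context
  fixes N :: "'a::euclidean_space set"
  assumes N: "full_lattice N"
begin

lemma lattice_basis:
  obtains B where "independent B" "span B = UNIV" "finite B" "card B = DIM('a)"
    "N = {v. \<exists>c :: 'a \<Rightarrow> int. v = (\<Sum>b\<in>B. of_int (c b) *\<^sub>R b)}" "B \<subseteq> N"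
proof -
  from N obtain B where B: "independent B" "span B = UNIV"
    "N = {v. \<exists>c :: 'a \<Rightarrow> int. v = (\<Sum>b\<in>B. of_int (c b) *\<^sub>R b)}"
    unfolding full_lattice_def by (elim exE conjE)
  have fin: "finite B" using B(1) by (rule independent_imp_finite)
  have "card B = DIM('a)" using B(1,2) by (metis dim_UNIV dim_span_eq_card_independent)
  moreover have "B \<subseteq> N"
  proof
    fix b assume b: "b \<in> B"
    have "(\<Sum>x\<in>B. of_int ((\<lambda>x. if x = b then 1 else 0) x) *\<^sub>R x) = (\<Sum>x\<in>B. if x = b then x else 0)"
      by (intro sum.cong) auto
    also have "\<dots> = b" using fin b by simp
    finally show "b \<in> N" unfolding B(3) by (intro CollectI exI [of _ "\<lambda>x. if x = b then 1 else 0"]) simp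
  qed
  ultimately show ?thesis using that B fin by blast
qed

lemma lattice_comb:
  assumes "x \<in> N" "y \<in> N" shows "of_int a *\<^sub>R x + of_int b *\<^sub>R y \<in> N"
proof -
  obtain B where B: "N = {v. \<exists>c :: 'a \<Rightarrow> int. v = (\<Sum>b\<in>B. of_int (c b) *\<^sub>R b)}"
    by (rule lattice_basis)
  from assms obtain c d where "x = (\<Sum>b\<in>B. of_int (c b) *\<^sub>R b)" "y = (\<Sum>b\<in>B. of_int (d b) *\<^sub>R b)"
    unfolding B by (elim CollectE exE)
  then have "of_int a *\<^sub>R x + of_int b *\<^sub>R y = (\<Sum>e\<in>B. of_int (a * c e + b * d e) *\<^sub>R e)"
    by (simp add: scaleR_sum_right sum.distrib algebra_simps)
  then show ?thesis unfolding B by (intro CollectI exI)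
qed

text \<open>
  A nonzero vector has a nonzero coordinate with respect to a lattice basis; such a coordinate is
  integral on the lattice.
\<close>

lemma lattice_coordinate:
  assumes "x \<noteq> 0"
  obtains u where "linear u" "\<And>y. y \<in> N \<Longrightarrow> u y \<in> \<int>" "u x \<noteq> (0::real)"
proof -
  obtain B where B: "independent B" "span B = UNIV" "finite B"
    "N = {v. \<exists>c :: 'a \<Rightarrow> int. v = (\<Sum>b\<in>B. of_int (c b) *\<^sub>R b)}"
    by (rule lattice_basis)
  define u where "u b y = representation B y b" for b y
  have lin: "linear (u b)" for b
    unfolding u_def using B by (intro linearI) (auto simp: representation_add representation_scale)
  have x: "x = (\<Sum>b\<in>B. u b x *\<^sub>R b)"
    unfolding u_def using B by (simp add: sum_representation_eq)
  have ub: "u b b' = (if b' = b then 1 else 0)" if "b' \<in> B" for b b'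
    unfolding u_def using representation_basis [OF B(1) that] by auto
  obtain b where b: "b \<in> B" "u b x \<noteq> 0"
  proof (rule ccontr)
    assume "\<not> thesis"
    then have "\<forall>b\<in>B. u b x = 0" using that by blast
    then have "x = 0" by (subst x) simp
    then show False using assms by simp
  qed
  have "u b y \<in> \<int>" if y: "y \<in> N" for y
  proof -
    from y obtain c :: "'a \<Rightarrow> int" where "y = (\<Sum>b\<in>B. of_int (c b) *\<^sub>R b)" unfolding B by blast
    then have "u b y = (\<Sum>b'\<in>B. of_int (c b') * u b b')"
      using lin [of b] by (simp add: linear_sum linear_cmul)
    also have "\<dots> = (\<Sum>b'\<in>B. if b' = b then of_int (c b') else 0)"
      by (intro sum.cong) (auto simp: ub)
    also have "\<dots> = of_int (c b)" using B b by simp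
    finally show ?thesis by simp
  qed
  then show ?thesis using that lin b by blast
qed

text \<open>
  If \<open>x = m w\<close> with \<open>w\<close> in the lattice, then \<open>m\<close> is bounded by any nonzero integral coordinate of
  \<open>x\<close>. For the largest such \<open>m\<close> the vector \<open>w\<close> is primitive.
\<close>

lemma primitive_multiple:
  assumes "x \<in> N" "x \<noteq> 0"
  obtains w m where "is_primitive_vector N w" "m > 0" "x = real m *\<^sub>R w"
proof -
  obtain u where u: "linear u" "\<And>y. y \<in> N \<Longrightarrow> u y \<in> \<int>" "u x \<noteq> (0::real)"
    using lattice_coordinate [OF assms(2)] by blast
  define S where "S = {m. \<exists>w\<in>N. x = real m *\<^sub>R w}"
  have bound: "real m \<le> \<bar>u x\<bar>" if "m \<in> S" for m
  proof -
    from that obtain w where w: "w \<in> N" "x = real m *\<^sub>R w" by (auto simp: S_def)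
    have eq: "u x = real m * u w" using w u(1) by (simp add: linear_cmul)
    then have "u w \<noteq> 0" using u(3) by auto
    then have "1 \<le> \<bar>u w\<bar>" using u(2) [OF w(1)] by (meson Ints_nonzero_abs_ge1)
    then show ?thesis using mult_left_mono [of 1 "\<bar>u w\<bar>" "real m"] by (simp add: eq abs_mult)
  qed
  have "finite S"
  proof (rule finite_subset)
    show "S \<subseteq> {..nat \<lfloor>\<bar>u x\<bar>\<rfloor>}"
      using bound by (auto simp: le_nat_iff le_floor_iff)
  qed simp
  moreover have "1 \<in> S" using assms by (auto simp: S_def)
  ultimately have M: "Max S \<in> S" "1 \<le> Max S" by (auto intro: Max_in)
  then obtain w where w: "w \<in> N" "x = real (Max S) *\<^sub>R w" by (auto simp: S_def)
  have "is_primitive_vector N w"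
    unfolding is_primitive_vector_def
  proof (intro conjI ballI allI impI)
    show "w \<noteq> 0" using w assms by auto
    fix w' m assume w': "w' \<in> N" "w = real m *\<^sub>R w'"
    then have "x = real (Max S * m) *\<^sub>R w'" using w by simp
    then have "Max S * m \<in> S" using w' unfolding S_def by blast
    then have "Max S * m \<le> Max S" using \<open>finite S\<close> by simp
    then have "m \<le> 1" using M(2) by simp
    moreover have "m \<noteq> 0" using w' w assms by auto
    ultimately show "m = 1" by simp
  qed (use w in auto)
  moreover have "Max S > 0" using M(2) by simp
  ultimately show ?thesis using that w(2) by blast
qed

text \<open>
  The factor is a rational number \<open>p/q\<close> in lowest terms. By Bezout the lattice contains a vector \<open>z\<close>
  with \<open>v = q z\<close> and \<open>w = p z\<close>, and primitivity forces \<open>p = q = 1\<close>.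
\<close>

lemma primitive_vectors_proportional:
  assumes "is_primitive_vector N v" "is_primitive_vector N w" "w = r *\<^sub>R v" "r > 0"
  shows "w = v"
proof -
  have v: "v \<in> N" "v \<noteq> 0" and w: "w \<in> N" using assms by (auto simp: is_primitive_vector_def)
  obtain u where u: "linear u" "\<And>y. y \<in> N \<Longrightarrow> u y \<in> \<int>" "u v \<noteq> (0::real)"
    using lattice_coordinate [OF v(2)] by blast
  have "u w = r * u v" using assms u by (simp add: linear_cmul)
  then have "r = u w / u v" using u by simp
  moreover have "u w \<in> \<rat>" "u v \<in> \<rat>" using u(2) v w Ints_subset_Rats by blast+
  ultimately have "r \<in> \<rat>" by simp
  then obtain p q :: nat where pq: "q \<noteq> 0" "\<bar>r\<bar> = real p / real q" "coprime p q"
    by (rule Rats_abs_nat_div_natE)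
  then have r: "r = real p / real q" using assms(4) by simp
  obtain a b where ab: "a * int p + b * int q = 1"
    using pq(3) bezout_int [of "int p" "int q"] by (metis coprime_int_iff coprime_imp_gcd_eq_1)
  have abr: "of_int a * real p + of_int b * real q = 1"
    using arg_cong [OF ab, of real_of_int] by simp
  define z where "z = of_int a *\<^sub>R w + of_int b *\<^sub>R v"
  have z: "z \<in> N" unfolding z_def by (rule lattice_comb [OF w v(1)])
  have "real q *\<^sub>R z = (of_int a * real p + of_int b * real q) *\<^sub>R v"
    using pq(1) by (simp add: z_def assms(3) r algebra_simps)
  then have vz: "v = real q *\<^sub>R z" using abr by simp
  then have "q = 1" using assms(1) z by (auto simp: is_primitive_vector_def)
  moreover have "w = real p *\<^sub>R z" using vz pq(1) by (simp add: assms(3) r)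
  then have "p = 1" using assms(2) z by (auto simp: is_primitive_vector_def)
  ultimately show ?thesis using assms(3) r by simp
qed

text \<open>
  Vectors that are independent over the reals are independent over the rationals, and the lattice
  lies in a rational space of dimension \<open>n\<close>, so \<open>n\<close> of them already span it.
\<close>

lemma rat_span_eq_of_independent:
  assumes "independent (v ` I)" "inj_on v I" "card I = DIM('a)" "v ` I \<subseteq> N"
  shows "N \<subseteq> rat_scaled.span (v ` I)"
proof -
  obtain B where B: "independent B" "span B = UNIV" "finite B" "card B = DIM('a)"
    "N = {v. \<exists>c :: 'a \<Rightarrow> int. v = (\<Sum>b\<in>B. of_int (c b) *\<^sub>R b)}" "B \<subseteq> N"
    by (rule lattice_basis)
  have NB: "N \<subseteq> rat_scaled.span B"
  proof
    fix x assume "x \<in> N"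
    then obtain c :: "'a \<Rightarrow> int" where "x = (\<Sum>b\<in>B. of_rat (of_int (c b)) *\<^sub>R b)" unfolding B by auto
    also have "\<dots> \<in> rat_scaled.span B"
      by (intro rat_scaled.span_sum rat_scaled.span_scale rat_scaled.span_base)
    finally show "x \<in> rat_scaled.span B" .
  qed
  have ind: "rat_scaled.independent (v ` I)" by (rule independent_imp_rat_independent [OF assms(1)])
  have "B \<subseteq> rat_scaled.span (v ` I)"
  proof (rule ccontr)
    assume "\<not> ?thesis"
    then obtain b where b: "b \<in> B" "b \<notin> rat_scaled.span (v ` I)" by blast
    have "finite I" using assms(3) by (metis DIM_positive card.infinite less_numeral_extra(3))
    have "rat_scaled.independent (insert b (v ` I))"
      using ind b by (simp add: rat_scaled.independent_insertI)
    moreover have "insert b (v ` I) \<subseteq> rat_scaled.span B"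
      using b NB assms(4) B(6) by blast
    ultimately have "card (insert b (v ` I)) \<le> card B"
      using rat_scaled.independent_span_bound [OF B(3)] by blast
    moreover have "b \<notin> v ` I" using b(2) by (auto intro: rat_scaled.span_base)
    ultimately show False
      using \<open>finite I\<close> assms B(4) by (simp add: card_image)
  qed
  then have "rat_scaled.span B \<subseteq> rat_scaled.span (v ` I)"
    by (rule rat_scaled.span_minimal) (rule rat_scaled.subspace_span)
  with NB show ?thesis by (rule subset_trans)
qed

lemma dual_rat_integral_multiple:
  assumes "u \<in> dual_rat N"
  obtains m :: nat where "m > 0" "(\<lambda>x. real m * u x) \<in> dual_lattice N"
proof -
  obtain B where B: "finite B" "B \<subseteq> N"
    "N = {v. \<exists>c :: 'a \<Rightarrow> int. v = (\<Sum>b\<in>B. of_int (c b) *\<^sub>R b)}"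
    by (rule lattice_basis)
  have lin: "linear u" using assms by (simp add: dual_rat_def)
  have "\<exists>m::nat. m > 0 \<and> real m * u b \<in> \<int>" if "b \<in> B" for b
  proof -
    have "u b \<in> \<rat>" using assms that B by (auto simp: dual_rat_def)
    then obtain p and q :: int where pq: "q > 0" "u b = of_int p / of_int q"
      by (metis Rats_cases')
    then have "real (nat q) * u b = of_int p" by simp
    then show ?thesis using pq(1) by (intro exI [of _ "nat q"]) auto
  qed
  then obtain d :: "'a \<Rightarrow> nat" where d: "\<And>b. b \<in> B \<Longrightarrow> d b > 0 \<and> real (d b) * u b \<in> \<int>"
    by metis
  define m where "m = (\<Prod>b\<in>B. d b)"
  have mb: "real m * u b \<in> \<int>" if "b \<in> B" for b
  proof -
    have "m = (\<Prod>b\<in>B - {b}. d b) * d b"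
      unfolding m_def using prod.remove [OF B(1) that, of d] by (simp add: mult.commute)
    then have "real m * u b = real (\<Prod>b\<in>B - {b}. d b) * (real (d b) * u b)" by simp
    then show ?thesis using d [OF that] by (metis Ints_mult Ints_of_nat)
  qed
  have "(\<lambda>x. real m * u x) \<in> dual_lattice N"
    unfolding dual_lattice_def
  proof (intro CollectI conjI ballI)
    show "linear (\<lambda>x. real m * u x)"
      using lin by (intro linearI) (simp_all add: linear_add linear_cmul algebra_simps)
    fix x assume "x \<in> N"
    then obtain c :: "'a \<Rightarrow> int" where "x = (\<Sum>b\<in>B. of_int (c b) *\<^sub>R b)" unfolding B by blast
    then have "real m * u x = (\<Sum>b\<in>B. of_int (c b) * (real m * u b))"
      using lin by (simp add: linear_sum linear_cmul sum_distrib_left mult_ac)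
    also have "\<dots> \<in> \<int>" by (intro Ints_sum Ints_mult [OF Ints_of_int mb])
    finally show "real m * u x \<in> \<int>" .
  qed
  moreover have "m > 0" unfolding m_def using d by (intro prod_pos) blast
  ultimately show ?thesis using that by blast
qed

end

lemma dual_lattice_subset: "dual_lattice N \<subseteq> dual_rat N"
  unfolding dual_lattice_def dual_rat_def using Ints_subset_Rats by blast

lemma lattice_subset_lattice_rat: "N \<subseteq> lattice_rat N"
  by (auto simp: lattice_rat_def intro: exI [of _ 1])

lemma dual_rat_lattice_rat:
  assumes "u \<in> dual_rat N" "w \<in> lattice_rat N" shows "u w \<in> \<rat>"
proof -
  obtain m :: nat where m: "m \<noteq> 0" "real m *\<^sub>R w \<in> N" using assms(2) by (auto simp: lattice_rat_def)
  have "real m * u w \<in> \<rat>"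
    using assms(1) m(2) by (auto simp: dual_rat_def linear_cmul dest!: bspec)
  then have "(real m * u w) / real m \<in> \<rat>" by (intro Rats_divide) auto
  then show ?thesis using m by simp
qed

lemma lattice_rat_comb:
  assumes N: "full_lattice N" and "x \<in> lattice_rat N" "y \<in> lattice_rat N" "a \<in> \<rat>" "b \<in> \<rat>"
  shows "a *\<^sub>R x + b *\<^sub>R y \<in> lattice_rat N"
proof -
  obtain m l :: nat where m: "m \<noteq> 0" "real m *\<^sub>R x \<in> N" "l \<noteq> 0" "real l *\<^sub>R y \<in> N"
    using assms(2,3) by (auto simp: lattice_rat_def)
  obtain p q :: int where pq: "q > 0" "a = of_int p / of_int q" using \<open>a \<in> \<rat>\<close> by (metis Rats_cases')
  obtain p' q' :: int where pq': "q' > 0" "b = of_int p' / of_int q'" using \<open>b \<in> \<rat>\<close> by (metis Rats_cases')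
  define s where "s = m * l * nat q * nat q'"
  have "real s *\<^sub>R (a *\<^sub>R x + b *\<^sub>R y) =
      of_int (int l * p * q') *\<^sub>R (real m *\<^sub>R x) + of_int (int m * p' * q) *\<^sub>R (real l *\<^sub>R y)"
    using pq pq' by (simp add: s_def algebra_simps)
  also have "\<dots> \<in> N" by (rule lattice_comb [OF N m(2,4)])
  finally show ?thesis
    using m pq(1) pq'(1) unfolding lattice_rat_def
    by (intro CollectI exI [of _ s] conjI) (simp_all add: s_def)
qed


section \<open>The rays of a simplicial multi-fan\<close>

locale simplicial_fan =
  fixes N :: "'a::euclidean_space set" and \<Delta> :: "('v, 'a) multifan"
  assumes fan: "simplicial_multifan N \<Delta>"
begin

abbreviation "S \<equiv> simplices \<Delta>"
abbreviation "C \<equiv> cone_of \<Delta>"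
abbreviation "v \<equiv> ray_vector N \<Delta>"

lemma fan_conditions:
  shows lattice: "full_lattice N"
    and "finite_complex S"
    and "\<forall>J\<in>S. rational_cone N (C J) \<and> strongly_convex (C J) \<and> dim (C J) = card J"
    and "\<forall>J\<in>S. \<exists>I\<in>simplices_of \<Delta> DIM('a). J \<subseteq> I"
    and "\<forall>I\<in>S. \<forall>J\<in>S. J \<subseteq> I \<longrightarrow> cone_face (C J) (C I)"
    and "\<forall>I\<in>S. \<forall>J\<in>S. \<forall>K\<in>S. J \<subseteq> I \<and> K \<subseteq> I \<longrightarrow> (J \<subseteq> K \<longleftrightarrow> C J \<subseteq> C K)"
proof -
  note conds = fan [unfolded simplicial_multifan_def]
  show "full_lattice N"
    using conds by (elim conjE)
  show "finite_complex S"
    using conds by (elim conjE)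
  show "\<forall>J\<in>S. rational_cone N (C J) \<and> strongly_convex (C J) \<and> dim (C J) = card J"
    using conds by (elim conjE)
  show "\<forall>J\<in>S. \<exists>I\<in>simplices_of \<Delta> DIM('a). J \<subseteq> I"
    using conds by (elim conjE)
  show "\<forall>I\<in>S. \<forall>J\<in>S. J \<subseteq> I \<longrightarrow> cone_face (C J) (C I)"
    using conds by (elim conjE)
  have "\<forall>I\<in>S. bij_betw C {J \<in> S. J \<subseteq> I} {F. cone_face F (C I)} \<and>
      (\<forall>J\<in>S. \<forall>K\<in>S. J \<subseteq> I \<and> K \<subseteq> I \<longrightarrow> (J \<subseteq> K \<longleftrightarrow> C J \<subseteq> C K))"
    using conds by (elim conjE)
  then show "\<forall>I\<in>S. \<forall>J\<in>S. \<forall>K\<in>S. J \<subseteq> I \<and> K \<subseteq> I \<longrightarrow> (J \<subseteq> K \<longleftrightarrow> C J \<subseteq> C K)"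
    by (intro ballI) (drule bspec, assumption, drule conjunct2, drule bspec, assumption, drule bspec, assumption)
qed

lemma complex: "finite S" "{} \<in> S" "J \<in> S \<Longrightarrow> finite J" "J \<in> S \<Longrightarrow> K \<subseteq> J \<Longrightarrow> K \<in> S"
  using fan_conditions(2) by (simp_all add: finite_complex_def)

lemma vertices_eq: "vertices \<Delta> = \<Union>S"
proof
  show "vertices \<Delta> \<subseteq> \<Union>S" by (auto simp: vertices_def)
  show "\<Union>S \<subseteq> vertices \<Delta>"
  proof
    fix i assume "i \<in> \<Union>S"
    then obtain J where "J \<in> S" "i \<in> J" by blast
    then show "i \<in> vertices \<Delta>" using complex(4) [of J "{i}"] by (simp add: vertices_def)
  qed
qed

lemma finite_vertices: "finite (vertices \<Delta>)"
  unfolding vertices_eq using complex(1,3) by (simp add: finite_Union)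

lemma simplex_in_top: "J \<in> S \<Longrightarrow> \<exists>I\<in>S. card I = DIM('a) \<and> J \<subseteq> I"
  using fan_conditions(4) by (auto simp: simplices_of_def)

lemma simplex_card_extend:
  assumes "K \<in> S" "card K \<le> k" "k \<le> DIM('a)"
  obtains J where "J \<in> S" "card J = k" "K \<subseteq> J"
proof -
  obtain I where I: "I \<in> S" "card I = DIM('a)" "K \<subseteq> I" using simplex_in_top [OF assms(1)] by blast
  obtain J where "K \<subseteq> J" "J \<subseteq> I" "card J = k"
    using exists_subset_between [OF assms(2) _ I(3) complex(3) [OF I(1)]] assms(3) I(2) by auto
  then show ?thesis using that complex(4) [OF I(1)] by blast
qed

lemma cone:
  assumes "J \<in> S"
  shows "rational_cone N (C J)" "strongly_convex (C J)" "dim (C J) = card J" "convex_cone (C J)"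
proof -
  show *: "rational_cone N (C J)" "strongly_convex (C J)" "dim (C J) = card J"
    using fan_conditions(3) assms by auto
  then show "convex_cone (C J)"
    by (auto simp: rational_cone_def convex_cone_convex_cone_hull)
qed

lemma cone_face_of: "I \<in> S \<Longrightarrow> J \<subseteq> I \<Longrightarrow> C J face_of C I"
  using fan_conditions(5) complex(4) [of I J] by (simp add: cone_face_def)

lemma cone_subset_iff:
  assumes "I \<in> S" "J \<subseteq> I" "K \<subseteq> I" shows "C J \<subseteq> C K \<longleftrightarrow> J \<subseteq> K"
proof -
  have JK: "J \<in> S" "K \<in> S" using complex(4) assms by blast+
  have "J \<subseteq> K \<longleftrightarrow> C J \<subseteq> C K"
    by (rule mp [OF bspec [OF bspec [OF bspec [OF fan_conditions(6) assms(1)] JK(1)] JK(2)]])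
      (use assms in blast)
  then show ?thesis by (rule sym)
qed

lemma line_of_one_dim:
  assumes "dim X = 1" "x \<in> X" "x \<noteq> 0" "y \<in> (X :: 'a set)"
  obtains r where "y = r *\<^sub>R x"
proof -
  have "X \<subseteq> span {x}"
    using assms by (intro card_ge_dim_independent) auto
  then show ?thesis using assms(4) that by (auto simp: span_singleton)
qed

lemma ray_proportional:
  assumes "{i} \<in> S" "x \<in> C {i}" "x \<noteq> 0" "y \<in> C {i}"
  obtains r where "y = r *\<^sub>R x" "r \<ge> 0"
proof -
  obtain r where r: "y = r *\<^sub>R x"
    using line_of_one_dim [OF _ assms(2-4)] cone(3) [OF assms(1)] by auto
  have "r \<ge> 0"
  proof (rule ccontr)
    assume "\<not> r \<ge> 0"
    then have "(- 1 / r) *\<^sub>R y \<in> C {i}"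
      using convex_cone_scaleR [OF cone(4) [OF assms(1)] _ assms(4), of "- 1 / r"]
      by (simp add: divide_nonpos_neg)
    moreover have "(- 1 / r) *\<^sub>R y = - x" using \<open>\<not> r \<ge> 0\<close> by (simp add: r)
    ultimately have "x \<in> C {i} \<inter> uminus ` C {i}"
      using assms(2) by (auto simp: image_iff intro!: bexI [of _ "- x"])
    then show False using cone(2) [OF assms(1)] assms(3) by (auto simp: strongly_convex_def)
  qed
  then show ?thesis using that r by blast
qed

text \<open>
  A nonzero generator of the ray is a multiple of a primitive vector. Uniqueness holds because strong
  convexity makes any two nonzero vectors of the ray positive multiples of each other.
\<close>

lemma ray_vector:
  assumes "i \<in> vertices \<Delta>"
  shows "is_primitive_vector N (v i) \<and> v i \<in> C {i}"
proof -
  have i: "{i} \<in> S" using assms by (simp add: vertices_def)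
  obtain G where G: "finite G" "G \<subseteq> N" "C {i} = convex_cone hull G"
    using cone(1) [OF i] unfolding rational_cone_def by blast
  obtain s where s: "s \<in> G" "s \<noteq> 0"
  proof (rule ccontr)
    assume "\<not> thesis"
    then have "G \<subseteq> {0}" using that by blast
    then have "C {i} \<subseteq> {0}" unfolding G(3) by (rule hull_minimal) simp
    then have "dim (C {i}) = 0" by simp
    then show False using cone(3) [OF i] by simp
  qed
  obtain w m where w: "is_primitive_vector N w" "m > 0" "s = real m *\<^sub>R w"
    using primitive_multiple [OF lattice, of s] s G by blast
  have sC: "s \<in> C {i}" unfolding G(3) using s by (simp add: hull_inc)
  have "(1 / real m) *\<^sub>R s \<in> C {i}"
    using convex_cone_scaleR [OF cone(4) [OF i] _ sC] by simp
  moreover have "(1 / real m) *\<^sub>R s = w" using w by simp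
  ultimately have wC: "w \<in> C {i}" by simp
  show ?thesis
    unfolding ray_vector_def
  proof (rule theI)
    show "is_primitive_vector N w \<and> w \<in> C {i}" using w wC by simp
    fix w' assume w': "is_primitive_vector N w' \<and> w' \<in> C {i}"
    have nz: "w \<noteq> 0" "w' \<noteq> 0" using w w' by (auto simp: is_primitive_vector_def)
    obtain r where r: "w' = r *\<^sub>R w" "r \<ge> 0"
      using ray_proportional [OF i wC nz(1)] w' by blast
    moreover have "r \<noteq> 0" using r nz by auto
    ultimately show "w' = w"
      using primitive_vectors_proportional [OF lattice w(1), of w' r] w' by simp
  qed
qed

lemma ray_vector_in: "i \<in> vertices \<Delta> \<Longrightarrow> v i \<in> N" "i \<in> vertices \<Delta> \<Longrightarrow> v i \<noteq> 0"
  using ray_vector [of i] by (simp_all add: is_primitive_vector_def)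

lemma simplex_vertices: "J \<in> S \<Longrightarrow> J \<subseteq> vertices \<Delta>"
  by (auto simp: vertices_eq)

lemma ray_vector_in_cone:
  assumes "J \<in> S" "i \<in> J" shows "v i \<in> C J"
proof -
  have "v i \<in> C {i}" using ray_vector simplex_vertices assms by blast
  moreover have "C {i} \<subseteq> C J" using cone_subset_iff [OF assms(1), of "{i}" J] assms by simp
  ultimately show ?thesis by blast
qed

text \<open>
  A face is the intersection of the cone with its span. If that span contained \<open>v\<^sub>i\<close>, the face \<open>C(K)\<close>
  would contain the ray \<open>C({i})\<close>, contrary to the order isomorphism between simplices and faces.
\<close>

lemma ray_vector_not_in_facet_span:
  assumes "J \<in> S" "K \<subseteq> J" "i \<in> J - K"
  shows "v i \<notin> span (C K)"
proof
  assume span: "v i \<in> span (C K)"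
  have K: "K \<in> S" and i: "{i} \<in> S" "i \<in> vertices \<Delta>"
    using assms complex(4) [OF assms(1)] by (auto simp: vertices_def)
  have "0 \<in> C K" using cone(4) [OF K] by (rule convex_cone_contains_0)
  then have "v i \<in> affine hull (C K)" using span by (simp add: affine_hull_span_0 hull_inc)
  moreover have "convex (C J)" using cone(4) [OF assms(1)] by (simp add: convex_cone_def)
  ultimately have vK: "v i \<in> C K"
    using face_of_imp_eq_affine_Int [OF _ cone_face_of [OF assms(1,2)]] ray_vector_in_cone [OF assms(1)] assms(3)
    by blast
  have "C {i} \<subseteq> C K"
  proof
    fix x assume "x \<in> C {i}"
    then obtain r where "x = r *\<^sub>R v i" "r \<ge> 0"
      using ray_proportional [OF i(1) _ ray_vector_in(2) [OF i(2)]] ray_vector [OF i(2)] by blast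
    then show "x \<in> C K" using convex_cone_scaleR [OF cone(4) [OF K] _ vK] by simp
  qed
  then show False using cone_subset_iff [OF assms(1), of "{i}" K] assms by auto
qed

lemma rays_independent:
  assumes "J \<in> S" shows "inj_on v J \<and> independent (v ` J)"
  using complex(3) [OF assms] assms
proof (induction J)
  case empty
  then show ?case by (simp add: independent_empty)
next
  case (insert j J)
  have J: "J \<in> S" using complex(4) [OF insert.prems] by blast
  have "v ` J \<subseteq> C J" using ray_vector_in_cone [OF J] by blast
  then have "v j \<notin> span (v ` J)"
    using ray_vector_not_in_facet_span [OF insert.prems, of J j] insert.hyps span_mono by blast
  moreover have "v j \<notin> v ` J"
    using calculation by (rule contra_subsetD [OF span_superset])
  ultimately show ?case
    using insert.IH [OF J] insert.hyps(2) by (simp add: independent_insertI)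
qed

lemma card_rays: "J \<in> S \<Longrightarrow> card (v ` J) = card J"
  using rays_independent [of J] by (simp add: card_image)

lemma cone_subset_span_rays:
  assumes "J \<in> S" shows "C J \<subseteq> span (v ` J)"
proof (rule card_ge_dim_independent)
  show "v ` J \<subseteq> C J" using ray_vector_in_cone [OF assms] by (rule image_subsetI)
  show "independent (v ` J)" using rays_independent [OF assms] by simp
  show "dim (C J) \<le> card (v ` J)" by (simp add: card_rays cone(3) assms)
qed

subsection \<open>Dual bases\<close>

lemma dual_vector:
  assumes "I \<in> S" "card I = DIM('a)"
  shows "dual_vector N \<Delta> I i \<in> dual_rat N \<and>
    (\<forall>j\<in>I. dual_vector N \<Delta> I i (v j) = (if j = i then 1 else 0))"
proof -
  have ind: "inj_on v I" "independent (v ` I)" using rays_independent [OF assms(1)] by auto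
  have vN: "v ` I \<subseteq> N" using ray_vector_in simplex_vertices [OF assms(1)] by blast
  obtain u :: "'a \<Rightarrow> real" where u: "linear u"
    "\<And>x. x \<in> v ` I \<Longrightarrow> u x = (if inv_into I v x = i then 1 else 0)"
    using linear_independent_extend [OF ind(2), of "\<lambda>x. if inv_into I v x = i then 1 else (0::real)"] by blast
  have uI: "u (v j) = (if j = i then 1 else 0)" if "j \<in> I" for j
    using u(2) [of "v j"] that ind(1) by simp
  have UNIV: "span (v ` I) = UNIV"
    using card_ge_dim_independent [of "v ` I" UNIV] ind card_rays [OF assms(1)] assms(2) by (simp add: top.extremum_uniqueI)
  have "u x \<in> \<rat>" if "x \<in> N" for x
    by (rule linear_rational_on_rat_span [OF u(1), of "v ` I"])
      (use that uI rat_span_eq_of_independent [OF lattice ind(2,1) assms(2) vN] in auto)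
  then have ud: "u \<in> dual_rat N" using u(1) by (simp add: dual_rat_def)
  define P where "P u \<longleftrightarrow> u \<in> dual_rat N \<and> (\<forall>j\<in>I. u (v j) = (if j = i then 1 else 0))" for u
  have "P (THE u. P u)"
  proof (rule theI [of P u])
    show "P u" using ud uI by (simp add: P_def)
    fix w assume w: "P w"
    show "w = u"
    proof (rule ext)
      fix x
      have lw: "linear w" using w by (simp add: P_def dual_rat_def)
      show "w x = u x"
        by (rule linear_eq_on [OF lw u(1), of x "v ` I"]) (use UNIV w uI in \<open>auto simp: P_def\<close>)
    qed
  qed
  then show ?thesis unfolding dual_vector_def P_def .
qed

lemma iota_var_dual_rat: "I \<in> S \<Longrightarrow> card I = DIM('a) \<Longrightarrow> iota_var N \<Delta> I i \<in> dual_rat N"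
  by (cases "i \<in> I") (simp_all add: iota_var_def dual_vector, simp add: dual_rat_def linear_zero)

lemma iota_var_ray:
  "I \<in> S \<Longrightarrow> card I = DIM('a) \<Longrightarrow> j \<in> I \<Longrightarrow> iota_var N \<Delta> I i (v j) = (if j = i then 1 else 0)"
  by (cases "i \<in> I") (auto simp: iota_var_def dual_vector)

lemma expand_in_rays:
  assumes "I \<in> S" "card I = DIM('a)"
  shows "x = (\<Sum>i\<in>I. iota_var N \<Delta> I i x *\<^sub>R v i)"
proof -
  have ind: "inj_on v I" "independent (v ` I)" using rays_independent [OF assms(1)] by auto
  have UNIV: "span (v ` I) = UNIV"
    using card_ge_dim_independent [of "v ` I" UNIV] ind card_rays [OF assms(1)] assms(2) by (simp add: top.extremum_uniqueI)
  have lin: "linear (iota_var N \<Delta> I i)" for i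
    using iota_var_dual_rat [OF assms] by (simp add: dual_rat_def)
  have fin: "finite I" using complex(3) assms(1) .
  show ?thesis
  proof (rule linear_eq_on [of "\<lambda>x. x" "\<lambda>x. \<Sum>i\<in>I. iota_var N \<Delta> I i x *\<^sub>R v i" x "v ` I"])
    show "linear (\<lambda>x. x)" by (rule linear_ident)
    show "linear (\<lambda>x. \<Sum>i\<in>I. iota_var N \<Delta> I i x *\<^sub>R v i)"
      by (intro linearI) (simp_all add: linear_add [OF lin] linear_cmul [OF lin]
        scaleR_left_distrib sum.distrib scaleR_sum_right)
    show "b = (\<Sum>i\<in>I. iota_var N \<Delta> I i b *\<^sub>R v i)" if "b \<in> v ` I" for b
    proof -
      obtain j where j: "j \<in> I" "b = v j" using \<open>b \<in> v ` I\<close> by (rule imageE)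
      have "(\<Sum>i\<in>I. iota_var N \<Delta> I i b *\<^sub>R v i) = (\<Sum>i\<in>I. if j = i then v i else 0)"
        using j by (intro sum.cong) (auto simp: iota_var_ray [OF assms])
      then show ?thesis using j fin by simp
    qed
  qed (simp add: UNIV)
qed

subsection \<open>Annihilators\<close>

text \<open>
  The lattice vectors killed by \<open>u\<close> form a primitive sublattice. It contains the lattice points of
  \<open>C(J)\<close> as soon as it contains the rays, since they span the cone, and then it contains \<open>N\<^sub>J\<close>.
\<close>

lemma annihilator_iff:
  assumes "J \<in> S"
  shows "u \<in> annihilator N \<Delta> J \<longleftrightarrow> u \<in> dual_lattice N \<and> (\<forall>j\<in>J. u (v j) = 0)"
proof (intro iffI conjI ballI)
  assume u: "u \<in> annihilator N \<Delta> J"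
  then show "u \<in> dual_lattice N" by (simp add: annihilator_def)
  fix j assume j: "j \<in> J"
  have "v j \<in> N \<inter> C J"
    using ray_vector_in_cone [OF assms j] ray_vector_in(1) simplex_vertices [OF assms] j by blast
  then have "v j \<in> sublattice_of N \<Delta> J" by (auto simp: sublattice_of_def)
  then show "u (v j) = 0" using u by (simp add: annihilator_def)
next
  assume u: "u \<in> dual_lattice N \<and> (\<forall>j\<in>J. u (v j) = 0)"
  then have lin: "linear u" by (simp add: dual_lattice_def)
  have span0: "u x = 0" if "x \<in> span (v ` J)" for x
    by (rule linear_eq_0_on_span [OF lin _ that]) (use u in auto)
  have 0: "0 \<in> N"
    using lattice unfolding full_lattice_def by (auto intro!: exI [of _ "\<lambda>_. 0"])
  have "primitive_sublattice N {x \<in> N. u x = 0}"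
    unfolding primitive_sublattice_def
  proof (intro conjI ballI allI impI)
    show "0 \<in> {x \<in> N. u x = 0}" using 0 lin by (simp add: linear_0)
    show "x - y \<in> {x \<in> N. u x = 0}" if "x \<in> {x \<in> N. u x = 0}" "y \<in> {x \<in> N. u x = 0}" for x y
      using that lattice_comb [OF lattice, of x y 1 "-1"] lin by (simp add: linear_diff)
    show "x \<in> {x \<in> N. u x = 0}" if "x \<in> N" "m \<noteq> 0 \<and> real m *\<^sub>R x \<in> {x \<in> N. u x = 0}" for x and m :: nat
      using that lin by (auto simp: linear_cmul)
  qed auto
  moreover have "N \<inter> C J \<subseteq> {x \<in> N. u x = 0}"
    using cone_subset_span_rays [OF assms] span0 by blast
  ultimately have "sublattice_of N \<Delta> J \<subseteq> {x \<in> N. u x = 0}"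
    unfolding sublattice_of_def by blast
  then show "u \<in> annihilator N \<Delta> J" using u by (auto simp: annihilator_def)
qed

lemma annihilator_basis_in:
  assumes "J \<in> S" "annihilator_basis N \<Delta> J us" "u \<in> set us"
  shows "u \<in> dual_rat N" "j \<in> J \<Longrightarrow> u (v j) = 0"
proof -
  have "set us \<subseteq> annihilator N \<Delta> J"
    using assms(2) by (simp add: annihilator_basis_def int_basis_def)
  then have "u \<in> annihilator N \<Delta> J" using assms(3) by (rule subsetD)
  then have "u \<in> dual_lattice N \<and> (\<forall>j\<in>J. u (v j) = 0)"
    by (rule iffD1 [OF annihilator_iff [OF assms(1)]])
  then show "u \<in> dual_rat N" "j \<in> J \<Longrightarrow> u (v j) = 0"
    by (auto intro: subsetD [OF dual_lattice_subset])
qed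

text \<open>
  Some positive integral multiple of \<open>u\<close> lies in \<open>M\<^sub>J\<close>.
\<close>

lemma annihilator_basis_span:
  assumes "J \<in> S" "annihilator_basis N \<Delta> J us" "u \<in> dual_rat N" "\<And>j. j \<in> J \<Longrightarrow> u (v j) = 0"
  obtains c :: "nat \<Rightarrow> real" where "u = (\<lambda>x. \<Sum>l<length us. c l * (us ! l) x)"
proof -
  obtain m :: nat where m: "m > 0" "(\<lambda>x. real m * u x) \<in> dual_lattice N"
    by (rule dual_rat_integral_multiple [OF lattice assms(3)])
  have mem: "(\<lambda>x. real m * u x) \<in> annihilator N \<Delta> J"
    using m assms(4) by (simp add: annihilator_iff [OF assms(1)])
  have "\<forall>u\<in>annihilator N \<Delta> J. \<exists>!c :: int list. length c = length us \<and>
        u = (\<lambda>v. \<Sum>i<length us. of_int (c ! i) * (us ! i) v)"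
    using assms(2) unfolding annihilator_basis_def int_basis_def by (elim conjE)
  from ex1_implies_ex [OF bspec [OF this mem]] obtain c :: "int list" where
    c: "(\<lambda>x. real m * u x) = (\<lambda>v. \<Sum>i<length us. of_int (c ! i) * (us ! i) v)"
    by (elim exE conjE)
  have "u x = (\<Sum>l<length us. (of_int (c ! l) / real m) * (us ! l) x)" for x
  proof -
    have "u x = (real m * u x) / real m" using m by simp
    also have "\<dots> = (\<Sum>l<length us. of_int (c ! l) * (us ! l) x) / real m"
      using fun_cong [OF c, of x] by simp
    finally show ?thesis by (simp add: sum_divide_distrib)
  qed
  then have "u = (\<lambda>x. \<Sum>l<length us. (of_int (c ! l) / real m) * (us ! l) x)" by (rule ext)
  then show ?thesis by (rule that)
qed

end


section \<open>Determinants of linear forms\<close>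

lemma permutes_less: "p permutes {0..<n} \<Longrightarrow> i < n \<Longrightarrow> p i < (n::nat)"
  using permutes_in_image [of p "{0..<n}" i] by simp

lemma wedge_eq_sum:
  assumes "length ws = length us"
  shows "wedge us ws = (\<Sum>p | p permutes {0..<length us}. signof p * (\<Prod>i = 0..<length us. (us ! i) (ws ! p i)))"
  using assms unfolding wedge_def
  by (subst det_def' [of _ "length us"]) (auto intro!: sum.cong prod.cong simp: permutes_less)

text \<open>
  The contraction of \<open>u\<^sub>1 \<and> \<dots> \<and> u\<^sub>l\<close> with \<open>w\<^sub>0 \<and> \<dots> \<and> w\<^sub>l\<close>: the cofactor expansion of a determinant
  whose first row holds the vectors \<open>w\<^sub>j\<close> themselves. It lies in the span of the \<open>w\<^sub>j\<close> and in the
  common kernel of the \<open>u\<^sub>i\<close>.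
\<close>

definition plane_vector :: "('a::real_vector \<Rightarrow> real) list \<Rightarrow> 'a list \<Rightarrow> 'a" where
  "plane_vector us ws = (\<Sum>j\<le>length us. ((-1) ^ j *
     Determinant.det (Matrix.mat (length us) (length us)
       (\<lambda>(a, b). (us ! a) (ws ! (if b < j then b else Suc b))))) *\<^sub>R (ws ! j))"

lemma wedge_Cons:
  assumes "linear u" "length ws = Suc (length us)"
  shows "wedge (u # us) ws = u (plane_vector us ws)"
proof -
  let ?n = "length us"
  define A where "A = Matrix.mat (Suc ?n) (Suc ?n) (\<lambda>(i, j). ((u # us) ! i) (ws ! j))"
  have A: "A \<in> carrier_mat (Suc ?n) (Suc ?n)" by (simp add: A_def)
  have A0: "A $$ (0, j) = u (ws ! j)" if "j < Suc ?n" for j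
    using that by (simp add: A_def)
  have cof: "cofactor A 0 j = (-1) ^ j * Determinant.det (Matrix.mat ?n ?n
       (\<lambda>(a, b). (us ! a) (ws ! (if b < j then b else Suc b))))" if "j < Suc ?n" for j
  proof -
    have "mat_delete A 0 j = Matrix.mat ?n ?n (\<lambda>(a, b). (us ! a) (ws ! (if b < j then b else Suc b)))"
      using that by (intro eq_matI) (auto simp: mat_delete_def A_def)
    then show ?thesis by (simp add: cofactor_def)
  qed
  have "wedge (u # us) ws = Determinant.det A"
    using assms(2) by (simp add: wedge_def A_def)
  also have "\<dots> = (\<Sum>j<Suc ?n. A $$ (0, j) * cofactor A 0 j)"
    by (rule laplace_expansion_row [OF A]) simp
  also have "\<dots> = (\<Sum>j\<le>?n. u (ws ! j) * ((-1) ^ j * Determinant.det (Matrix.mat ?n ?n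
       (\<lambda>(a, b). (us ! a) (ws ! (if b < j then b else Suc b))))))"
    unfolding lessThan_Suc_atMost by (intro sum.cong) (simp_all add: cof A0)
  also have "\<dots> = u (plane_vector us ws)"
    unfolding plane_vector_def using assms(1) by (simp add: linear_sum linear_cmul mult_ac)
  finally show ?thesis .
qed

lemma wedge_repeated:
  assumes "u \<in> set us" shows "wedge (u # us) ws = 0"
proof (cases "length ws = Suc (length us)")
  case True
  obtain l where l: "l < length us" "us ! l = u" using assms by (auto simp: in_set_conv_nth)
  show ?thesis
    unfolding wedge_def using True l
    by (auto intro!: det_identical_rows [of _ "Suc (length us)" 0 "Suc l"] simp: row_def)
qed (simp add: wedge_def)

lemma plane_vector_in_kernel:
  assumes "u \<in> set us" "linear u" "length ws = Suc (length us)"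
  shows "u (plane_vector us ws) = 0"
  using wedge_Cons [OF assms(2,3)] wedge_repeated [OF assms(1)] by simp

lemma linear_form_on_plane:
  assumes "linear u" "\<And>w. w \<in> set ws \<Longrightarrow> u w = 0" "length ws = Suc (length us)"
  shows "u (plane_vector us ws) = 0"
proof -
  have "u (ws ! j) = 0" if "j \<in> {..length us}" for j
    using assms(2) [of "ws ! j"] assms(3) that by simp
  then show ?thesis
    unfolding plane_vector_def using assms(1) by (simp add: linear_sum linear_cmul)
qed

lemma det_rational:
  assumes "\<And>i j. i < n \<Longrightarrow> j < n \<Longrightarrow> f (i, j) \<in> (\<rat>::real set)"
  shows "Determinant.det (Matrix.mat n n f) \<in> \<rat>"
proof -
  have "Determinant.det (Matrix.mat n n f) =
    (\<Sum>p | p permutes {0..<n}. signof p * (\<Prod>i = 0..<n. Matrix.mat n n f $$ (i, p i)))"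
    by (rule det_def') simp
  also have "\<dots> \<in> \<rat>"
  proof (intro Rats_sum Rats_mult Rats_prod)
    show "signof p \<in> (\<rat>::real set)" for p :: "nat \<Rightarrow> nat"
      by (auto simp: sign_def)
    show "Matrix.mat n n f $$ (i, p i) \<in> \<rat>" if "p \<in> {p. p permutes {0..<n}}" "i \<in> {0..<n}" for p i
      using that assms by (auto simp: permutes_less)
  qed
  finally show ?thesis .
qed

lemma wedge_rational:
  assumes "set us \<subseteq> dual_rat N" "set ws \<subseteq> lattice_rat N"
  shows "wedge us ws \<in> \<rat>"
proof (cases "length ws = length us")
  case True
  have "(us ! i) (ws ! j) \<in> \<rat>" if "i < length us" "j < length us" for i j
    using assms that True by (intro dual_rat_lattice_rat [of "us ! i" N "ws ! j"]) (simp_all add: subset_iff)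
  then show ?thesis
    unfolding wedge_def using True by (simp add: det_rational)
qed (simp add: wedge_def)

lemma wedge_nonzero_independent:
  assumes "wedge us ws \<noteq> 0" "\<And>u. u \<in> set us \<Longrightarrow> linear u"
  shows "distinct ws" "independent (set ws)"
proof -
  have len: "length ws = length us" using assms(1) by (auto simp: wedge_def split: if_splits)
  let ?n = "length us"
  define A where "A = Matrix.mat ?n ?n (\<lambda>(i, j). (us ! i) (ws ! j))"
  have A: "A \<in> carrier_mat ?n ?n" by (simp add: A_def)
  have det: "Determinant.det A \<noteq> 0" using assms(1) len by (simp add: wedge_def A_def)
  show d: "distinct ws"
  proof (rule ccontr)
    assume "\<not> distinct ws"
    then obtain i j where ij: "i < ?n" "j < ?n" "i \<noteq> j" "ws ! i = ws ! j"
      by (auto simp: distinct_conv_nth len)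
    then have "Determinant.det A = 0"
      by (intro det_identical_columns [OF A, of i j]) (auto simp: A_def)
    then show False using det by simp
  qed
  show "independent (set ws)"
  proof (rule independent_if_scalars_zero)
    fix f :: "'a \<Rightarrow> real" and x
    assume sum0: "(\<Sum>x\<in>set ws. f x *\<^sub>R x) = 0" and x: "x \<in> set ws"
    have sum0': "(\<Sum>j<?n. f (ws ! j) *\<^sub>R (ws ! j)) = 0"
      using sum0 sum.reindex_bij_betw [OF bij_betw_nth [OF d, of "{..<?n}" "set ws"], of "\<lambda>x. f x *\<^sub>R x"] len by simp
    define c where "c = Matrix.vec ?n (\<lambda>j. f (ws ! j))"
    have "A *\<^sub>v c = 0\<^sub>v ?n"
    proof (rule eq_vecI)
      fix i assume "i < dim_vec (0\<^sub>v ?n)"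
      then have i: "i < ?n" by simp
      then have lin: "linear (us ! i)" using assms(2) by simp
      have "(A *\<^sub>v c) $ i = (\<Sum>j = 0..<?n. (us ! i) (ws ! j) * f (ws ! j))"
        using i by (simp add: A_def c_def scalar_prod_def)
      also have "\<dots> = (us ! i) (\<Sum>j<?n. f (ws ! j) *\<^sub>R (ws ! j))"
        using lin by (simp add: linear_sum linear_cmul mult.commute atLeast0LessThan)
      also have "\<dots> = 0" using lin by (simp add: sum0' linear_0)
      finally show "(A *\<^sub>v c) $ i = 0\<^sub>v ?n $ i" using i by simp
    qed (simp add: A_def)
    moreover have "c \<in> carrier_vec ?n" by (simp add: c_def)
    ultimately have "c = 0\<^sub>v ?n"
      using det det_0_iff_vec_prod_zero_field [OF A] by blast
    moreover obtain j where j: "j < ?n" "x = ws ! j" using x len by (auto simp: in_set_conv_nth)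
    ultimately have "Matrix.vec_index c j = 0" by simp
    then show "f x = 0" using j by (simp add: c_def)
  qed simp
qed

text \<open>
  The coefficients \<open>C\<close> form a left inverse of the matrix whose determinant is the wedge.
\<close>

lemma wedge_nonzeroI:
  assumes len: "length ws = length us"
    and C: "\<And>i j. i < length us \<Longrightarrow> j < length us \<Longrightarrow>
      (\<Sum>b<length us. C i b * (us ! b) (ws ! j)) = (if i = j then 1 else 0)"
  shows "wedge us ws \<noteq> 0"
proof -
  let ?n = "length us"
  define A where "A = Matrix.mat ?n ?n (\<lambda>(i, j). (us ! i) (ws ! j))"
  define B where "B = Matrix.mat ?n ?n (\<lambda>(i, j). C i j)"
  have A: "A \<in> carrier_mat ?n ?n" and B: "B \<in> carrier_mat ?n ?n" by (simp_all add: A_def B_def)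
  have "B * A = 1\<^sub>m ?n"
  proof (rule eq_matI)
    fix i j assume "i < dim_row (1\<^sub>m ?n)" "j < dim_col (1\<^sub>m ?n)"
    then have ij: "i < ?n" "j < ?n" by simp_all
    then have "(B * A) $$ (i, j) = (\<Sum>b = 0..<?n. C i b * (us ! b) (ws ! j))"
      by (simp add: A_def B_def scalar_prod_def)
    then show "(B * A) $$ (i, j) = 1\<^sub>m ?n $$ (i, j)"
      using C [OF ij] ij by (simp add: atLeast0LessThan)
  qed (simp_all add: A_def B_def)
  then have "Determinant.det B * Determinant.det A = 1"
    using det_mult [OF B A] by simp
  then show ?thesis using len by (auto simp: wedge_def A_def)
qed

lemma independent_imp_wedge_nonzero:
  assumes "distinct ws" "independent (set ws)"
  shows "\<exists>us. length us = length ws \<and> (\<forall>u\<in>set us. linear u) \<and> wedge us ws \<noteq> 0"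
proof -
  have "\<exists>u::'a::real_vector \<Rightarrow> real. linear u \<and> (\<forall>x\<in>set ws. u x = (if x = ws ! i then 1 else 0))" for i
    by (rule linear_independent_extend [OF assms(2)])
  from choice [OF allI [OF this]] obtain u :: "nat \<Rightarrow> 'a \<Rightarrow> real" where
    u: "\<forall>i. linear (u i) \<and> (\<forall>x\<in>set ws. u i x = (if x = ws ! i then 1 else 0))" ..
  define us where "us = map u [0..<length ws]"
  have "wedge us ws \<noteq> 0"
  proof (rule wedge_nonzeroI)
    show "length ws = length us" by (simp add: us_def)
    fix i j assume ij: "i < length us" "j < length us"
    have "(\<Sum>b<length us. (if i = b then 1 else 0) * (us ! b) (ws ! j)) =
        (\<Sum>b<length us. if i = b then (us ! b) (ws ! j) else 0)"
      by (intro sum.cong) auto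
    also have "\<dots> = (us ! i) (ws ! j)" using ij by simp
    also have "\<dots> = (if i = j then 1 else 0)"
      using ij assms(1) by (auto simp: us_def u nth_eq_iff_index_eq)
    finally show "(\<Sum>b<length us. (if i = b then 1 else 0) * (us ! b) (ws ! j)) = (if i = j then 1 else 0)" .
  qed
  then show ?thesis using u by (intro exI [of _ us]) (auto simp: us_def)
qed

text \<open>
  Cramer's rule. A nonzero determinant means that the forms restrict to a basis of the dual of the
  span of \<open>ws\<close>; the coefficients are rational because minors of a rational matrix are.
\<close>

lemma forms_span_dual_of_plane:
  assumes "wedge gs ws \<noteq> 0" "set gs \<subseteq> dual_rat N" "set ws \<subseteq> lattice_rat N" "\<theta> \<in> dual_rat N"
  obtains c where "\<And>l. l < length gs \<Longrightarrow> c l \<in> \<rat>"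
    "\<And>w. w \<in> set ws \<Longrightarrow> \<theta> w = (\<Sum>l<length gs. c l * (gs ! l) w)"
proof -
  have len: "length ws = length gs" using assms(1) by (auto simp: wedge_def split: if_splits)
  let ?n = "length gs"
  define A where "A = Matrix.mat ?n ?n (\<lambda>(i, j). (gs ! i) (ws ! j))"
  have A: "A \<in> carrier_mat ?n ?n" by (simp add: A_def)
  have det: "Determinant.det A \<noteq> 0" using assms(1) len by (simp add: wedge_def A_def)
  have rat: "(gs ! i) (ws ! j) \<in> \<rat>" if "i < ?n" "j < ?n" for i j
    using assms(2,3) that len by (intro dual_rat_lattice_rat [of _ N]) (auto simp: subset_iff)
  have ratA: "Determinant.det A \<in> \<rat>" unfolding A_def by (rule det_rational) (simp add: rat)
  have ratadj: "adj_mat A $$ (i, j) \<in> \<rat>" if "i < ?n" "j < ?n" for i j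
  proof -
    have dims: "dim_row A = ?n" "dim_col A = ?n" using A by auto
    have "Determinant.det (mat_delete A j i) \<in> \<rat>"
      unfolding mat_delete_def dims using that by (intro det_rational) (auto simp: A_def rat)
    then show ?thesis using that A by (simp add: adj_mat_def cofactor_def)
  qed
  define c where "c l = (\<Sum>m<?n. \<theta> (ws ! m) * adj_mat A $$ (m, l)) / Determinant.det A" for l
  have "c l \<in> \<rat>" if "l < ?n" for l
    unfolding c_def using that assms(3,4) len
    by (intro Rats_divide Rats_sum Rats_mult ratadj ratA dual_rat_lattice_rat [of \<theta> N]) auto
  moreover have "\<theta> w = (\<Sum>l<?n. c l * (gs ! l) w)" if w: "w \<in> set ws" for w
  proof -
    obtain j where j: "j < ?n" "w = ws ! j" using w len by (auto simp: in_set_conv_nth)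
    have adj: "(\<Sum>l<?n. adj_mat A $$ (m, l) * (gs ! l) w) = (if m = j then Determinant.det A else 0)"
      if m: "m < ?n" for m
    proof -
      have "(\<Sum>l<?n. adj_mat A $$ (m, l) * (gs ! l) w) = (adj_mat A * A) $$ (m, j)"
        using m j A adj_mat(1) [OF A] by (simp add: scalar_prod_def A_def atLeast0LessThan)
      then show ?thesis using adj_mat(3) [OF A] m j by simp
    qed
    have "(\<Sum>l<?n. c l * (gs ! l) w) =
        (\<Sum>l<?n. \<Sum>m<?n. \<theta> (ws ! m) * adj_mat A $$ (m, l) * (gs ! l) w) / Determinant.det A"
      by (simp add: c_def sum_divide_distrib sum_distrib_right)
    also have "(\<Sum>l<?n. \<Sum>m<?n. \<theta> (ws ! m) * adj_mat A $$ (m, l) * (gs ! l) w) =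
        (\<Sum>m<?n. \<theta> (ws ! m) * (\<Sum>l<?n. adj_mat A $$ (m, l) * (gs ! l) w))"
      by (subst sum.swap) (simp add: sum_distrib_left mult_ac)
    also have "\<dots> = (\<Sum>m<?n. if m = j then \<theta> (ws ! m) * Determinant.det A else 0)"
      by (intro sum.cong) (auto simp: adj)
    also have "\<dots> = \<theta> w * Determinant.det A" using j by simp
    finally show ?thesis using det by simp
  qed
  ultimately show ?thesis using that by blast
qed

section \<open>Density of generic rational planes\<close>

definition rational_tuples :: "'a::euclidean_space set \<Rightarrow> nat \<Rightarrow> 'a list set" where
  "rational_tuples N r = {ws. length ws = r \<and> set ws \<subseteq> lattice_rat N}"

definition line_point :: "real \<Rightarrow> 'a::real_vector list \<Rightarrow> 'a list \<Rightarrow> 'a list" where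
  "line_point t ws ws' = map2 (\<lambda>w w'. (1 - t) *\<^sub>R w + t *\<^sub>R w') ws ws'"

text \<open>
  Being polynomial along every rational line is all that the density argument uses of polynomial
  functions on tuples of vectors, and it is stable under sums and products.
\<close>

definition line_polynomial :: "'a::euclidean_space set \<Rightarrow> nat \<Rightarrow> ('a list \<Rightarrow> real) \<Rightarrow> bool" where
  "line_polynomial N r D \<longleftrightarrow> (\<forall>ws\<in>rational_tuples N r. \<forall>ws'\<in>rational_tuples N r.
     \<exists>P. \<forall>t\<in>\<rat>. D (line_point t ws ws') = poly P t)"

lemma line_point_rational:
  assumes "full_lattice N" "ws \<in> rational_tuples N r" "ws' \<in> rational_tuples N r" "t \<in> \<rat>"
  shows "line_point t ws ws' \<in> rational_tuples N r"
  using assms unfolding rational_tuples_def line_point_def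
  by (auto simp: set_zip intro!: lattice_rat_comb Rats_diff)

lemma line_point_ends:
  assumes "length ws = length ws'"
  shows "line_point 0 ws ws' = ws" "line_point 1 ws ws' = ws'"
  using assms by (auto intro!: nth_equalityI simp: line_point_def)

lemma line_polynomial_const: "line_polynomial N r (\<lambda>ws. c)"
  unfolding line_polynomial_def by (intro ballI exI [of _ "[:c:]"]) simp

lemma line_polynomial_add:
  assumes "line_polynomial N r f" "line_polynomial N r g"
  shows "line_polynomial N r (\<lambda>ws. f ws + g ws)"
  unfolding line_polynomial_def
proof (intro ballI)
  fix ws ws' assume "ws \<in> rational_tuples N r" "ws' \<in> rational_tuples N r"
  then obtain P Q where "\<forall>t\<in>\<rat>. f (line_point t ws ws') = poly P t" "\<forall>t\<in>\<rat>. g (line_point t ws ws') = poly Q t"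
    using assms unfolding line_polynomial_def by blast
  then show "\<exists>P. \<forall>t\<in>\<rat>. f (line_point t ws ws') + g (line_point t ws ws') = poly P t"
    by (intro exI [of _ "P + Q"]) simp
qed

lemma line_polynomial_mult:
  assumes "line_polynomial N r f" "line_polynomial N r g"
  shows "line_polynomial N r (\<lambda>ws. f ws * g ws)"
  unfolding line_polynomial_def
proof (intro ballI)
  fix ws ws' assume "ws \<in> rational_tuples N r" "ws' \<in> rational_tuples N r"
  then obtain P Q where "\<forall>t\<in>\<rat>. f (line_point t ws ws') = poly P t" "\<forall>t\<in>\<rat>. g (line_point t ws ws') = poly Q t"
    using assms unfolding line_polynomial_def by blast
  then show "\<exists>P. \<forall>t\<in>\<rat>. f (line_point t ws ws') * g (line_point t ws ws') = poly P t"
    by (intro exI [of _ "P * Q"]) simp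
qed

lemma line_polynomial_sum:
  "(\<And>x. x \<in> A \<Longrightarrow> line_polynomial N r (f x)) \<Longrightarrow> line_polynomial N r (\<lambda>ws. \<Sum>x\<in>A. f x ws)"
  by (induction A rule: infinite_finite_induct) (auto intro: line_polynomial_const line_polynomial_add)

lemma line_polynomial_prod:
  "(\<And>x. x \<in> A \<Longrightarrow> line_polynomial N r (f x)) \<Longrightarrow> line_polynomial N r (\<lambda>ws. \<Prod>x\<in>A. f x ws)"
  by (induction A rule: infinite_finite_induct) (auto intro: line_polynomial_const line_polynomial_mult)

lemma line_polynomial_cong:
  assumes "full_lattice N" "line_polynomial N r f" "\<And>ws. ws \<in> rational_tuples N r \<Longrightarrow> f ws = g ws"
  shows "line_polynomial N r g"
  unfolding line_polynomial_def
proof (intro ballI)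
  fix ws ws' assume ws: "ws \<in> rational_tuples N r" "ws' \<in> rational_tuples N r"
  then obtain P where "\<forall>t\<in>\<rat>. f (line_point t ws ws') = poly P t"
    using assms(2) unfolding line_polynomial_def by blast
  then show "\<exists>P. \<forall>t\<in>\<rat>. g (line_point t ws ws') = poly P t"
    using assms(3) line_point_rational [OF assms(1) ws] by (intro exI [of _ P]) simp
qed

lemma line_polynomial_coordinate:
  assumes "linear u" "j < r"
  shows "line_polynomial N r (\<lambda>ws. u (ws ! j))"
  unfolding line_polynomial_def
proof (intro ballI)
  fix ws ws' assume ws: "ws \<in> rational_tuples N r" "ws' \<in> rational_tuples N r"
  then have "u (line_point t ws ws' ! j) = (1 - t) * u (ws ! j) + t * u (ws' ! j)" for t
    using assms by (simp add: line_point_def rational_tuples_def linear_add linear_cmul)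
  then show "\<exists>P. \<forall>t\<in>\<rat>. u (line_point t ws ws' ! j) = poly P t"
    by (intro exI [of _ "[:u (ws ! j), u (ws' ! j) - u (ws ! j):]"]) (simp add: algebra_simps)
qed

lemma line_polynomial_wedge:
  assumes "full_lattice N" "length us = r" "\<And>u. u \<in> set us \<Longrightarrow> linear u"
  shows "line_polynomial N r (wedge us)"
proof (rule line_polynomial_cong [OF assms(1)])
  show "line_polynomial N r (\<lambda>ws. \<Sum>p | p permutes {0..<length us}.
      signof p * (\<Prod>i = 0..<length us. (us ! i) (ws ! p i)))"
    using assms(2,3)
    by (intro line_polynomial_sum line_polynomial_mult line_polynomial_const line_polynomial_prod
        line_polynomial_coordinate) (auto simp: permutes_less)
qed (use assms(2) in \<open>simp add: rational_tuples_def wedge_eq_sum\<close>)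

text \<open>
  Join \<open>ws\<close> to \<open>ws0\<close> by a line. Along it the product of \<open>f\<close> and \<open>g\<close> is a polynomial with
  infinitely many zeros, and the factor \<open>g\<close> is not the zero polynomial because of its value at \<open>ws0\<close>.
\<close>

lemma zero_of_generic_zero:
  assumes N: "full_lattice N" and "line_polynomial N r f" "line_polynomial N r g"
    and "\<And>ws. ws \<in> rational_tuples N r \<Longrightarrow> g ws \<noteq> 0 \<Longrightarrow> f ws = 0"
    and ws0: "ws0 \<in> rational_tuples N r" "g ws0 \<noteq> 0" and ws: "ws \<in> rational_tuples N r"
  shows "f ws = 0"
proof -
  obtain P Q where PQ: "\<forall>t\<in>\<rat>. f (line_point t ws ws0) = poly P t" "\<forall>t\<in>\<rat>. g (line_point t ws ws0) = poly Q t"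
    using assms(2,3) ws ws0(1) unfolding line_polynomial_def by blast
  have ends: "line_point 0 ws ws0 = ws" "line_point 1 ws ws0 = ws0"
    using line_point_ends [of ws ws0] ws ws0 by (auto simp: rational_tuples_def)
  have "\<forall>t\<in>\<rat>. poly (P * Q) t = 0"
    using assms(4) line_point_rational [OF N ws ws0(1)] PQ by fastforce
  then have "(\<rat>::real set) \<subseteq> {t. poly (P * Q) t = 0}" by blast
  moreover have "infinite (\<rat>::real set)"
  proof
    assume "finite (\<rat>::real set)"
    then have "finite (range real)" by (rule finite_subset [rotated]) auto
    then show False using finite_imageD [of real UNIV] by (auto simp: inj_on_def)
  qed
  ultimately have "P * Q = 0" using poly_roots_finite [of "P * Q"] finite_subset by blast
  moreover have "Q \<noteq> 0" using PQ(2) ends ws0(2) by (metis Rats_1 poly_0)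
  ultimately have "P = 0" by simp
  then show ?thesis using PQ(1) ends by (metis Rats_0 poly_0)
qed

text \<open>
  Finitely many nonempty Zariski open sets meet: a condition that failed wherever all the previous
  ones hold would fail everywhere.
\<close>

lemma common_generic_point:
  assumes N: "full_lattice N" and "finite A"
    and "\<And>s. s \<in> A \<Longrightarrow> line_polynomial N r (D s)"
    and "\<And>s. s \<in> A \<Longrightarrow> \<exists>ws\<in>rational_tuples N r. D s ws \<noteq> 0"
  shows "\<exists>ws\<in>rational_tuples N r. \<forall>s\<in>A. D s ws \<noteq> 0"
  using assms(2-4)
proof (induction A)
  case empty
  have "0 \<in> lattice_rat N"
    using N unfolding full_lattice_def lattice_rat_def
    by (auto intro!: exI [of _ "1::nat"] exI [of _ "\<lambda>_. 0::int"])
  then have "replicate r 0 \<in> rational_tuples N r" by (auto simp: rational_tuples_def)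
  then show ?case by blast
next
  case (insert s A)
  then obtain ws1 where ws1: "ws1 \<in> rational_tuples N r" "\<forall>s\<in>A. D s ws1 \<noteq> 0" by auto
  obtain ws2 where ws2: "ws2 \<in> rational_tuples N r" "D s ws2 \<noteq> 0" using insert.prems(2) by blast
  show ?case
  proof (rule ccontr)
    assume contr: "\<not> ?thesis"
    have "D s ws2 = 0"
    proof (rule zero_of_generic_zero [OF N])
      show "line_polynomial N r (D s)" using insert.prems(1) by simp
      show "line_polynomial N r (\<lambda>ws. \<Prod>s\<in>A. D s ws)"
        using insert.prems(1) by (intro line_polynomial_prod) simp
      show "D s ws = 0" if "ws \<in> rational_tuples N r" "(\<Prod>s\<in>A. D s ws) \<noteq> 0" for ws
        using contr that insert.hyps(1) by auto
      show "(\<Prod>s\<in>A. D s ws1) \<noteq> 0" using ws1 insert.hyps(1) by simp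
    qed (use ws1 ws2 in auto)
    then show False using ws2 by simp
  qed
qed


section \<open>Polynomial functions on the Grassmann cone\<close>

lemma wedge_in_ext_power:
  assumes "length us = r" "set us \<subseteq> dual_rat N" shows "wedge us \<in> ext_power N r"
  unfolding ext_power_def using assms
  by (intro CollectI exI [of _ "{us}"] exI [of _ "\<lambda>_. 1"]) auto

lemma ext_power_comb:
  assumes "\<omega> \<in> ext_power N r" "\<eta> \<in> ext_power N r"
  shows "(\<lambda>ws. of_rat a * \<omega> ws + of_rat b * \<eta> ws) \<in> ext_power N r"
proof -
  obtain S c where S: "finite S" "S \<subseteq> {us. length us = r \<and> set us \<subseteq> dual_rat N}"
    "\<omega> = (\<lambda>ws. \<Sum>us\<in>S. of_rat (c us) * wedge us ws)"
    using assms(1) unfolding ext_power_def by blast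
  obtain S' c' where S': "finite S'" "S' \<subseteq> {us. length us = r \<and> set us \<subseteq> dual_rat N}"
    "\<eta> = (\<lambda>ws. \<Sum>us\<in>S'. of_rat (c' us) * wedge us ws)"
    using assms(2) unfolding ext_power_def by blast
  define d where "d us = (if us \<in> S then a * c us else 0) + (if us \<in> S' then b * c' us else 0)" for us
  have "of_rat a * \<omega> ws + of_rat b * \<eta> ws = (\<Sum>us\<in>S \<union> S'. of_rat (d us) * wedge us ws)" for ws
  proof -
    have "of_rat a * \<omega> ws = (\<Sum>us\<in>S. of_rat (a * c us) * wedge us ws)"
      by (simp add: S(3) sum_distrib_left of_rat_mult mult.assoc)
    also have "\<dots> = (\<Sum>us\<in>S \<union> S'. of_rat (if us \<in> S then a * c us else 0) * wedge us ws)"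
      using S(1) S'(1) by (intro sum.mono_neutral_cong_left) auto
    finally have 1: "of_rat a * \<omega> ws = (\<Sum>us\<in>S \<union> S'. of_rat (if us \<in> S then a * c us else 0) * wedge us ws)" .
    have "of_rat b * \<eta> ws = (\<Sum>us\<in>S'. of_rat (b * c' us) * wedge us ws)"
      by (simp add: S'(3) sum_distrib_left of_rat_mult mult.assoc)
    also have "\<dots> = (\<Sum>us\<in>S \<union> S'. of_rat (if us \<in> S' then b * c' us else 0) * wedge us ws)"
      using S(1) S'(1) by (intro sum.mono_neutral_cong_left) auto
    finally show ?thesis
      unfolding 1 d_def by (simp only: of_rat_add distrib_right sum.distrib)
  qed
  then show ?thesis
    unfolding ext_power_def using S(1,2) S'(1,2)
    by (intro CollectI exI [of _ "S \<union> S'"] exI [of _ d]) auto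
qed

lemma ext_power_zero: "(\<lambda>ws. 0) \<in> ext_power N r"
  unfolding ext_power_def by (intro CollectI exI [of _ "{}"]) simp

lemma dual_space_zero:
  assumes "\<xi> \<in> dual_space (ext_power N r)" shows "\<xi> (\<lambda>ws. 0) = 0"
proof -
  have "\<forall>\<omega>\<in>ext_power N r. \<forall>\<eta>\<in>ext_power N r. \<forall>a b. \<xi> (\<lambda>ws. of_rat a * \<omega> ws + of_rat b * \<eta> ws) =
        of_rat a * \<xi> \<omega> + of_rat b * \<xi> \<eta>"
    using assms unfolding dual_space_def mem_Collect_eq by (elim conjE)
  from this [rule_format, OF ext_power_zero ext_power_zero, of 0 0] show ?thesis by simp
qed

lemma plucker_apply: "\<omega> \<in> ext_power N r \<Longrightarrow> plucker N r ws \<omega> = \<omega> ws"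
  by (simp add: plucker_def)

lemma plucker_in_dual_space:
  assumes "ws \<in> rational_tuples N r"
  shows "plucker N r ws \<in> dual_space (ext_power N r)"
proof -
  have "\<omega> ws \<in> \<rat>" if "\<omega> \<in> ext_power N r" for \<omega>
  proof -
    obtain S c where S: "finite S" "S \<subseteq> {us. length us = r \<and> set us \<subseteq> dual_rat N}"
      "\<omega> = (\<lambda>ws. \<Sum>us\<in>S. of_rat (c us) * wedge us ws)"
      using \<open>\<omega> \<in> ext_power N r\<close> unfolding ext_power_def by blast
    have "wedge us ws \<in> \<rat>" if "us \<in> S" for us
      using S(2) assms that by (intro wedge_rational [of us N]) (auto simp: rational_tuples_def)
    then show ?thesis unfolding S(3) by (intro Rats_sum Rats_mult) auto
  qed
  then show ?thesis
    unfolding dual_space_def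
    by (auto simp: plucker_apply ext_power_comb) (simp add: plucker_def)
qed

text \<open>
  Elements of \<open>sym_power\<close> take the default value outside the dual space. This predicate looks at the
  values on the dual space only, so that pointwise sums and products need no restriction.
\<close>

definition symmetric_function ::
    "'a::euclidean_space set \<Rightarrow> nat \<Rightarrow> nat \<Rightarrow> (('a form \<Rightarrow> real) \<Rightarrow> real) \<Rightarrow> bool" where
  "symmetric_function N r d f \<longleftrightarrow>
    restrict f (dual_space (ext_power N r)) \<in> sym_power (ext_power N r) d"

lemma symmetric_function_iff:
  "symmetric_function N r d f \<longleftrightarrow> (\<exists>S c. finite S \<and> S \<subseteq> {\<omega>s. length \<omega>s = d \<and> set \<omega>s \<subseteq> ext_power N r} \<and>
     (\<forall>\<xi>\<in>dual_space (ext_power N r). f \<xi> = (\<Sum>\<omega>s\<in>S. of_rat (c \<omega>s) * prod_list (map \<xi> \<omega>s))))"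
  unfolding symmetric_function_def sym_power_def mem_Collect_eq restrict_def fun_eq_iff
  by (intro ex_cong1) auto

lemma sym_power_imp:
  assumes "p \<in> sym_power (ext_power N r) d"
  shows "symmetric_function N r d p" "restrict p (dual_space (ext_power N r)) = p"
proof -
  show *: "restrict p (dual_space (ext_power N r)) = p"
    using assms by (auto simp: sym_power_def)
  show "symmetric_function N r d p" unfolding symmetric_function_def * by (rule assms)
qed

lemma symmetric_function_add:
  assumes "symmetric_function N r d f" "symmetric_function N r d g"
  shows "symmetric_function N r d (\<lambda>\<xi>. f \<xi> + g \<xi>)"
proof -
  let ?L = "{\<omega>s. length \<omega>s = d \<and> set \<omega>s \<subseteq> ext_power N r}"
  obtain S c where S: "finite S" "S \<subseteq> ?L"
    "\<forall>\<xi>\<in>dual_space (ext_power N r). f \<xi> = (\<Sum>\<omega>s\<in>S. of_rat (c \<omega>s) * prod_list (map \<xi> \<omega>s))"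
    using assms(1) unfolding symmetric_function_iff by blast
  obtain S' c' where S': "finite S'" "S' \<subseteq> ?L"
    "\<forall>\<xi>\<in>dual_space (ext_power N r). g \<xi> = (\<Sum>\<omega>s\<in>S'. of_rat (c' \<omega>s) * prod_list (map \<xi> \<omega>s))"
    using assms(2) unfolding symmetric_function_iff by blast
  define e where "e us = (if us \<in> S then c us else 0) + (if us \<in> S' then c' us else 0)" for us
  have "f \<xi> + g \<xi> = (\<Sum>\<omega>s\<in>S \<union> S'. of_rat (e \<omega>s) * prod_list (map \<xi> \<omega>s))"
    if \<xi>: "\<xi> \<in> dual_space (ext_power N r)" for \<xi>
  proof -
    have 1: "f \<xi> = (\<Sum>\<omega>s\<in>S \<union> S'. of_rat (if \<omega>s \<in> S then c \<omega>s else 0) * prod_list (map \<xi> \<omega>s))"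
      unfolding bspec [OF S(3) \<xi>]
      using S(1) S'(1) by (intro sum.mono_neutral_cong_left) auto
    have 2: "g \<xi> = (\<Sum>\<omega>s\<in>S \<union> S'. of_rat (if \<omega>s \<in> S' then c' \<omega>s else 0) * prod_list (map \<xi> \<omega>s))"
      unfolding bspec [OF S'(3) \<xi>]
      using S(1) S'(1) by (intro sum.mono_neutral_cong_left) auto
    show ?thesis unfolding 1 2 e_def by (simp only: of_rat_add distrib_right sum.distrib)
  qed
  then show ?thesis
    unfolding symmetric_function_iff using S(1,2) S'(1,2)
    by (intro exI [of _ "S \<union> S'"] exI [of _ e]) auto
qed

lemma symmetric_function_mult:
  assumes "symmetric_function N r d f" "symmetric_function N r e g"
  shows "symmetric_function N r (d + e) (\<lambda>\<xi>. f \<xi> * g \<xi>)"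
proof -
  obtain S c where S: "finite S" "S \<subseteq> {\<omega>s. length \<omega>s = d \<and> set \<omega>s \<subseteq> ext_power N r}"
    "\<forall>\<xi>\<in>dual_space (ext_power N r). f \<xi> = (\<Sum>\<omega>s\<in>S. of_rat (c \<omega>s) * prod_list (map \<xi> \<omega>s))"
    using assms(1) unfolding symmetric_function_iff by blast
  obtain S' c' where S': "finite S'" "S' \<subseteq> {\<omega>s. length \<omega>s = e \<and> set \<omega>s \<subseteq> ext_power N r}"
    "\<forall>\<xi>\<in>dual_space (ext_power N r). g \<xi> = (\<Sum>\<omega>s\<in>S'. of_rat (c' \<omega>s) * prod_list (map \<xi> \<omega>s))"
    using assms(2) unfolding symmetric_function_iff by blast
  define a where "a \<omega>s = c (take d \<omega>s) * c' (drop d \<omega>s)" for \<omega>s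
  let ?app = "\<lambda>(x, y). x @ y"
  have inj: "inj_on ?app (S \<times> S')"
    using S(2) by (auto simp: inj_on_def subset_iff append_eq_append_conv)
  have "f \<xi> * g \<xi> = (\<Sum>\<omega>s\<in>?app ` (S \<times> S'). of_rat (a \<omega>s) * prod_list (map \<xi> \<omega>s))"
    if \<xi>: "\<xi> \<in> dual_space (ext_power N r)" for \<xi>
  proof -
    have len: "length x = d" if "x \<in> S" for x using S(2) that by auto
    have "f \<xi> * g \<xi> = (\<Sum>(x, y)\<in>S \<times> S'. (of_rat (c x) * prod_list (map \<xi> x)) * (of_rat (c' y) * prod_list (map \<xi> y)))"
      unfolding bspec [OF S(3) \<xi>] bspec [OF S'(3) \<xi>] by (simp add: sum_product sum.cartesian_product)
    also have "\<dots> = (\<Sum>z\<in>S \<times> S'. of_rat (a (?app z)) * prod_list (map \<xi> (?app z)))"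
      by (intro sum.cong) (auto simp: a_def of_rat_mult len mult_ac)
    also have "\<dots> = (\<Sum>\<omega>s\<in>?app ` (S \<times> S'). of_rat (a \<omega>s) * prod_list (map \<xi> \<omega>s))"
      using sum.reindex [OF inj, of "\<lambda>\<omega>s. of_rat (a \<omega>s) * prod_list (map \<xi> \<omega>s)"] by (simp add: comp_def)
    finally show ?thesis .
  qed
  moreover have "?app ` (S \<times> S') \<subseteq> {\<omega>s. length \<omega>s = d + e \<and> set \<omega>s \<subseteq> ext_power N r}"
    using S(2) S'(2) by (auto simp: subset_iff)
  ultimately show ?thesis
    unfolding symmetric_function_iff using S(1) S'(1)
    by (intro exI [of _ "?app ` (S \<times> S')"] exI [of _ a]) auto
qed

lemma symmetric_function_const: "symmetric_function N r 0 (\<lambda>\<xi>. of_rat c)"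
  unfolding symmetric_function_iff by (intro exI [of _ "{[]}"] exI [of _ "\<lambda>_. c"]) auto

lemma symmetric_function_zero: "symmetric_function N r d (\<lambda>\<xi>. 0)"
  unfolding symmetric_function_iff by (intro exI [of _ "{}"]) auto

lemma symmetric_function_generator:
  "\<omega> \<in> ext_power N r \<Longrightarrow> symmetric_function N r 1 (\<lambda>\<xi>. \<xi> \<omega>)"
  unfolding symmetric_function_iff by (intro exI [of _ "{[\<omega>]}"] exI [of _ "\<lambda>_. 1"]) auto

lemma symmetric_function_scale:
  "symmetric_function N r d f \<Longrightarrow> symmetric_function N r d (\<lambda>\<xi>. of_rat c * f \<xi>)"
  using symmetric_function_mult [OF symmetric_function_const] by fastforce

lemma symmetric_function_sum:
  "(\<And>x. x \<in> A \<Longrightarrow> symmetric_function N r d (f x)) \<Longrightarrow> symmetric_function N r d (\<lambda>\<xi>. \<Sum>x\<in>A. f x \<xi>)"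
  by (induction A rule: infinite_finite_induct)
    (auto intro: symmetric_function_zero symmetric_function_add)

lemma symmetric_function_power:
  assumes "symmetric_function N r 1 f" shows "symmetric_function N r m (\<lambda>\<xi>. f \<xi> ^ m)"
proof (induction m)
  case 0
  then show ?case using symmetric_function_const [of N r 1] by simp
next
  case (Suc m)
  then show ?case using symmetric_function_mult [OF assms Suc] by simp
qed

lemma symmetric_function_prod:
  assumes "finite A" "\<And>x. x \<in> A \<Longrightarrow> symmetric_function N r (d x) (f x)"
  shows "symmetric_function N r (\<Sum>x\<in>A. d x) (\<lambda>\<xi>. \<Prod>x\<in>A. f x \<xi>)"
  using assms
proof (induction A)
  case empty
  then show ?case using symmetric_function_const [of N r 1] by simp
next
  case (insert x A)
  then show ?case using symmetric_function_mult [of N r "d x" "f x"] by simp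
qed

lemma symmetric_function_poly_eval:
  assumes "poly_homogeneous d p" "\<And>i. \<omega> i \<in> ext_power N r"
  shows "symmetric_function N r d (\<lambda>\<xi>. poly_eval (\<lambda>i. \<xi> (\<omega> i)) p)"
  unfolding poly_eval_def
proof (intro symmetric_function_sum symmetric_function_scale)
  fix m assume "m \<in> Poly_Mapping.keys p"
  then have d: "d = (\<Sum>i\<in>Poly_Mapping.keys m. Poly_Mapping.lookup m i)"
    using assms(1) by (simp add: poly_homogeneous_def)
  show "symmetric_function N r d (\<lambda>\<xi>. \<Prod>i\<in>Poly_Mapping.keys m. \<xi> (\<omega> i) ^ Poly_Mapping.lookup m i)"
    unfolding d
    by (intro symmetric_function_prod symmetric_function_power symmetric_function_generator assms(2)) simp
qed

lemma line_polynomial_symmetric_function: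
  assumes N: "full_lattice N" and f: "symmetric_function N r d f"
  shows "line_polynomial N r (\<lambda>ws. f (plucker N r ws))"
proof -
  obtain S c where S: "finite S" "S \<subseteq> {\<omega>s. length \<omega>s = d \<and> set \<omega>s \<subseteq> ext_power N r}"
    "\<forall>\<xi>\<in>dual_space (ext_power N r). f \<xi> = (\<Sum>\<omega>s\<in>S. of_rat (c \<omega>s) * prod_list (map \<xi> \<omega>s))"
    using f unfolding symmetric_function_iff by blast
  have form: "line_polynomial N r (\<lambda>ws. \<omega> ws)" if \<omega>: "\<omega> \<in> ext_power N r" for \<omega>
  proof -
    obtain T b where T: "finite T" "T \<subseteq> {us. length us = r \<and> set us \<subseteq> dual_rat N}"
      "\<omega> = (\<lambda>ws. \<Sum>us\<in>T. of_rat (b us) * wedge us ws)"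
      using \<omega> unfolding ext_power_def by blast
    show ?thesis
      unfolding T(3)
    proof (intro line_polynomial_sum line_polynomial_mult line_polynomial_const)
      fix us assume "us \<in> T"
      then show "line_polynomial N r (wedge us)"
        using T(2) by (intro line_polynomial_wedge [OF N]) (auto simp: dual_rat_def)
    qed
  qed
  have "line_polynomial N r (\<lambda>ws. prod_list (map (\<lambda>\<omega>. \<omega> ws) \<omega>s))"
    if "set \<omega>s \<subseteq> ext_power N r" for \<omega>s
    using that
    by (induction \<omega>s) (auto intro: line_polynomial_const line_polynomial_mult form)
  then have "line_polynomial N r (\<lambda>ws. \<Sum>\<omega>s\<in>S. of_rat (c \<omega>s) * prod_list (map (\<lambda>\<omega>. \<omega> ws) \<omega>s))"
    using S(2) by (intro line_polynomial_sum line_polynomial_mult line_polynomial_const) blast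
  then show ?thesis
  proof (rule line_polynomial_cong [OF N])
    fix ws assume ws: "ws \<in> rational_tuples N r"
    have "prod_list (map (plucker N r ws) \<omega>s) = prod_list (map (\<lambda>\<omega>. \<omega> ws) \<omega>s)" if "\<omega>s \<in> S" for \<omega>s
    proof -
      have "set \<omega>s \<subseteq> ext_power N r" using S(2) that by auto
      then have "map (plucker N r ws) \<omega>s = map (\<lambda>\<omega>. \<omega> ws) \<omega>s"
        by (intro map_cong refl) (auto simp: plucker_apply)
      then show ?thesis by (rule arg_cong)
    qed
    then show "(\<Sum>\<omega>s\<in>S. of_rat (c \<omega>s) * prod_list (map (\<lambda>\<omega>. \<omega> ws) \<omega>s)) = f (plucker N r ws)"
      unfolding bspec [OF S(3) plucker_in_dual_space [OF ws]] by simp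
  qed
qed

lemma grass_cone_iff:
  "\<xi> \<in> grass_cone N r \<longleftrightarrow>
    (\<exists>ws\<in>rational_tuples N r. distinct ws \<and> independent (set ws) \<and> \<xi> = plucker N r ws)"
  by (auto simp: grass_cone_def rational_tuples_def)

lemma grass_cone_dual: "\<xi> \<in> grass_cone N r \<Longrightarrow> \<xi> \<in> dual_space (ext_power N r)"
  using plucker_in_dual_space by (auto simp: grass_cone_iff)

text \<open>
  Irreducibility of the Grassmannian. The extra factor \<open>wedge us\<close>, with forms \<open>us\<close> independent on the
  plane of \<open>\<xi>0\<close>, singles out the tuples on the line that are still linearly independent.
\<close>

lemma zero_on_grass_cone:
  assumes N: "full_lattice N"
    and f: "symmetric_function N r d f" and g: "symmetric_function N r e g"
    and fg: "\<And>\<xi>. \<xi> \<in> grass_cone N r \<Longrightarrow> g \<xi> \<noteq> 0 \<Longrightarrow> f \<xi> = 0"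
    and \<xi>0: "\<xi>0 \<in> grass_cone N r" "g \<xi>0 \<noteq> 0"
    and \<xi>: "\<xi> \<in> grass_cone N r"
  shows "f \<xi> = 0"
proof -
  obtain ws0 where ws0: "ws0 \<in> rational_tuples N r" "distinct ws0" "independent (set ws0)" "\<xi>0 = plucker N r ws0"
    using \<xi>0(1) unfolding grass_cone_iff by blast
  obtain ws where ws: "ws \<in> rational_tuples N r" "\<xi> = plucker N r ws"
    using \<xi> unfolding grass_cone_iff by blast
  from independent_imp_wedge_nonzero [OF ws0(2,3)] obtain us where
    us: "length us = length ws0" "\<forall>u\<in>set us. linear u" "wedge us ws0 \<noteq> 0"
    by (elim exE conjE)
  note lin = bspec [OF us(2)]
  have lus: "length us = r" using us(1) ws0(1) by (simp add: rational_tuples_def)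
  have "f (plucker N r ws) = 0"
  proof (rule zero_of_generic_zero [OF N line_polynomial_symmetric_function [OF N f] _ _ ws0(1) _ ws(1)])
    show "line_polynomial N r (\<lambda>ws. g (plucker N r ws) * wedge us ws)"
      by (rule line_polynomial_mult [OF line_polynomial_symmetric_function [OF N g]
            line_polynomial_wedge [OF N lus lin]])
    show "f (plucker N r ws) = 0" if "ws \<in> rational_tuples N r" "g (plucker N r ws) * wedge us ws \<noteq> 0" for ws
    proof (rule fg)
      have "wedge us ws \<noteq> 0" using that(2) by simp
      from wedge_nonzero_independent [OF this lin]
      show "plucker N r ws \<in> grass_cone N r" unfolding grass_cone_iff using that(1) by blast
      show "g (plucker N r ws) \<noteq> 0" using that(2) by simp
    qed
    show "g (plucker N r ws0) * wedge us ws0 \<noteq> 0" using \<xi>0(2) ws0(4) us(3) by simp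
  qed
  then show ?thesis by (simp add: ws(2))
qed

section \<open>The field of rational functions on the Grassmannian\<close>

context
  fixes N :: "'a::euclidean_space set" and r :: nat
  assumes N: "full_lattice N"
begin

abbreviation (input) "D \<equiv> dual_space (ext_power N r)"
abbreviation (input) "G \<equiv> grass_cone N r"

lemma fractions_iff:
  "(restrict p D, restrict q D) \<in> fractions N r \<longleftrightarrow>
    (\<exists>d. symmetric_function N r d p \<and> symmetric_function N r d q) \<and> (\<exists>\<xi>\<in>G. q \<xi> \<noteq> 0)"
proof -
  have "(\<exists>\<xi>\<in>G. restrict q D \<xi> \<noteq> 0) \<longleftrightarrow> (\<exists>\<xi>\<in>G. q \<xi> \<noteq> 0)"
    by (intro bex_cong refl) (simp add: grass_cone_dual)
  then show ?thesis
    unfolding fractions_def symmetric_function_def by (auto simp del: restrict_apply)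
qed

lemma fractionsE:
  assumes "(p, q) \<in> fractions N r"
  obtains d where "symmetric_function N r d p" "symmetric_function N r d q" "\<exists>\<xi>\<in>G. q \<xi> \<noteq> 0"
    "restrict p D = p" "restrict q D = q"
proof -
  from assms obtain d where d: "p \<in> sym_power (ext_power N r) d" "q \<in> sym_power (ext_power N r) d"
    "\<exists>\<xi>\<in>G. q \<xi> \<noteq> 0"
    unfolding fractions_def by auto
  show ?thesis
    by (rule that [OF sym_power_imp(1) [OF d(1)] sym_power_imp(1) [OF d(2)] d(3)
          sym_power_imp(2) [OF d(1)] sym_power_imp(2) [OF d(2)]])
qed

lemma fractions_denominator_mult:
  assumes "(p, q) \<in> fractions N r" "(p', q') \<in> fractions N r"
  shows "\<exists>\<xi>\<in>G. q \<xi> * q' \<xi> \<noteq> 0"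
proof (rule ccontr)
  assume contr: "\<not> ?thesis"
  obtain d where d: "symmetric_function N r d q" "\<exists>\<xi>\<in>G. q \<xi> \<noteq> 0" by (rule fractionsE [OF assms(1)])
  obtain d' where d': "symmetric_function N r d' q'" "\<exists>\<xi>\<in>G. q' \<xi> \<noteq> 0" by (rule fractionsE [OF assms(2)])
  from d(2) obtain \<xi>0 where \<xi>0: "\<xi>0 \<in> G" "q \<xi>0 \<noteq> 0" ..
  have "q' \<xi> = 0" if "\<xi> \<in> G" for \<xi>
    by (rule zero_on_grass_cone [where f = q' and g = q and \<xi> = \<xi> and ?\<xi>0.0 = \<xi>0, OF N d'(1) d(1) _ \<xi>0 that])
      (use contr in auto)
  moreover from d'(2) obtain \<xi>1 where "\<xi>1 \<in> G" "q' \<xi>1 \<noteq> 0" ..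
  ultimately show False by simp
qed

text \<open>
  Transitivity requires cancelling the middle denominator, which is allowed because it does not vanish
  identically on the irreducible Grassmannian.
\<close>

lemma equiv_fraction_rel: "equiv (fractions N r) (fraction_rel N r)"
proof (rule equivI)
  show "fraction_rel N r \<subseteq> fractions N r \<times> fractions N r"
    by (auto simp: fraction_rel_def)
  show "refl_on (fractions N r) (fraction_rel N r)"
    by (rule refl_onI) (auto simp: fraction_rel_def)
  show "sym (fraction_rel N r)" by (rule symI) (auto simp: fraction_rel_def)
  show "trans (fraction_rel N r)"
  proof (rule transI, clarify)
    fix p q p' q' p'' q''
    assume 1: "((p, q), (p', q')) \<in> fraction_rel N r" and 2: "((p', q'), (p'', q'')) \<in> fraction_rel N r"
    then have f: "(p, q) \<in> fractions N r" "(p', q') \<in> fractions N r" "(p'', q'') \<in> fractions N r"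
      by (auto simp: fraction_rel_def)
    have e1: "p \<xi> * q' \<xi> = p' \<xi> * q \<xi>" and e2: "p' \<xi> * q'' \<xi> = p'' \<xi> * q' \<xi>" if "\<xi> \<in> G" for \<xi>
      using 1 2 that by (auto simp: fraction_rel_def)
    obtain d where d: "symmetric_function N r d p" "symmetric_function N r d q" by (rule fractionsE [OF f(1)])
    obtain d' where d': "symmetric_function N r d' q'" "\<exists>\<xi>\<in>G. q' \<xi> \<noteq> 0" by (rule fractionsE [OF f(2)])
    obtain d'' where d'': "symmetric_function N r d'' p''" "symmetric_function N r d'' q''" by (rule fractionsE [OF f(3)])
    have s: "symmetric_function N r (d + d'') (\<lambda>\<xi>. p \<xi> * q'' \<xi> + of_rat (- 1) * (q \<xi> * p'' \<xi>))"
      by (intro symmetric_function_add symmetric_function_scale symmetric_function_mult d d'')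
    from d'(2) obtain \<xi>0 where \<xi>0: "\<xi>0 \<in> G" "q' \<xi>0 \<noteq> 0" ..
    have "p \<xi> * q'' \<xi> + of_rat (- 1) * (q \<xi> * p'' \<xi>) = 0" if "\<xi> \<in> G" for \<xi>
    proof (rule zero_on_grass_cone [where f = "\<lambda>\<xi>. p \<xi> * q'' \<xi> + of_rat (- 1) * (q \<xi> * p'' \<xi>)"
          and g = q' and \<xi> = \<xi> and ?\<xi>0.0 = \<xi>0, OF N s d'(1) _ \<xi>0 that])
      fix \<xi> assume \<xi>: "\<xi> \<in> G" "q' \<xi> \<noteq> 0"
      have "q' \<xi> * (p \<xi> * q'' \<xi>) = (p \<xi> * q' \<xi>) * q'' \<xi>" by (simp add: mult_ac)
      also have "\<dots> = q \<xi> * (p' \<xi> * q'' \<xi>)" unfolding e1 [OF \<xi>(1)] by (simp add: mult_ac)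
      also have "\<dots> = q' \<xi> * (q \<xi> * p'' \<xi>)" unfolding e2 [OF \<xi>(1)] by (simp add: mult_ac)
      finally show "p \<xi> * q'' \<xi> + of_rat (- 1) * (q \<xi> * p'' \<xi>) = 0" using \<xi>(2) by simp
    qed
    then show "((p, q), (p'', q'')) \<in> fraction_rel N r"
      using f by (auto simp: fraction_rel_def mult.commute)
  qed
qed

lemma ratfun_eqI:
  assumes "(p, q) \<in> fractions N r" "(p', q') \<in> fractions N r"
    and "\<And>\<xi>. \<xi> \<in> G \<Longrightarrow> p \<xi> * q' \<xi> = p' \<xi> * q \<xi>"
  shows "ratfun N r p q = ratfun N r p' q'"
  unfolding ratfun_def
  by (rule equiv_class_eq [OF equiv_fraction_rel]) (use assms in \<open>simp add: fraction_rel_def\<close>)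

lemma ratfun_carrier:
  "(p, q) \<in> fractions N r \<Longrightarrow> ratfun N r p q \<in> carrier (Rat_Grass N r)"
  by (simp add: Rat_Grass_def Let_def ratfun_def quotientI)

lemma ratfun_cases:
  assumes "X \<in> carrier (Rat_Grass N r)"
  obtains p q where "(p, q) \<in> fractions N r" "X = ratfun N r p q"
  using assms by (auto simp: Rat_Grass_def Let_def ratfun_def elim!: quotientE)

lemma ratfun_self: "(p, q) \<in> fractions N r \<Longrightarrow> (p, q) \<in> ratfun N r p q"
  unfolding ratfun_def by (rule equiv_class_self [OF equiv_fraction_rel])

lemma ratfun_member:
  assumes "(p', q') \<in> ratfun N r p q"
  shows "(p, q) \<in> fractions N r" "(p', q') \<in> fractions N r"
    "\<xi> \<in> G \<Longrightarrow> p \<xi> * q' \<xi> = p' \<xi> * q \<xi>"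
  using assms by (auto simp: ratfun_def fraction_rel_def)

lemma fractions_add:
  assumes "(p, q) \<in> fractions N r" "(p', q') \<in> fractions N r"
  shows "(\<lambda>\<xi>\<in>D. p \<xi> * q' \<xi> + p' \<xi> * q \<xi>, \<lambda>\<xi>\<in>D. q \<xi> * q' \<xi>) \<in> fractions N r"
  unfolding fractions_iff
proof
  obtain d where d: "symmetric_function N r d p" "symmetric_function N r d q" by (rule fractionsE [OF assms(1)])
  obtain d' where d': "symmetric_function N r d' p'" "symmetric_function N r d' q'" by (rule fractionsE [OF assms(2)])
  have "symmetric_function N r (d + d') (\<lambda>\<xi>. p' \<xi> * q \<xi>)"
    using symmetric_function_mult [OF d'(1) d(2)] by (simp add: add.commute)
  then have "symmetric_function N r (d + d') (\<lambda>\<xi>. p \<xi> * q' \<xi> + p' \<xi> * q \<xi>)"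
    by (rule symmetric_function_add [OF symmetric_function_mult [OF d(1) d'(2)]])
  then show "\<exists>d. symmetric_function N r d (\<lambda>\<xi>. p \<xi> * q' \<xi> + p' \<xi> * q \<xi>) \<and> symmetric_function N r d (\<lambda>\<xi>. q \<xi> * q' \<xi>)"
    using symmetric_function_mult [OF d(2) d'(2)] by blast
qed (rule fractions_denominator_mult [OF assms])

lemma ratfun_add:
  assumes "(p, q) \<in> fractions N r" "(p', q') \<in> fractions N r"
  shows "ratfun N r p q \<oplus>\<^bsub>Rat_Grass N r\<^esub> ratfun N r p' q' =
    ratfun N r (\<lambda>\<xi>\<in>D. p \<xi> * q' \<xi> + p' \<xi> * q \<xi>) (\<lambda>\<xi>\<in>D. q \<xi> * q' \<xi>)"
    (is "_ = ?Z")
proof -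
  have *: "ratfun N r (\<lambda>\<xi>\<in>D. p1 \<xi> * q1' \<xi> + p1' \<xi> * q1 \<xi>) (\<lambda>\<xi>\<in>D. q1 \<xi> * q1' \<xi>) = ?Z"
    if 1: "(p1, q1) \<in> ratfun N r p q" and 2: "(p1', q1') \<in> ratfun N r p' q'" for p1 q1 p1' q1'
  proof (rule ratfun_eqI [OF fractions_add [OF ratfun_member(2) [OF 1] ratfun_member(2) [OF 2]] fractions_add [OF assms]])
    fix \<xi> assume \<xi>: "\<xi> \<in> G"
    have e1: "p1 \<xi> * q \<xi> = p \<xi> * q1 \<xi>" and e2: "p1' \<xi> * q' \<xi> = p' \<xi> * q1' \<xi>"
      using ratfun_member(3) [OF 1 \<xi>] ratfun_member(3) [OF 2 \<xi>] by simp_all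
    have "(p1 \<xi> * q1' \<xi> + p1' \<xi> * q1 \<xi>) * (q \<xi> * q' \<xi>) =
        (p1 \<xi> * q \<xi>) * (q1' \<xi> * q' \<xi>) + (p1' \<xi> * q' \<xi>) * (q1 \<xi> * q \<xi>)" by (simp add: algebra_simps)
    also have "\<dots> = (p \<xi> * q' \<xi> + p' \<xi> * q \<xi>) * (q1 \<xi> * q1' \<xi>)" unfolding e1 e2 by (simp add: algebra_simps)
    finally show "(\<lambda>\<xi>\<in>D. p1 \<xi> * q1' \<xi> + p1' \<xi> * q1 \<xi>) \<xi> * (\<lambda>\<xi>\<in>D. q \<xi> * q' \<xi>) \<xi> =
        (\<lambda>\<xi>\<in>D. p \<xi> * q' \<xi> + p' \<xi> * q \<xi>) \<xi> * (\<lambda>\<xi>\<in>D. q1 \<xi> * q1' \<xi>) \<xi>"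
      by (simp add: grass_cone_dual [OF \<xi>])
  qed
  show ?thesis
    unfolding Rat_Grass_def Let_def ring.simps
  proof (intro equalityI subsetI)
    fix z assume "z \<in> ?Z"
    then show "z \<in> (\<Union>(p, q)\<in>ratfun N r p q. \<Union>(p', q')\<in>ratfun N r p' q'.
        ratfun N r (\<lambda>\<xi>\<in>D. p \<xi> * q' \<xi> + p' \<xi> * q \<xi>) (\<lambda>\<xi>\<in>D. q \<xi> * q' \<xi>))"
      using ratfun_self [OF assms(1)] ratfun_self [OF assms(2)] by blast
  next
    fix z assume "z \<in> (\<Union>(p, q)\<in>ratfun N r p q. \<Union>(p', q')\<in>ratfun N r p' q'.
        ratfun N r (\<lambda>\<xi>\<in>D. p \<xi> * q' \<xi> + p' \<xi> * q \<xi>) (\<lambda>\<xi>\<in>D. q \<xi> * q' \<xi>))"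
    then obtain p1 q1 p1' q1' where "(p1, q1) \<in> ratfun N r p q" "(p1', q1') \<in> ratfun N r p' q'"
      "z \<in> ratfun N r (\<lambda>\<xi>\<in>D. p1 \<xi> * q1' \<xi> + p1' \<xi> * q1 \<xi>) (\<lambda>\<xi>\<in>D. q1 \<xi> * q1' \<xi>)"
      by blast
    then show "z \<in> ?Z" using * by simp
  qed
qed

lemma fractions_scale:
  assumes "(p, q) \<in> fractions N r"
  shows "(\<lambda>\<xi>\<in>D. of_rat c * p \<xi>, q) \<in> fractions N r"
proof -
  obtain d where d: "symmetric_function N r d p" "symmetric_function N r d q" "\<exists>\<xi>\<in>G. q \<xi> \<noteq> 0" "restrict q D = q"
    by (rule fractionsE [OF assms])
  have "(\<lambda>\<xi>\<in>D. of_rat c * p \<xi>, restrict q D) \<in> fractions N r"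
    unfolding fractions_iff using symmetric_function_scale [OF d(1)] d(2,3) by blast
  then show ?thesis by (simp only: d(4))
qed

lemma ratfun_smult:
  assumes "(p, q) \<in> fractions N r"
  shows "c \<odot>\<^bsub>Rat_Grass N r\<^esub> ratfun N r p q = ratfun N r (\<lambda>\<xi>\<in>D. of_rat c * p \<xi>) q" (is "_ = ?Z")
proof -
  have *: "ratfun N r (\<lambda>\<xi>\<in>D. of_rat c * p1 \<xi>) q1 = ?Z" if 1: "(p1, q1) \<in> ratfun N r p q" for p1 q1
  proof (rule ratfun_eqI [OF fractions_scale [OF ratfun_member(2) [OF 1]] fractions_scale [OF assms]])
    fix \<xi> assume \<xi>: "\<xi> \<in> G"
    show "(\<lambda>\<xi>\<in>D. of_rat c * p1 \<xi>) \<xi> * q \<xi> = (\<lambda>\<xi>\<in>D. of_rat c * p \<xi>) \<xi> * q1 \<xi>"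
      using ratfun_member(3) [OF 1 \<xi>] by (simp add: grass_cone_dual [OF \<xi>])
  qed
  show ?thesis
    unfolding Rat_Grass_def Let_def module.simps
  proof (intro equalityI subsetI)
    fix z assume "z \<in> ?Z"
    then show "z \<in> (\<Union>(p, q)\<in>ratfun N r p q. ratfun N r (\<lambda>\<xi>\<in>D. of_rat c * p \<xi>) q)"
      using ratfun_self [OF assms(1)] by blast
  next
    fix z assume "z \<in> (\<Union>(p, q)\<in>ratfun N r p q. ratfun N r (\<lambda>\<xi>\<in>D. of_rat c * p \<xi>) q)"
    then obtain p1 q1 where "(p1, q1) \<in> ratfun N r p q" "z \<in> ratfun N r (\<lambda>\<xi>\<in>D. of_rat c * p1 \<xi>) q1"
      by blast
    then show "z \<in> ?Z" using * by simp
  qed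
qed

lemma Rat_Grass_closed:
  "X \<in> carrier (Rat_Grass N r) \<Longrightarrow> Y \<in> carrier (Rat_Grass N r) \<Longrightarrow>
    X \<oplus>\<^bsub>Rat_Grass N r\<^esub> Y \<in> carrier (Rat_Grass N r)"
  "X \<in> carrier (Rat_Grass N r) \<Longrightarrow> c \<odot>\<^bsub>Rat_Grass N r\<^esub> X \<in> carrier (Rat_Grass N r)"
proof -
  assume X: "X \<in> carrier (Rat_Grass N r)"
  obtain p q where pq: "(p, q) \<in> fractions N r" "X = ratfun N r p q" by (rule ratfun_cases [OF X])
  show "c \<odot>\<^bsub>Rat_Grass N r\<^esub> X \<in> carrier (Rat_Grass N r)"
    unfolding pq(2) ratfun_smult [OF pq(1)] by (rule ratfun_carrier [OF fractions_scale [OF pq(1)]])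
  assume Y: "Y \<in> carrier (Rat_Grass N r)"
  obtain p' q' where pq': "(p', q') \<in> fractions N r" "Y = ratfun N r p' q'" by (rule ratfun_cases [OF Y])
  show "X \<oplus>\<^bsub>Rat_Grass N r\<^esub> Y \<in> carrier (Rat_Grass N r)"
    unfolding pq(2) pq'(2) ratfun_add [OF pq(1) pq'(1)]
    by (rule ratfun_carrier [OF fractions_add [OF pq(1) pq'(1)]])
qed

lemma Rat_Grass_one: "\<one>\<^bsub>Rat_Grass N r\<^esub> = ratfun N r (\<lambda>\<xi>\<in>D. 1) (\<lambda>\<xi>\<in>D. 1)"
  by (simp add: Rat_Grass_def Let_def)

end


section \<open>Tensor products over the rationals\<close>

context
  fixes A :: "(rat, 'x) module" and B :: "(rat, 'y) module"
  assumes A_add: "\<And>a a'. a \<in> carrier A \<Longrightarrow> a' \<in> carrier A \<Longrightarrow> a \<oplus>\<^bsub>A\<^esub> a' \<in> carrier A"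
    and A_smult: "\<And>c a. a \<in> carrier A \<Longrightarrow> c \<odot>\<^bsub>A\<^esub> a \<in> carrier A"
    and B_add: "\<And>b b'. b \<in> carrier B \<Longrightarrow> b' \<in> carrier B \<Longrightarrow> b \<oplus>\<^bsub>B\<^esub> b' \<in> carrier B"
    and B_smult: "\<And>c b. b \<in> carrier B \<Longrightarrow> c \<odot>\<^bsub>B\<^esub> b \<in> carrier B"
begin

abbreviation (input) "FG \<equiv> free_Abelian_group (carrier A \<times> carrier B)"
abbreviation (input) "R \<equiv> tensor_relations rat_ring A B"
abbreviation (input) "T \<equiv> tensor_product rat_ring A B"
abbreviation (input) "tens \<equiv> tensor rat_ring A B"

lemma frag_closed:
  "a \<in> carrier A \<Longrightarrow> b \<in> carrier B \<Longrightarrow> frag_of (a, b) \<in> carrier FG"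
  by simp

lemma frag_diff_closed: "x \<in> carrier FG \<Longrightarrow> y \<in> carrier FG \<Longrightarrow> x - y \<in> carrier FG"
  using keys_diff [of x y] by auto

abbreviation (input) "relators \<equiv>
  {frag_of (a \<oplus>\<^bsub>A\<^esub> a', b) - frag_of (a, b) - frag_of (a', b) | a a' b.
         a \<in> carrier A \<and> a' \<in> carrier A \<and> b \<in> carrier B} \<union>
      {frag_of (a, b \<oplus>\<^bsub>B\<^esub> b') - frag_of (a, b) - frag_of (a, b') | a b b'.
         a \<in> carrier A \<and> b \<in> carrier B \<and> b' \<in> carrier B} \<union>
      {frag_of (c \<odot>\<^bsub>A\<^esub> a, b) - frag_of (a, c \<odot>\<^bsub>B\<^esub> b) | c a b.
         c \<in> carrier rat_ring \<and> a \<in> carrier A \<and> b \<in> carrier B}"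

lemma relators_closed: "relators \<subseteq> carrier FG"
proof
  fix z assume "z \<in> relators"
  then consider
    (1) a a' b where "z = frag_of (a \<oplus>\<^bsub>A\<^esub> a', b) - frag_of (a, b) - frag_of (a', b)"
        "a \<in> carrier A" "a' \<in> carrier A" "b \<in> carrier B"
  | (2) a b b' where "z = frag_of (a, b \<oplus>\<^bsub>B\<^esub> b') - frag_of (a, b) - frag_of (a, b')"
        "a \<in> carrier A" "b \<in> carrier B" "b' \<in> carrier B"
  | (3) c a b where "z = frag_of (c \<odot>\<^bsub>A\<^esub> a, b) - frag_of (a, c \<odot>\<^bsub>B\<^esub> b)"
        "a \<in> carrier A" "b \<in> carrier B"
    by blast
  then show "z \<in> carrier FG"
    by cases (auto intro!: frag_diff_closed frag_closed A_add A_smult B_add B_smult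
        simp del: carrier_free_Abelian_group_iff)
qed

lemma tensor_relations_eq: "R = generate FG relators"
  by (simp add: tensor_relations_def)

lemma subgroup_R: "subgroup R FG"
  unfolding tensor_relations_eq
  by (rule group.generate_is_subgroup [OF group_free_Abelian_group relators_closed])

lemma comm_group_tensor: "comm_group T"
  unfolding tensor_product_def
  by (rule comm_group.abelian_FactGroup [OF abelian_free_Abelian_group subgroup_R])

lemma normal_R: "R \<lhd> FG"
  by (rule comm_group.subgroup_imp_normal [OF abelian_free_Abelian_group subgroup_R])

lemma coset_closed: "x \<in> carrier FG \<Longrightarrow> R #>\<^bsub>FG\<^esub> x \<in> carrier T"
  unfolding tensor_product_def FactGroup_def partial_object.simps
  by (rule group.rcosetsI [OF group_free_Abelian_group subgroup.subset [OF subgroup_R]])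

lemma coset_mult:
  "x \<in> carrier FG \<Longrightarrow> y \<in> carrier FG \<Longrightarrow>
    (R #>\<^bsub>FG\<^esub> x) \<otimes>\<^bsub>T\<^esub> (R #>\<^bsub>FG\<^esub> y) = R #>\<^bsub>FG\<^esub> (x + y)"
  using normal.rcos_sum [OF normal_R, of x y]
  by (simp add: tensor_product_def FactGroup_def)

lemma coset_eqI:
  assumes "x - y \<in> relators" "y \<in> carrier FG"
  shows "R #>\<^bsub>FG\<^esub> x = R #>\<^bsub>FG\<^esub> y"
proof -
  have "x - y \<in> R" unfolding tensor_relations_eq using assms(1) by (rule generate.incl)
  then have "x \<in> R #>\<^bsub>FG\<^esub> y" unfolding r_coset_def by force
  then show ?thesis
    by (rule group.repr_independence [OF group_free_Abelian_group _ assms(2) subgroup_R, symmetric])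
qed

lemma tensor_closed: "a \<in> carrier A \<Longrightarrow> b \<in> carrier B \<Longrightarrow> tens a b \<in> carrier T"
  unfolding tensor_def by (rule coset_closed [OF frag_closed])

lemma tensor_add_left:
  assumes "a \<in> carrier A" "a' \<in> carrier A" "b \<in> carrier B"
  shows "tens (a \<oplus>\<^bsub>A\<^esub> a') b = tens a b \<otimes>\<^bsub>T\<^esub> tens a' b"
proof -
  have "R #>\<^bsub>FG\<^esub> frag_of (a \<oplus>\<^bsub>A\<^esub> a', b) = R #>\<^bsub>FG\<^esub> (frag_of (a, b) + frag_of (a', b))"
  proof (rule coset_eqI)
    show "frag_of (a \<oplus>\<^bsub>A\<^esub> a', b) - (frag_of (a, b) + frag_of (a', b)) \<in> relators"
      using assms by (auto simp: algebra_simps)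
    show "frag_of (a, b) + frag_of (a', b) \<in> carrier FG"
      using subsetD [OF keys_add] assms by fastforce
  qed
  then show ?thesis
    unfolding tensor_def using coset_mult [OF frag_closed frag_closed, of a b a' b] assms by simp
qed

lemma tensor_add_right:
  assumes "a \<in> carrier A" "b \<in> carrier B" "b' \<in> carrier B"
  shows "tens a (b \<oplus>\<^bsub>B\<^esub> b') = tens a b \<otimes>\<^bsub>T\<^esub> tens a b'"
proof -
  have "R #>\<^bsub>FG\<^esub> frag_of (a, b \<oplus>\<^bsub>B\<^esub> b') = R #>\<^bsub>FG\<^esub> (frag_of (a, b) + frag_of (a, b'))"
  proof (rule coset_eqI)
    show "frag_of (a, b \<oplus>\<^bsub>B\<^esub> b') - (frag_of (a, b) + frag_of (a, b')) \<in> relators"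
      using assms by (auto simp: algebra_simps)
    show "frag_of (a, b) + frag_of (a, b') \<in> carrier FG"
      using subsetD [OF keys_add] assms by fastforce
  qed
  then show ?thesis
    unfolding tensor_def using coset_mult [OF frag_closed frag_closed, of a b a b'] assms by simp
qed

lemma tensor_smult:
  assumes "a \<in> carrier A" "b \<in> carrier B"
  shows "tens (c \<odot>\<^bsub>A\<^esub> a) b = tens a (c \<odot>\<^bsub>B\<^esub> b)"
  unfolding tensor_def
proof (rule coset_eqI)
  show "frag_of (c \<odot>\<^bsub>A\<^esub> a, b) - frag_of (a, c \<odot>\<^bsub>B\<^esub> b) \<in> relators"
    using assms by (auto simp: rat_ring_def)
  show "frag_of (a, c \<odot>\<^bsub>B\<^esub> b) \<in> carrier FG" using assms by (intro frag_closed B_smult)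
qed

lemma tensor_zero_left:
  assumes "a \<in> carrier A" "b \<in> carrier B" "a \<oplus>\<^bsub>A\<^esub> a = a"
  shows "tens a b = \<one>\<^bsub>T\<^esub>"
proof -
  interpret T: comm_group T by (rule comm_group_tensor)
  show ?thesis
    using tensor_add_left [OF assms(1,1,2)] tensor_closed [OF assms(1,2)]
    by (simp add: assms(3) T.l_cancel_one')
qed

lemma tensor_zero_right:
  assumes "a \<in> carrier A" "b \<in> carrier B" "b \<oplus>\<^bsub>B\<^esub> b = b"
  shows "tens a b = \<one>\<^bsub>T\<^esub>"
proof -
  interpret T: comm_group T by (rule comm_group_tensor)
  show ?thesis
    using tensor_add_right [OF assms(1,2,2)] tensor_closed [OF assms(1,2)]
    by (simp add: assms(3) T.l_cancel_one')
qed

end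

text \<open>
  Equality in the tensor product from an identity at generic points. Every \<open>X j\<close> and \<open>x\<close> is expanded
  in the elements \<open>y t\<close>; the coefficient of \<open>y t\<close> on the right is brought over the common
  denominator \<open>\<Prod>\<^sub>j q\<^sub>j\<close>, and equals the constant \<open>c t\<close> because both agree wherever this
  denominator does not vanish.
\<close>

lemma tensor_expansion:
  fixes N :: "'a::euclidean_space set" and r :: nat and B :: "(rat, 'y) module"
    and p q :: "'j \<Rightarrow> ('a form \<Rightarrow> real) \<Rightarrow> real"
  defines "F \<equiv> Rat_Grass N r"
  assumes N: "full_lattice N"
    and B_add: "\<And>b b'. b \<in> carrier B \<Longrightarrow> b' \<in> carrier B \<Longrightarrow> b \<oplus>\<^bsub>B\<^esub> b' \<in> carrier B"
    and B_smult: "\<And>c b. b \<in> carrier B \<Longrightarrow> c \<odot>\<^bsub>B\<^esub> b \<in> carrier B"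
    and fin: "finite S" "finite E"
    and pq: "\<And>j. j \<in> S \<Longrightarrow> (p j, q j) \<in> fractions N r"
    and y: "\<And>t. t \<in> E \<Longrightarrow> y t \<in> carrier B"
    and x: "x \<in> carrier B" and X: "\<And>j. j \<in> S \<Longrightarrow> X j \<in> carrier B"
    and x_expand: "\<And>a. a \<in> carrier F \<Longrightarrow> tensor rat_ring F B a x =
      (\<Otimes>\<^bsub>tensor_product rat_ring F B\<^esub> t\<in>E. tensor rat_ring F B (c t \<odot>\<^bsub>F\<^esub> a) (y t))"
    and X_expand: "\<And>a j. a \<in> carrier F \<Longrightarrow> j \<in> S \<Longrightarrow> tensor rat_ring F B a (X j) =
      (\<Otimes>\<^bsub>tensor_product rat_ring F B\<^esub> t\<in>E. tensor rat_ring F B (d j t \<odot>\<^bsub>F\<^esub> a) (y t))"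
    and coeff: "\<And>\<xi> t. \<xi> \<in> grass_cone N r \<Longrightarrow> (\<And>j. j \<in> S \<Longrightarrow> q j \<xi> \<noteq> 0) \<Longrightarrow> t \<in> E \<Longrightarrow>
      of_rat (c t) = (\<Sum>j\<in>S. of_rat (d j t) * (p j \<xi> / q j \<xi>))"
    and \<xi>0: "\<xi>0 \<in> grass_cone N r" "\<And>j. j \<in> S \<Longrightarrow> q j \<xi>0 \<noteq> 0"
  shows "tensor rat_ring F B \<one>\<^bsub>F\<^esub> x =
    (\<Otimes>\<^bsub>tensor_product rat_ring F B\<^esub> j\<in>S. tensor rat_ring F B (ratfun N r (p j) (q j)) (X j))"
proof -
  let ?D = "dual_space (ext_power N r)"
  let ?G = "grass_cone N r"
  let ?tens = "tensor rat_ring F B" and ?T = "tensor_product rat_ring F B"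
  note F_add = Rat_Grass_closed(1) [OF N, of _ r, folded F_def]
  note F_smult = Rat_Grass_closed(2) [OF N, of _ r, folded F_def]
  note hyps = F_add F_smult B_add B_smult
  have carr: "ratfun N r p q \<in> carrier F" if "(p, q) \<in> fractions N r" for p q
    unfolding F_def by (rule ratfun_carrier [OF N that])
  interpret T: comm_group ?T
    by (rule comm_group_tensor [OF hyps])
  have one: "(\<lambda>\<xi>\<in>?D. 1, \<lambda>\<xi>\<in>?D. 1) \<in> fractions N r"
    unfolding fractions_iff [OF N] using symmetric_function_const [of N r 1] \<xi>0(1) by auto
  have zero: "(\<lambda>\<xi>\<in>?D. 0, \<lambda>\<xi>\<in>?D. 1) \<in> fractions N r"
    unfolding fractions_iff [OF N]
    using symmetric_function_const [of N r 1] symmetric_function_zero [of N r 0] \<xi>0(1) by auto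
  \<comment> \<open>The fraction P t / Q is the coefficient of y t in the partial sum over S'.\<close>
  have main: "\<exists>P Q. (\<forall>t\<in>E. (P t, Q) \<in> fractions N r) \<and> (\<forall>\<xi>\<in>?G. Q \<xi> = (\<Prod>j\<in>S'. q j \<xi>)) \<and>
      (\<forall>\<xi>\<in>?G. (\<forall>j\<in>S'. q j \<xi> \<noteq> 0) \<longrightarrow> (\<forall>t\<in>E. P t \<xi> = Q \<xi> * (\<Sum>j\<in>S'. of_rat (d j t) * (p j \<xi> / q j \<xi>)))) \<and>
      (\<Otimes>\<^bsub>?T\<^esub> j\<in>S'. ?tens (ratfun N r (p j) (q j)) (X j)) =
      (\<Otimes>\<^bsub>?T\<^esub> t\<in>E. ?tens (ratfun N r (P t) Q) (y t))"
    if "S' \<subseteq> S" for S'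
    using finite_subset [OF that fin(1)] that
  proof (induction S')
    case empty
    have z: "ratfun N r (\<lambda>\<xi>\<in>?D. 0) (\<lambda>\<xi>\<in>?D. 1) \<oplus>\<^bsub>F\<^esub> ratfun N r (\<lambda>\<xi>\<in>?D. 0) (\<lambda>\<xi>\<in>?D. 1) =
        ratfun N r (\<lambda>\<xi>\<in>?D. 0) (\<lambda>\<xi>\<in>?D. 1)"
      unfolding F_def ratfun_add [OF N zero zero]
      by (rule ratfun_eqI [OF N fractions_add [OF N zero zero] zero]) (simp add: grass_cone_dual)
    have "(\<Otimes>\<^bsub>?T\<^esub> t\<in>E. ?tens (ratfun N r (\<lambda>\<xi>\<in>?D. 0) (\<lambda>\<xi>\<in>?D. 1)) (y t)) =
        \<one>\<^bsub>?T\<^esub>"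
      by (rule T.finprod_one_eqI) (rule tensor_zero_left [OF hyps carr [OF zero] y z])
    moreover have "(\<lambda>\<xi>\<in>?D. 0) \<xi> = (0::real)" "(\<lambda>\<xi>\<in>?D. 1) \<xi> = (1::real)" if "\<xi> \<in> ?G" for \<xi>
      using grass_cone_dual [OF that] by simp_all
    ultimately show ?case
      using zero
      by (intro exI [of _ "\<lambda>t. \<lambda>\<xi>\<in>?D. 0"] exI [of _ "\<lambda>\<xi>\<in>?D. 1"])
        (simp del: restrict_apply)
  next
    case (insert j S')
    then have j: "j \<in> S" by simp
    have "S' \<subseteq> S" using insert.prems by simp
    from insert.IH [OF this]
    obtain P Q where PQ_all: "\<forall>t\<in>E. (P t, Q) \<in> fractions N r" "\<forall>\<xi>\<in>?G. Q \<xi> = (\<Prod>j\<in>S'. q j \<xi>)"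
      "\<forall>\<xi>\<in>?G. (\<forall>j\<in>S'. q j \<xi> \<noteq> 0) \<longrightarrow> (\<forall>t\<in>E. P t \<xi> = Q \<xi> * (\<Sum>j\<in>S'. of_rat (d j t) * (p j \<xi> / q j \<xi>)))"
      "(\<Otimes>\<^bsub>?T\<^esub> j\<in>S'. ?tens (ratfun N r (p j) (q j)) (X j)) =
      (\<Otimes>\<^bsub>?T\<^esub> t\<in>E. ?tens (ratfun N r (P t) Q) (y t))"
      by (elim exE conjE)
    have PQ1: "(P t, Q) \<in> fractions N r" if "t \<in> E" for t using PQ_all(1) that by (rule bspec)
    have PQ2: "Q \<xi> = (\<Prod>j\<in>S'. q j \<xi>)" if "\<xi> \<in> ?G" for \<xi> using PQ_all(2) that by (rule bspec)
    have PQ3: "P t \<xi> = Q \<xi> * (\<Sum>j\<in>S'. of_rat (d j t) * (p j \<xi> / q j \<xi>))"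
      if "\<xi> \<in> ?G" "\<forall>j\<in>S'. q j \<xi> \<noteq> 0" "t \<in> E" for \<xi> t
      by (rule bspec [OF mp [OF bspec [OF PQ_all(3) that(1)] that(2)] that(3)])
    define dp where "dp t = (\<lambda>\<xi>\<in>?D. of_rat (d j t) * p j \<xi>)" for t
    have dp: "(dp t, q j) \<in> fractions N r" for t
      unfolding dp_def by (rule fractions_scale [OF N pq [OF j]])
    define P' where "P' t = (\<lambda>\<xi>\<in>?D. dp t \<xi> * Q \<xi> + P t \<xi> * q j \<xi>)" for t
    define Q' where "Q' = (\<lambda>\<xi>\<in>?D. q j \<xi> * Q \<xi>)"
    have P'Q': "(P' t, Q') \<in> fractions N r" if "t \<in> E" for t
      unfolding P'_def Q'_def by (rule fractions_add [OF N dp PQ1 [OF that]])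
    have sum: "ratfun N r (P' t) Q' = ratfun N r (dp t) (q j) \<oplus>\<^bsub>F\<^esub> ratfun N r (P t) Q" if "t \<in> E" for t
      unfolding P'_def Q'_def F_def by (rule ratfun_add [OF N dp PQ1 [OF that], symmetric])
    have closed: "?tens (ratfun N r (p j) (q j)) (X j) \<in> carrier ?T" if "j \<in> S" for j
      by (rule tensor_closed [OF hyps carr [OF pq [OF that]] X [OF that]])
    have "(\<Otimes>\<^bsub>?T\<^esub> j\<in>insert j S'. ?tens (ratfun N r (p j) (q j)) (X j)) =
        ?tens (ratfun N r (p j) (q j)) (X j) \<otimes>\<^bsub>?T\<^esub>
        (\<Otimes>\<^bsub>?T\<^esub> j\<in>S'. ?tens (ratfun N r (p j) (q j)) (X j))"
      using insert.hyps insert.prems closed by (intro T.finprod_insert) auto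
    also have "?tens (ratfun N r (p j) (q j)) (X j) =
        (\<Otimes>\<^bsub>?T\<^esub> t\<in>E. ?tens (ratfun N r (dp t) (q j)) (y t))"
      using X_expand [OF carr [OF pq [OF j]] j]
      unfolding dp_def F_def ratfun_smult [OF N pq [OF j]] .
    also have "\<dots> \<otimes>\<^bsub>?T\<^esub>
        (\<Otimes>\<^bsub>?T\<^esub> j\<in>S'. ?tens (ratfun N r (p j) (q j)) (X j)) =
        (\<Otimes>\<^bsub>?T\<^esub> t\<in>E. ?tens (ratfun N r (dp t) (q j)) (y t)
          \<otimes>\<^bsub>?T\<^esub> ?tens (ratfun N r (P t) Q) (y t))"
      unfolding PQ_all(4)
      by (rule T.finprod_multf [symmetric])
        (auto intro!: tensor_closed [OF hyps] carr dp PQ1 y)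
    also have "\<dots> = (\<Otimes>\<^bsub>?T\<^esub> t\<in>E. ?tens (ratfun N r (P' t) Q') (y t))"
    proof (rule T.finprod_cong' [OF refl])
      show "(\<lambda>t. ?tens (ratfun N r (P' t) Q') (y t)) \<in> E \<rightarrow> carrier ?T"
        by (auto intro!: tensor_closed [OF hyps] carr P'Q' y)
      show "?tens (ratfun N r (dp t) (q j)) (y t) \<otimes>\<^bsub>?T\<^esub>
          ?tens (ratfun N r (P t) Q) (y t) = ?tens (ratfun N r (P' t) Q') (y t)" if "t \<in> E" for t
        unfolding sum [OF that]
        by (rule tensor_add_left [OF hyps carr [OF dp] carr [OF PQ1 [OF that]] y [OF that], symmetric])
    qed
    finally have e4: "(\<Otimes>\<^bsub>?T\<^esub> j\<in>insert j S'. ?tens (ratfun N r (p j) (q j)) (X j)) =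
        (\<Otimes>\<^bsub>?T\<^esub> t\<in>E. ?tens (ratfun N r (P' t) Q') (y t))" .
    have e2: "Q' \<xi> = (\<Prod>j\<in>insert j S'. q j \<xi>)" if "\<xi> \<in> ?G" for \<xi>
      using insert.hyps PQ2 [OF that] grass_cone_dual [OF that] by (simp add: Q'_def)
    have e3: "P' t \<xi> = Q' \<xi> * (\<Sum>j\<in>insert j S'. of_rat (d j t) * (p j \<xi> / q j \<xi>))"
      if "\<xi> \<in> ?G" "\<forall>j\<in>insert j S'. q j \<xi> \<noteq> 0" "t \<in> E" for \<xi> t
    proof -
      have "P' t \<xi> = of_rat (d j t) * p j \<xi> * Q \<xi> + P t \<xi> * q j \<xi>"
        using grass_cone_dual [OF that(1)] by (simp add: P'_def dp_def)
      also have "P t \<xi> = Q \<xi> * (\<Sum>j\<in>S'. of_rat (d j t) * (p j \<xi> / q j \<xi>))"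
        using PQ3 [OF that(1) _ that(3)] that(2) by simp
      also have "of_rat (d j t) * p j \<xi> * Q \<xi> = q j \<xi> * Q \<xi> * (of_rat (d j t) * (p j \<xi> / q j \<xi>))"
        using that(2) by simp
      finally show ?thesis
        using insert.hyps grass_cone_dual [OF that(1)] by (simp add: Q'_def algebra_simps)
    qed
    show ?case using P'Q' e2 e3 e4 by (intro exI [of _ P'] exI [of _ Q']) blast
  qed
  from main [OF subset_refl]
    obtain P Q where PQ_all: "\<forall>t\<in>E. (P t, Q) \<in> fractions N r" "\<forall>\<xi>\<in>?G. Q \<xi> = (\<Prod>j\<in>S. q j \<xi>)"
      "\<forall>\<xi>\<in>?G. (\<forall>j\<in>S. q j \<xi> \<noteq> 0) \<longrightarrow> (\<forall>t\<in>E. P t \<xi> = Q \<xi> * (\<Sum>j\<in>S. of_rat (d j t) * (p j \<xi> / q j \<xi>)))"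
      "(\<Otimes>\<^bsub>?T\<^esub> j\<in>S. ?tens (ratfun N r (p j) (q j)) (X j)) =
      (\<Otimes>\<^bsub>?T\<^esub> t\<in>E. ?tens (ratfun N r (P t) Q) (y t))"
      by (elim exE conjE)
    have PQ1: "(P t, Q) \<in> fractions N r" if "t \<in> E" for t using PQ_all(1) that by (rule bspec)
    have PQ2: "Q \<xi> = (\<Prod>j\<in>S. q j \<xi>)" if "\<xi> \<in> ?G" for \<xi> using PQ_all(2) that by (rule bspec)
    have PQ3: "P t \<xi> = Q \<xi> * (\<Sum>j\<in>S. of_rat (d j t) * (p j \<xi> / q j \<xi>))"
      if "\<xi> \<in> ?G" "\<forall>j\<in>S. q j \<xi> \<noteq> 0" "t \<in> E" for \<xi> t
      by (rule bspec [OF mp [OF bspec [OF PQ_all(3) that(1)] that(2)] that(3)])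
  have coeff_eq: "c t \<odot>\<^bsub>F\<^esub> \<one>\<^bsub>F\<^esub> = ratfun N r (P t) Q" if t: "t \<in> E" for t
    unfolding F_def Rat_Grass_one [OF N] ratfun_smult [OF N one]
  proof (rule ratfun_eqI [OF N fractions_scale [OF N one] PQ1 [OF t]])
    fix \<xi> assume \<xi>: "\<xi> \<in> ?G"
    obtain e where e: "symmetric_function N r e (P t)" "symmetric_function N r e Q"
      by (rule fractionsE [OF N PQ1 [OF t]])
    have s: "symmetric_function N r e (\<lambda>\<xi>. of_rat (c t) * Q \<xi> + of_rat (- 1) * P t \<xi>)"
      by (intro symmetric_function_add symmetric_function_scale e)
    have Q0: "Q \<xi>0 \<noteq> 0" using PQ2 [OF \<xi>0(1)] \<xi>0(2) fin(1) by simp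
    have "of_rat (c t) * Q \<xi> + of_rat (- 1) * P t \<xi> = 0"
    proof (rule zero_on_grass_cone [where f = "\<lambda>\<xi>. of_rat (c t) * Q \<xi> + of_rat (- 1) * P t \<xi>"
          and g = Q and \<xi> = \<xi> and ?\<xi>0.0 = \<xi>0, OF N s e(2) _ \<xi>0(1) Q0 \<xi>])
      fix \<xi> assume g: "\<xi> \<in> ?G" "Q \<xi> \<noteq> 0"
      then have nz: "\<And>j. j \<in> S \<Longrightarrow> q j \<xi> \<noteq> 0" using PQ2 [OF g(1)] fin(1) by auto
      then show "of_rat (c t) * Q \<xi> + of_rat (- 1) * P t \<xi> = 0"
        using PQ3 [OF g(1) _ t] coeff [OF g(1) nz t] by simp
    qed
    then show "(\<lambda>\<xi>\<in>?D. of_rat (c t) * (\<lambda>\<xi>\<in>?D. 1) \<xi>) \<xi> * Q \<xi> = P t \<xi> * (\<lambda>\<xi>\<in>?D. 1) \<xi>"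
      using grass_cone_dual [OF \<xi>] by simp
  qed
  have oneF: "\<one>\<^bsub>F\<^esub> \<in> carrier F"
    using carr [OF one] unfolding F_def Rat_Grass_one [OF N] .
  have "?tens \<one>\<^bsub>F\<^esub> x = (\<Otimes>\<^bsub>?T\<^esub> t\<in>E. ?tens (c t \<odot>\<^bsub>F\<^esub> \<one>\<^bsub>F\<^esub>) (y t))"
    by (rule x_expand [OF oneF])
  also have "\<dots> = (\<Otimes>\<^bsub>?T\<^esub> t\<in>E. ?tens (ratfun N r (P t) Q) (y t))"
    by (rule T.finprod_cong' [OF refl])
      (auto simp: coeff_eq intro!: tensor_closed [OF hyps] carr PQ1 y)
  finally show ?thesis unfolding PQ_all(4) .
qed


section \<open>Rational linear algebra modulo the relations\<close>

text \<open>
  The elements are added one at a time; a new one is kept unless it already lies in the span of the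
  chosen ones modulo \<open>W\<close>.
\<close>

lemma basis_modulo_subspace:
  fixes W :: "'v rpoly set" and X :: "'j \<Rightarrow> 'v rpoly"
  assumes W_add: "\<And>p q. p \<in> W \<Longrightarrow> q \<in> W \<Longrightarrow> p + q \<in> W"
    and W_scale: "\<And>c p. p \<in> W \<Longrightarrow> poly_const c * p \<in> W"
    and W_0: "0 \<in> W" and "finite A"
  shows "\<exists>E\<subseteq>A. (\<forall>e. (\<Sum>t\<in>E. poly_const (e t) * X t) \<in> W \<longrightarrow> (\<forall>t\<in>E. e t = 0)) \<and>
    (\<forall>j\<in>A. \<exists>d. X j - (\<Sum>t\<in>E. poly_const (d t) * X t) \<in> W)"
  using \<open>finite A\<close>
proof (induction A)
  case empty
  then show ?case by simp
next
  case (insert j A)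
  from insert.IH obtain E where E: "E \<subseteq> A"
    "\<forall>e. (\<Sum>t\<in>E. poly_const (e t) * X t) \<in> W \<longrightarrow> (\<forall>t\<in>E. e t = 0)"
    "\<forall>j\<in>A. \<exists>d. X j - (\<Sum>t\<in>E. poly_const (d t) * X t) \<in> W"
    by (elim exE conjE)
  have fin: "finite E" using E(1) insert.hyps(1) finite_subset by blast
  show ?case
  proof (cases "\<exists>d. X j - (\<Sum>t\<in>E. poly_const (d t) * X t) \<in> W")
    case True
    have "\<forall>i\<in>insert j A. \<exists>d. X i - (\<Sum>t\<in>E. poly_const (d t) * X t) \<in> W"
      using True E(3) by (simp only: ball_simps)
    moreover have "E \<subseteq> insert j A" using E(1) by (rule subset_insertI2)
    ultimately show ?thesis using E(2) by (intro exI [of _ E] conjI)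
  next
    case False
    have jE: "j \<notin> E" using E(1) insert.hyps(2) by blast
    have ind: "\<forall>t\<in>insert j E. e t = 0" if e: "(\<Sum>t\<in>insert j E. poly_const (e t) * X t) \<in> W" for e
    proof -
      have ej: "e j = 0"
      proof (rule ccontr)
        assume nz: "e j \<noteq> 0"
        have "poly_const (1 / e j) * (\<Sum>t\<in>insert j E. poly_const (e t) * X t) \<in> W"
          by (rule W_scale [OF e])
        also have "poly_const (1 / e j) * (\<Sum>t\<in>insert j E. poly_const (e t) * X t) =
            (\<Sum>t\<in>insert j E. poly_const (e t / e j) * X t)"
          by (simp add: sum_distrib_left poly_const_mult flip: mult.assoc)
        also have "\<dots> = X j + (\<Sum>t\<in>E. poly_const (e t / e j) * X t)"
          using fin jE nz by simp
        also have "\<dots> = X j - (\<Sum>t\<in>E. poly_const (- (e t / e j)) * X t)"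
          unfolding poly_const_uminus by (simp add: sum_negf)
        finally show False using False by (elim notE exI)
      qed
      then have "(\<Sum>t\<in>E. poly_const (e t) * X t) \<in> W" using e fin jE by simp
      then have "\<forall>t\<in>E. e t = 0" by (rule mp [OF spec [OF E(2)]])
      then show ?thesis using ej by simp
    qed
    have span: "\<exists>d. X i - (\<Sum>t\<in>insert j E. poly_const (d t) * X t) \<in> W" if "i \<in> insert j A" for i
    proof (cases "i = j")
      case True
      have "(\<Sum>t\<in>insert j E. poly_const (if t = j then 1 else 0) * X t) =
          X j + (\<Sum>t\<in>E. poly_const (if t = j then 1 else 0) * X t)"
        using fin jE by simp
      also have "(\<Sum>t\<in>E. poly_const (if t = j then 1 else 0) * X t) = 0"
        by (rule sum.neutral) (use jE in auto)
      finally have "X i - (\<Sum>t\<in>insert j E. poly_const (if t = j then 1 else 0) * X t) \<in> W"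
        using W_0 True by simp
      then show ?thesis by (intro exI [of _ "\<lambda>t. if t = j then 1 else 0"])
    next
      case neq: False
      then have "i \<in> A" using \<open>i \<in> insert j A\<close> by simp
      from bspec [OF E(3) this] obtain d where d: "X i - (\<Sum>t\<in>E. poly_const (d t) * X t) \<in> W" ..
      have "(\<Sum>t\<in>insert j E. poly_const (if t = j then 0 else d t) * X t) =
          (\<Sum>t\<in>E. poly_const (if t = j then 0 else d t) * X t)"
        using fin jE by simp
      also have "\<dots> = (\<Sum>t\<in>E. poly_const (d t) * X t)"
        by (intro sum.cong) (use jE in auto)
      finally have "X i - (\<Sum>t\<in>insert j E. poly_const (if t = j then 0 else d t) * X t) \<in> W"
        using d by simp
      then show ?thesis by (intro exI [of _ "\<lambda>t. if t = j then 0 else d t"])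
    qed
    show ?thesis
    proof (intro exI [of _ "insert j E"] conjI allI impI)
      show "insert j E \<subseteq> insert j A" using E(1) by (rule insert_mono)
      show "\<forall>t\<in>insert j E. e t = 0" if "(\<Sum>t\<in>insert j E. poly_const (e t) * X t) \<in> W" for e
        using that by (rule ind)
      show "\<forall>i\<in>insert j A. \<exists>d. X i - (\<Sum>t\<in>insert j E. poly_const (d t) * X t) \<in> W"
        using span by (rule ballI)
    qed
  qed
qed

section \<open>Restriction to a generic plane\<close>

locale fan_with_annihilators = simplicial_fan N \<Delta>
  for N :: "'a::euclidean_space set" and \<Delta> :: "('v, 'a) multifan" +
  fixes k r :: nat and b :: "'v set \<Rightarrow> ('a \<Rightarrow> real) list"
  assumes k: "1 \<le> k" "k \<le> DIM('a)"
    and r: "r = DIM('a) - k + 1"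
    and b: "\<And>J. J \<in> simplices_of \<Delta> k \<Longrightarrow> annihilator_basis N \<Delta> J (b J)"
begin

abbreviation "Sk \<equiv> simplices_of \<Delta> k"
text \<open>
  The simplex \<open>I\<close> that enters the definition of \<open>f\<^sup>J\<close>.
\<close>

definition "top_of J = (SOME I. I \<in> simplices_of \<Delta> DIM('a) \<and> J \<subseteq> I)"
abbreviation "\<iota> J \<equiv> iota_var N \<Delta> (top_of J)"
text \<open>
  The vector \<open>e\<^sub>J\<close> for the plane spanned by \<open>ws\<close>.
\<close>

definition "line_vector J ws = plane_vector (b J) ws"
text \<open>
  The plane meets the span of each \<open>C(J)\<close> in a line, spanned by \<open>e\<^sub>J\<close>, that avoids the spans of the
  facets of \<open>C(J)\<close>.
\<close>

definition "generic ws \<longleftrightarrow> ws \<in> rational_tuples N r \<and>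
  (\<forall>J\<in>Sk. \<forall>i\<in>J. wedge (\<iota> J i # b J) ws \<noteq> 0)"

lemma Sk_iff: "J \<in> Sk \<longleftrightarrow> J \<in> S \<and> card J = k"
  by (auto simp: simplices_of_def)

lemma finite_Sk: "finite Sk"
  using complex(1) by (simp add: simplices_of_def)

lemma top_of:
  assumes "J \<in> S"
  shows "top_of J \<in> S" "card (top_of J) = DIM('a)" "J \<subseteq> top_of J"
proof -
  have "\<exists>I. I \<in> simplices_of \<Delta> DIM('a) \<and> J \<subseteq> I"
    using simplex_in_top [OF assms] by (auto simp: simplices_of_def)
  then have "top_of J \<in> simplices_of \<Delta> DIM('a) \<and> J \<subseteq> top_of J"
    unfolding top_of_def by (rule someI_ex)
  then show "top_of J \<in> S" "card (top_of J) = DIM('a)" "J \<subseteq> top_of J"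
    by (auto simp: simplices_of_def)
qed

lemma iota_dual: "J \<in> S \<Longrightarrow> \<iota> J i \<in> dual_rat N"
  by (rule iota_var_dual_rat [OF top_of(1,2)])

lemma iota_linear: "J \<in> S \<Longrightarrow> linear (\<iota> J i)"
  using iota_dual [of J i] by (simp add: dual_rat_def)

lemma iota_ray: "J \<in> S \<Longrightarrow> j \<in> top_of J \<Longrightarrow> \<iota> J i (v j) = (if j = i then 1 else 0)"
  by (rule iota_var_ray [OF top_of(1,2)])

lemma length_b: "J \<in> Sk \<Longrightarrow> length (b J) = DIM('a) - k"
  using b [of J] by (simp add: annihilator_basis_def Sk_iff)

lemma b_in:
  assumes "J \<in> Sk" "u \<in> set (b J)"
  shows "u \<in> dual_rat N" "linear u" "j \<in> J \<Longrightarrow> u (v j) = 0"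
proof -
  have J: "J \<in> S" using assms(1) by (simp add: Sk_iff)
  show d: "u \<in> dual_rat N" by (rule annihilator_basis_in(1) [OF J b [OF assms(1)] assms(2)])
  then show "linear u" by (simp add: dual_rat_def)
  show "j \<in> J \<Longrightarrow> u (v j) = 0" by (rule annihilator_basis_in(2) [OF J b [OF assms(1)] assms(2)])
qed

lemma rational_tuples_length: "J \<in> Sk \<Longrightarrow> ws \<in> rational_tuples N r \<Longrightarrow> length ws = Suc (length (b J))"
  by (simp add: length_b rational_tuples_def r)

lemma wedge_line_vector:
  assumes "J \<in> Sk" "linear u" "length ws = Suc (length (b J))"
  shows "wedge (u # b J) ws = u (line_vector J ws)"
  unfolding line_vector_def by (rule wedge_Cons [OF assms(2,3)])

text \<open>
  For \<open>i \<notin> J\<close> the form \<open>\<iota>\<^sub>I\<^sup>*(x\<^sub>i)\<close> vanishes on the rays of \<open>J\<close>, so it is a combination of the forms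
  in \<open>b J\<close>, all of which vanish at \<open>e\<^sub>J\<close>.
\<close>

lemma iota_off_face:
  assumes J: "J \<in> Sk" and "i \<notin> J" and len: "length ws = Suc (length (b J))"
  shows "\<iota> J i (line_vector J ws) = 0"
proof -
  have JS: "J \<in> S" using J by (simp add: Sk_iff)
  have "\<iota> J i (v j) = 0" if "j \<in> J" for j
    using iota_ray [OF JS, of j i] top_of(3) [OF JS] that \<open>i \<notin> J\<close> by auto
  then obtain c where c: "\<iota> J i = (\<lambda>x. \<Sum>l<length (b J). c l * (b J ! l) x)"
    by (rule annihilator_basis_span [OF JS b [OF J] iota_dual [OF JS]])
  have "(b J ! l) (line_vector J ws) = 0" if "l < length (b J)" for l
    unfolding line_vector_def
    using that by (intro plane_vector_in_kernel len b_in(2) [OF J] nth_mem) auto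
  then show ?thesis unfolding c by simp
qed

lemma f_var_eq: "J \<in> Sk \<Longrightarrow> f_var N \<Delta> (b J) J i = wedge (\<iota> J i # b J)"
  by (simp add: f_var_def top_of_def)

lemma f_var_in_ext_power:
  assumes "J \<in> Sk" shows "f_var N \<Delta> (b J) J i \<in> ext_power N r"
  unfolding f_var_eq [OF assms]
  using assms b_in(1) [OF assms] by (intro wedge_in_ext_power) (auto simp: length_b Sk_iff iota_dual r)

lemma f_var_off_face:
  assumes "J \<in> Sk" "i \<notin> J" shows "f_var N \<Delta> (b J) J i = (\<lambda>ws. 0)"
proof
  fix ws :: "'a list"
  have J: "J \<in> S" using assms(1) by (simp add: Sk_iff)
  show "f_var N \<Delta> (b J) J i ws = 0"
  proof (cases "length ws = Suc (length (b J))")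
    case True
    then show ?thesis
      by (simp add: f_var_eq [OF assms(1)] wedge_line_vector [OF assms(1) iota_linear [OF J]]
          iota_off_face [OF assms])
  next
    case False
    then show ?thesis by (simp add: f_var_eq [OF assms(1)] wedge_def)
  qed
qed

lemma f_hom_class:
  assumes J: "J \<in> Sk" and p: "p \<in> carrier (poly_ring (vertices \<Delta>))"
  shows "f_hom N \<Delta> (b J) J (HT_class \<Delta> p) =
    (\<lambda>\<xi>\<in>dual_space (ext_power N r). poly_eval (\<lambda>i. \<xi> (f_var N \<Delta> (b J) J i)) p)"
proof -
  have const: "f_poly N \<Delta> (b J) J q = f_poly N \<Delta> (b J) J p" if q: "q \<in> HT_class \<Delta> p" for q
    unfolding f_poly_def
  proof (rule restrict_ext)
    fix \<xi> assume "\<xi> \<in> dual_space (ext_power N (DIM('a) - card J + 1))"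
    then have \<xi>: "\<xi> \<in> dual_space (ext_power N r)" using J by (simp add: Sk_iff r)
    show "poly_eval (\<lambda>i. \<xi> (f_var N \<Delta> (b J) J i)) q = poly_eval (\<lambda>i. \<xi> (f_var N \<Delta> (b J) J i)) p"
    proof (rule HT_class_eval_const [OF p _ q])
      fix K assume K: "K \<subseteq> vertices \<Delta>" "K \<notin> S"
      have "\<not> K \<subseteq> J" using complex(4) [of J K] J K(2) by (auto simp: Sk_iff)
      then obtain i where i: "i \<in> K" "i \<notin> J" by blast
      have "\<xi> (f_var N \<Delta> (b J) J i) = 0"
        unfolding f_var_off_face [OF J i(2)] by (rule dual_space_zero [OF \<xi>])
      then show "(\<Prod>i\<in>K. \<xi> (f_var N \<Delta> (b J) J i)) = 0"
        using i(1) finite_subset [OF K(1) finite_vertices] by auto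
    qed
  qed
  have "HT_class \<Delta> p \<noteq> {}" using HT_class_self [OF p] by auto
  then have "f_hom N \<Delta> (b J) J (HT_class \<Delta> p) = f_poly N \<Delta> (b J) J p"
    unfolding f_hom_def by (rule the_elem_image_unique) (rule const)
  then show ?thesis using J by (simp add: f_poly_def Sk_iff r)
qed

lemma f_var_plucker:
  assumes "J \<in> Sk" "ws \<in> rational_tuples N r"
  shows "plucker N r ws (f_var N \<Delta> (b J) J i) = \<iota> J i (line_vector J ws)"
proof -
  have J: "J \<in> S" using assms(1) by (simp add: Sk_iff)
  show ?thesis
    using plucker_apply [OF f_var_in_ext_power [OF assms(1)], of ws i]
    unfolding f_var_eq [OF assms(1)]
    by (rule trans) (rule wedge_line_vector [OF assms(1) iota_linear [OF J] rational_tuples_length [OF assms]])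
qed

text \<open>
  The tuple consists of \<open>v\<^sub>i\<close> and the rays of \<open>I\<close> outside \<open>J\<close>. Its dual basis consists of \<open>\<iota>\<^sub>I\<^sup>*(x\<^sub>i)\<close>
  and forms that vanish on the rays of \<open>J\<close>, all of them combinations of the given forms.
\<close>

lemma wedge_somewhere_nonzero:
  assumes J: "J \<in> Sk" and i: "i \<in> J"
  shows "\<exists>ws\<in>rational_tuples N r. wedge (\<iota> J i # b J) ws \<noteq> 0"
proof -
  have JS: "J \<in> S" using J by (simp add: Sk_iff)
  note I = top_of [OF JS]
  have finI: "finite (top_of J)" using complex(3) [OF I(1)] .
  obtain L where L: "set L = top_of J - J" "distinct L"
    using finite_distinct_list [of "top_of J - J"] finI by blast
  have lenL: "length L = length (b J)"
    using distinct_card [OF L(2)] L(1) I(2,3) card_Diff_subset [of J "top_of J"] complex(3) [OF JS] J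
    by (simp add: length_b Sk_iff)
  define zs where "zs = v i # map v L"
  have "\<exists>c. \<iota> J l = (\<lambda>x. \<Sum>m<length (b J). c m * (b J ! m) x)" if "l \<notin> J" for l
  proof -
    have "\<iota> J l (v j) = 0" if "j \<in> J" for j
      using iota_ray [OF JS, of j l] I(3) that \<open>l \<notin> J\<close> by auto
    from annihilator_basis_span [OF JS b [OF J] iota_dual [OF JS] this] show ?thesis by blast
  qed
  then have "\<forall>l. \<exists>c. l \<notin> J \<longrightarrow> \<iota> J l = (\<lambda>x. \<Sum>m<length (b J). c m * (b J ! m) x)" by blast
  from choice [OF this] obtain c where
    c: "\<And>l. l \<notin> J \<Longrightarrow> \<iota> J l = (\<lambda>x. \<Sum>m<length (b J). c l m * (b J ! m) x)"
    by blast
  define C where "C a m = (case a of 0 \<Rightarrow> (if m = 0 then 1 else 0)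
      | Suc a' \<Rightarrow> (case m of 0 \<Rightarrow> 0 | Suc m' \<Rightarrow> c (L ! a') m'))" for a m
  have "wedge (\<iota> J i # b J) zs \<noteq> 0"
  proof (rule wedge_nonzeroI [where C = C])
    show "length zs = length (\<iota> J i # b J)" by (simp add: zs_def lenL)
    fix a j assume aj: "a < length (\<iota> J i # b J)" "j < length (\<iota> J i # b J)"
    have dual: "\<iota> J ((i # L) ! a) (zs ! j) = (if a = j then 1 else 0)"
    proof -
      have d: "distinct (i # L)" and s: "set (i # L) \<subseteq> top_of J" using L i I(3) by auto
      have "zs ! j = v ((i # L) ! j)" using aj(2) lenL by (simp add: zs_def nth_Cons split: nat.split)
      moreover have "(i # L) ! j \<in> top_of J" using s aj(2) lenL by (auto intro!: subsetD [OF s] nth_mem simp del: nth_Cons_Suc)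
      ultimately show ?thesis
        using iota_ray [OF JS, of "(i # L) ! j" "(i # L) ! a"] nth_eq_iff_index_eq [OF d, of j a] aj lenL
        by auto
    qed
    have "(\<Sum>m<length (\<iota> J i # b J). C a m * ((\<iota> J i # b J) ! m) (zs ! j)) =
        C a 0 * \<iota> J i (zs ! j) + (\<Sum>m<length (b J). C a (Suc m) * (b J ! m) (zs ! j))"
      by (simp add: sum.lessThan_Suc_shift del: sum.lessThan_Suc)
    also have "\<dots> = \<iota> J ((i # L) ! a) (zs ! j)"
    proof (cases a)
      case 0
      then show ?thesis by (simp add: C_def)
    next
      case (Suc a')
      then have "L ! a' \<in> set L" using aj(1) lenL by simp
      then have "L ! a' \<notin> J" using L(1) by blast
      then have "\<iota> J (L ! a') (zs ! j) = (\<Sum>m<length (b J). c (L ! a') m * (b J ! m) (zs ! j))"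
        by (rule fun_cong [OF c])
      then show ?thesis using Suc by (simp add: C_def)
    qed
    finally show "(\<Sum>m<length (\<iota> J i # b J). C a m * ((\<iota> J i # b J) ! m) (zs ! j)) = (if a = j then 1 else 0)"
      using dual by simp
  qed
  moreover have "zs \<in> rational_tuples N r"
  proof -
    have "v l \<in> lattice_rat N" if "l \<in> top_of J" for l
      using ray_vector_in(1) simplex_vertices [OF I(1)] that lattice_subset_lattice_rat by blast
    then show ?thesis
      using L(1) i I(3) lenL length_b [OF J] by (auto simp: rational_tuples_def zs_def r)
  qed
  ultimately show ?thesis by blast
qed

lemma generic_exists: "\<exists>ws. generic ws"
proof -
  have "\<exists>ws\<in>rational_tuples N r. \<forall>s\<in>(SIGMA J:Sk. J). wedge (\<iota> (fst s) (snd s) # b (fst s)) ws \<noteq> 0"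
  proof (rule common_generic_point [OF lattice])
    show "finite (SIGMA J:Sk. J)"
      using finite_Sk complex(3) by (intro finite_SigmaI) (auto simp: Sk_iff)
    fix s assume "s \<in> (SIGMA J:Sk. J)"
    then obtain J i where s: "s = (J, i)" "J \<in> Sk" "i \<in> J" by blast
    have J: "J \<in> S" using s(2) by (simp add: Sk_iff)
    show "line_polynomial N r (wedge (\<iota> (fst s) (snd s) # b (fst s)))"
      using b_in(2) [OF s(2)] iota_linear [OF J]
      by (intro line_polynomial_wedge [OF lattice]) (auto simp: s(1) length_b [OF s(2)] r)
    show "\<exists>ws\<in>rational_tuples N r. wedge (\<iota> (fst s) (snd s) # b (fst s)) ws \<noteq> 0"
      using wedge_somewhere_nonzero [OF s(2,3)] by (simp add: s(1))
  qed
  then obtain ws where ws: "ws \<in> rational_tuples N r"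
    "\<forall>s\<in>(SIGMA J:Sk. J). wedge (\<iota> (fst s) (snd s) # b (fst s)) ws \<noteq> 0" ..
  have "generic ws"
    unfolding generic_def
  proof (intro conjI ballI ws(1))
    fix J i assume "J \<in> Sk" "i \<in> J"
    then show "wedge (\<iota> J i # b J) ws \<noteq> 0" using bspec [OF ws(2), of "(J, i)"] by simp
  qed
  then show ?thesis ..
qed

lemma Sk_nonempty: "\<exists>J. J \<in> Sk \<and> J \<noteq> {}"
proof -
  obtain J where "J \<in> S" "card J = k"
    using simplex_card_extend [OF complex(2) _ k(2)] by auto
  then show ?thesis using k(1) by (intro exI [of _ J]) (auto simp: Sk_iff)
qed

lemma generic_in_grass_cone:
  assumes "generic ws" shows "plucker N r ws \<in> grass_cone N r"
proof -
  obtain J i where J: "J \<in> Sk" "i \<in> J" using Sk_nonempty by blast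
  have JS: "J \<in> S" using J(1) by (simp add: Sk_iff)
  have "wedge (\<iota> J i # b J) ws \<noteq> 0" using assms J by (simp add: generic_def)
  from wedge_nonzero_independent [OF this] have "distinct ws \<and> independent (set ws)"
    using b_in(2) [OF J(1)] iota_linear [OF JS] by auto
  then show ?thesis using assms unfolding grass_cone_iff generic_def by blast
qed

text \<open>
  Enlarge \<open>K\<close> to a simplex \<open>J\<close> with \<open>k\<close> elements and choose \<open>i0 \<in> J - K\<close>. The form \<open>\<iota>\<^sub>I\<^sup>*(x\<^sub>i\<^sub>0)\<close> and
  the forms in \<open>b J\<close> vanish on the rays of \<open>K\<close>, and by genericity they restrict to a basis of the dual
  of the plane. Subtracting from \<open>\<iota>\<^sub>I\<^sup>*(x\<^sub>i)\<close> the combination of them that agrees with it on the plane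
  leaves its values on the rays of \<open>K\<close> unchanged.
\<close>

lemma form_vanishing_on_plane:
  assumes ws: "generic ws" and K: "K \<in> S" "card K < k" "i \<in> K"
  obtains \<eta> where "\<eta> \<in> dual_rat N" "\<And>w. w \<in> set ws \<Longrightarrow> \<eta> w = 0"
    "\<And>j. j \<in> K \<Longrightarrow> \<eta> (v j) = (if j = i then 1 else 0)"
proof -
  obtain J where J: "J \<in> S" "card J = k" "K \<subseteq> J"
    using simplex_card_extend [OF K(1) _ k(2)] K(2) by auto
  have JSk: "J \<in> Sk" using J by (simp add: Sk_iff)
  have "\<not> J \<subseteq> K" using K(2) J(2) card_mono [OF complex(3) [OF K(1)], of J] by auto
  then obtain i0 where i0: "i0 \<in> J" "i0 \<notin> K" by blast
  define gs where "gs = \<iota> J i0 # b J"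
  have "wedge gs ws \<noteq> 0" using ws JSk i0 by (simp add: generic_def gs_def)
  moreover have gs: "set gs \<subseteq> dual_rat N" using b_in(1) [OF JSk] iota_dual [OF J(1)] by (auto simp: gs_def)
  moreover have wsr: "set ws \<subseteq> lattice_rat N" using ws by (simp add: generic_def rational_tuples_def)
  ultimately obtain c where c: "\<And>l. l < length gs \<Longrightarrow> c l \<in> \<rat>"
    "\<And>w. w \<in> set ws \<Longrightarrow> \<iota> J i w = (\<Sum>l<length gs. c l * (gs ! l) w)"
    using forms_span_dual_of_plane [OF _ _ _ iota_dual [OF J(1)], of gs ws i] by blast
  define \<eta> where "\<eta> x = \<iota> J i x - (\<Sum>l<length gs. c l * (gs ! l) x)" for x
  have gsd: "gs ! l \<in> dual_rat N" if "l < length gs" for l using gs that nth_mem by blast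
  have gsl: "linear (gs ! l)" if "l < length gs" for l using gsd [OF that] by (simp add: dual_rat_def)
  have K0: "(gs ! l) (v j) = 0" if "l < length gs" "j \<in> K" for l j
  proof (cases l)
    case 0
    then show ?thesis
      using iota_ray [OF J(1), of j i0] top_of(3) [OF J(1)] J(3) that(2) i0(2) by (auto simp: gs_def)
  next
    case (Suc l')
    then have "b J ! l' \<in> set (b J)" using that(1) by (simp add: gs_def)
    from b_in(3) [OF JSk this, of j] show ?thesis using Suc that(2) J(3) by (auto simp: gs_def)
  qed
  have "\<eta> \<in> dual_rat N"
    unfolding dual_rat_def
  proof (intro CollectI conjI ballI)
    show "linear \<eta>"
      unfolding \<eta>_def using iota_linear [OF J(1), of i] gsl
      by (intro linearI) (simp_all add: linear_add linear_cmul algebra_simps sum.distrib sum_distrib_left)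
    fix x assume "x \<in> N"
    then show "\<eta> x \<in> \<rat>"
      unfolding \<eta>_def using iota_dual [OF J(1), of i] gsd c(1)
      by (intro Rats_diff Rats_sum Rats_mult) (auto simp: dual_rat_def)
  qed
  moreover have "\<eta> w = 0" if "w \<in> set ws" for w using c(2) [OF that] by (simp add: \<eta>_def)
  moreover have "\<eta> (v j) = (if j = i then 1 else 0)" if "j \<in> K" for j
    using iota_ray [OF J(1), of j i] top_of(3) [OF J(1)] J(3) that K0 by (auto simp: \<eta>_def)
  ultimately show ?thesis using that by blast
qed

text \<open>
  The sum over the vertices is the value of \<open>\<eta>\<close> at \<open>e\<^sub>J\<close>, which is \<open>0\<close> because \<open>e\<^sub>J\<close> lies in the plane.
\<close>

lemma linear_relation:
  assumes ws: "generic ws" and K: "K \<in> S" "card K < k" "i \<in> K"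
  shows "\<exists>c. (\<Sum>j\<in>vertices \<Delta>. poly_const (c j) * poly_var j) \<in> coh_kernel N \<Delta> \<and>
    (\<forall>j\<in>K. c j = (if j = i then 1 else 0)) \<and>
    (\<forall>J\<in>S. card J = k \<longrightarrow> (\<Sum>j\<in>vertices \<Delta>. of_rat (c j) * \<iota> J j (line_vector J ws)) = 0)"
proof -
  obtain \<eta> where \<eta>: "\<eta> \<in> dual_rat N" "\<And>w. w \<in> set ws \<Longrightarrow> \<eta> w = 0"
    "\<And>j. j \<in> K \<Longrightarrow> \<eta> (v j) = (if j = i then 1 else 0)"
    by (rule form_vanishing_on_plane [OF assms]) (rule that)
  have lin: "linear \<eta>" using \<eta>(1) by (simp add: dual_rat_def)
  define c :: "'v \<Rightarrow> rat" where "c j = (SOME q. \<eta> (v j) = of_rat q)" for j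
  have c: "\<eta> (v j) = of_rat (c j)" if "j \<in> vertices \<Delta>" for j
  proof -
    have "\<eta> (v j) \<in> \<rat>" using \<eta>(1) ray_vector_in(1) [OF that] by (simp add: dual_rat_def)
    then have "\<exists>q. \<eta> (v j) = of_rat q" by (auto simp: Rats_def)
    then show ?thesis unfolding c_def by (rule someI_ex)
  qed
  have "c j = (if j = i then 1 else 0)" if "j \<in> K" for j
  proof -
    have "of_rat (c j) = (of_rat (if j = i then 1 else 0) :: real)"
      using c [of j] \<eta>(3) [OF that] simplex_vertices [OF K(1)] that by auto
    then show ?thesis by (simp only: of_rat_eq_iff)
  qed
  moreover have "(\<Sum>j\<in>vertices \<Delta>. of_rat (c j) * \<iota> J j (line_vector J ws)) = 0" if J: "J \<in> S" "card J = k" for J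
  proof -
    note I = top_of [OF J(1)]
    have JSk: "J \<in> Sk" using J by (simp add: Sk_iff)
    have len: "length ws = Suc (length (b J))"
      using rational_tuples_length [OF JSk] ws by (simp add: generic_def)
    let ?e = "line_vector J ws"
    have "(\<Sum>j\<in>vertices \<Delta>. of_rat (c j) * \<iota> J j ?e) = (\<Sum>j\<in>vertices \<Delta>. \<eta> (v j) * \<iota> J j ?e)"
      by (intro sum.cong) (simp_all add: c)
    also have "\<dots> = (\<Sum>j\<in>top_of J. \<eta> (v j) * \<iota> J j ?e)"
      using finite_vertices simplex_vertices [OF I(1)]
      by (intro sum.mono_neutral_right) (auto simp: iota_var_def)
    also have "\<dots> = \<eta> (\<Sum>j\<in>top_of J. \<iota> J j ?e *\<^sub>R v j)"
      using lin by (simp add: linear_sum linear_cmul mult.commute)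
    also have "(\<Sum>j\<in>top_of J. \<iota> J j ?e *\<^sub>R v j) = ?e"
      by (rule expand_in_rays [OF I(1,2), symmetric])
    also have "\<eta> ?e = 0"
      unfolding line_vector_def by (rule linear_form_on_plane [OF lin \<eta>(2) len])
    finally show ?thesis .
  qed
  ultimately show ?thesis using linear_form_in_coh_kernel [OF \<eta>(1) c] by blast
qed

lemma localization_at_generic_plane:
  assumes ws: "generic ws" and p: "p \<in> carrier (poly_ring (vertices \<Delta>))" "poly_homogeneous k p"
  shows "\<exists>c. (\<forall>J\<in>Sk. of_rat (c J) * (\<Prod>j\<in>J. \<iota> J j (line_vector J ws)) =
      poly_eval (\<lambda>j. \<iota> J j (line_vector J ws)) p) \<and>
    p - (\<Sum>J\<in>Sk. poly_const (c J) * (\<Prod>j\<in>J. poly_var j)) \<in> coh_kernel N \<Delta>"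
proof -
  have "\<exists>c. (\<forall>J\<in>S. card J = k \<longrightarrow> of_rat (c J) * (\<Prod>j\<in>J. \<iota> J j (line_vector J ws)) =
      poly_eval (\<lambda>j. \<iota> J j (line_vector J ws)) p) \<and>
    p - (\<Sum>J | J \<in> S \<and> card J = k. poly_const (c J) * (\<Prod>j\<in>J. poly_var j)) \<in> coh_kernel N \<Delta>"
  proof (rule localization_in_ideal [where a = "\<lambda>J j. \<iota> J j (line_vector J ws)" and V = "vertices \<Delta>"])
    show "p + q \<in> coh_kernel N \<Delta>" if "p \<in> coh_kernel N \<Delta>" "q \<in> coh_kernel N \<Delta>" for p q
      using that by (rule coh_kernel_add)
    show "q * p \<in> coh_kernel N \<Delta>" if "p \<in> coh_kernel N \<Delta>" "q \<in> carrier (poly_ring (vertices \<Delta>))" for p q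
      using that by (rule coh_kernel_mult)
    show "(\<Prod>i\<in>K. poly_var i) \<in> coh_kernel N \<Delta>" if "K \<subseteq> vertices \<Delta>" "K \<notin> S" for K
      using SR_ideal_nonface [OF that] SR_ideal_subset by blast
    show "K \<in> S" if "J \<in> S" "K \<subseteq> J" for J K using that by (rule complex(4))
    show "\<exists>J\<in>S. card J = k \<and> K \<subseteq> J" if "K \<in> S" "card K < k" for K
      using simplex_card_extend [OF that(1) _ k(2)] that(2) by (metis less_imp_le)
    show "\<iota> J i (line_vector J ws) = 0" if "J \<in> S" "card J = k" "i \<in> vertices \<Delta> - J" for J i
      using that ws rational_tuples_length [of J ws]
      by (intro iota_off_face) (auto simp: Sk_iff generic_def)
    show "\<iota> J i (line_vector J ws) \<noteq> 0" if "J \<in> S" "card J = k" "i \<in> J" for J i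
    proof -
      have JSk: "J \<in> Sk" using that by (simp add: Sk_iff)
      have "wedge (\<iota> J i # b J) ws \<noteq> 0" using ws JSk that(3) by (simp add: generic_def)
      then show ?thesis
        using wedge_line_vector [OF JSk iota_linear [OF that(1)]] rational_tuples_length [OF JSk] ws
        by (simp add: generic_def)
    qed
  qed (use finite_vertices complex(1) coh_kernel_0 simplex_vertices linear_relation [OF ws] p in auto)
  then obtain c where c: "\<forall>J\<in>S. card J = k \<longrightarrow> of_rat (c J) * (\<Prod>j\<in>J. \<iota> J j (line_vector J ws)) =
      poly_eval (\<lambda>j. \<iota> J j (line_vector J ws)) p"
    "p - (\<Sum>J | J \<in> S \<and> card J = k. poly_const (c J) * (\<Prod>j\<in>J. poly_var j)) \<in> coh_kernel N \<Delta>"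
    by (elim exE conjE)
  have "\<forall>J\<in>Sk. of_rat (c J) * (\<Prod>j\<in>J. \<iota> J j (line_vector J ws)) =
      poly_eval (\<lambda>j. \<iota> J j (line_vector J ws)) p"
    using c(1) by (simp add: Sk_iff)
  moreover have "p - (\<Sum>J\<in>Sk. poly_const (c J) * (\<Prod>j\<in>J. poly_var j)) \<in> coh_kernel N \<Delta>"
    using c(2) by (simp only: simplices_of_def)
  ultimately show ?thesis by (intro exI [of _ c] conjI)
qed

end


section \<open>The expansion over the function field\<close>

lemma poly_const_sum: "poly_const (sum h A) = (\<Sum>x\<in>A. poly_const (h x))"
  by (induction A rule: infinite_finite_induct) (simp_all flip: poly_const_add)

lemma H_deg_cases:
  assumes "X \<in> carrier (H_deg N \<Delta> k)"
  obtains p where "p \<in> carrier (poly_ring (vertices \<Delta>))" "poly_homogeneous k p" "X = coh N \<Delta> p"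
  using assms by (auto simp: H_deg_def HT_deg_def coh_def)

lemma H_deg_closed:
  "X \<in> carrier (H_deg N \<Delta> k) \<Longrightarrow> Y \<in> carrier (H_deg N \<Delta> k) \<Longrightarrow>
    X \<oplus>\<^bsub>H_deg N \<Delta> k\<^esub> Y \<in> carrier (H_deg N \<Delta> k)"
  "X \<in> carrier (H_deg N \<Delta> k) \<Longrightarrow> c \<odot>\<^bsub>H_deg N \<Delta> k\<^esub> X \<in> carrier (H_deg N \<Delta> k)"
proof -
  assume X: "X \<in> carrier (H_deg N \<Delta> k)"
  obtain p where p: "p \<in> carrier (poly_ring (vertices \<Delta>))" "poly_homogeneous k p" "X = coh N \<Delta> p"
    by (rule H_deg_cases [OF X])
  show "c \<odot>\<^bsub>H_deg N \<Delta> k\<^esub> X \<in> carrier (H_deg N \<Delta> k)"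
    unfolding H_deg_simps p(3) coh_const_mult [OF p(1), symmetric]
    by (intro coh_in_H_deg poly_ring_mult poly_ring_const p poly_homogeneous_const_mult)
  assume Y: "Y \<in> carrier (H_deg N \<Delta> k)"
  obtain q where q: "q \<in> carrier (poly_ring (vertices \<Delta>))" "poly_homogeneous k q" "Y = coh N \<Delta> q"
    by (rule H_deg_cases [OF Y])
  show "X \<oplus>\<^bsub>H_deg N \<Delta> k\<^esub> Y \<in> carrier (H_deg N \<Delta> k)"
    unfolding H_deg_simps p(3) q(3) coh_add [OF p(1) q(1), symmetric]
    by (intro coh_in_H_deg poly_ring_add p q poly_homogeneous_add)
qed

lemma tensor_coh_sum:
  fixes N :: "'a::euclidean_space set" and \<Delta> :: "('v, 'a) multifan" and k r :: nat
  defines "B \<equiv> H_deg N \<Delta> k" and "F \<equiv> Rat_Grass N r"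
  assumes N: "full_lattice N" and "finite E"
    and X: "\<And>t. t \<in> E \<Longrightarrow> X t \<in> carrier (poly_ring (vertices \<Delta>)) \<and> poly_homogeneous k (X t)"
    and a: "a \<in> carrier F"
  shows "tensor rat_ring F B a (coh N \<Delta> (\<Sum>t\<in>E. poly_const (c t) * X t)) =
    (\<Otimes>\<^bsub>tensor_product rat_ring F B\<^esub> t\<in>E. tensor rat_ring F B (c t \<odot>\<^bsub>F\<^esub> a) (coh N \<Delta> (X t)))"
proof -
  let ?T = "tensor_product rat_ring F B" and ?tens = "tensor rat_ring F B"
  note hyps = Rat_Grass_closed [OF N, of _ r, folded F_def] H_deg_closed [where N = N and \<Delta> = \<Delta> and k = k, folded B_def]
  interpret T: comm_group ?T
    by (rule comm_group_tensor [OF hyps])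
  have cB: "coh N \<Delta> p \<in> carrier B" if "p \<in> carrier (poly_ring (vertices \<Delta>))" "poly_homogeneous k p" for p
    unfolding B_def using that by (rule coh_in_H_deg)
  show ?thesis
    using \<open>finite E\<close> X
  proof (induction E)
    case empty
    have "coh N \<Delta> 0 \<oplus>\<^bsub>B\<^esub> coh N \<Delta> 0 = coh N \<Delta> 0"
      using coh_add [OF poly_ring_0 poly_ring_0, of N \<Delta>] by (simp add: B_def)
    then show ?case
      using tensor_zero_right [OF hyps a cB [OF poly_ring_0 poly_homogeneous_0]] by simp
  next
    case (insert t E)
    have Xt: "X t \<in> carrier (poly_ring (vertices \<Delta>))" "poly_homogeneous k (X t)"
      using insert.prems by simp_all
    have ct: "poly_const (c t) * X t \<in> carrier (poly_ring (vertices \<Delta>))" "poly_homogeneous k (poly_const (c t) * X t)"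
      by (intro poly_ring_mult poly_ring_const Xt poly_homogeneous_const_mult)+
    have sum: "(\<Sum>t\<in>E. poly_const (c t) * X t) \<in> carrier (poly_ring (vertices \<Delta>))"
      "poly_homogeneous k (\<Sum>t\<in>E. poly_const (c t) * X t)"
    proof -
      show "(\<Sum>t\<in>E. poly_const (c t) * X t) \<in> carrier (poly_ring (vertices \<Delta>))"
        using insert.prems by (intro poly_ring_sum poly_ring_mult poly_ring_const) simp
      show "poly_homogeneous k (\<Sum>t\<in>E. poly_const (c t) * X t)"
        using insert.hyps(1) insert.prems
        by (induction E) (auto intro: poly_homogeneous_0 poly_homogeneous_add poly_homogeneous_const_mult)
    qed
    have IH: "?tens a (coh N \<Delta> (\<Sum>t\<in>E. poly_const (c t) * X t)) =
        (\<Otimes>\<^bsub>?T\<^esub> t\<in>E. ?tens (c t \<odot>\<^bsub>F\<^esub> a) (coh N \<Delta> (X t)))"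
      using insert.IH insert.prems by simp
    have "?tens a (coh N \<Delta> (\<Sum>t\<in>insert t E. poly_const (c t) * X t)) =
        ?tens a (coh N \<Delta> (poly_const (c t) * X t) \<oplus>\<^bsub>B\<^esub> coh N \<Delta> (\<Sum>t\<in>E. poly_const (c t) * X t))"
      using insert.hyps coh_add [OF ct(1) sum(1), of N] by (simp add: B_def)
    also have "\<dots> = ?tens a (coh N \<Delta> (poly_const (c t) * X t)) \<otimes>\<^bsub>?T\<^esub>
        ?tens a (coh N \<Delta> (\<Sum>t\<in>E. poly_const (c t) * X t))"
      by (rule tensor_add_right [OF hyps a cB [OF ct] cB [OF sum]])
    also have "?tens a (coh N \<Delta> (poly_const (c t) * X t)) =
        ?tens (c t \<odot>\<^bsub>F\<^esub> a) (coh N \<Delta> (X t))"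
      using tensor_smult [OF hyps a cB [OF Xt], of "c t"] coh_const_mult [OF Xt(1), of N "c t"]
      by (simp add: B_def)
    finally show ?case
      unfolding IH
      using insert.hyps insert.prems
      by (subst T.finprod_insert) (auto intro!: tensor_closed [OF hyps] hyps(2) a cB)
  qed
qed

context fan_with_annihilators
begin

abbreviation "face J \<equiv> (\<Prod>j\<in>J. poly_var j :: 'v rpoly)"

lemma face_in: "J \<in> Sk \<Longrightarrow> face J \<in> carrier (poly_ring (vertices \<Delta>)) \<and> poly_homogeneous k (face J)"
  using simplex_vertices [of J] poly_homogeneous_face [of J] complex(3) [of J]
  by (auto simp: Sk_iff intro!: poly_ring_prod poly_ring_var)

lemma f_hom_plucker:
  assumes "J \<in> Sk" "ws \<in> rational_tuples N r" "p \<in> carrier (poly_ring (vertices \<Delta>))"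
  shows "f_hom N \<Delta> (b J) J (HT_class \<Delta> p) (plucker N r ws) = poly_eval (\<lambda>j. \<iota> J j (line_vector J ws)) p"
  unfolding f_hom_class [OF assms(1,3)]
  by (simp add: plucker_in_dual_space [OF assms(2)] f_var_plucker [OF assms(1,2)])

lemma f_hom_face_plucker:
  assumes "J \<in> Sk" "ws \<in> rational_tuples N r"
  shows "f_hom N \<Delta> (b J) J (HT_face \<Delta> J) (plucker N r ws) = (\<Prod>j\<in>J. \<iota> J j (line_vector J ws))"
  unfolding HT_face_def using f_hom_plucker [OF assms, of "face J"] face_in [OF assms(1)]
  by (simp add: poly_eval_prod)

text \<open>
  A rational plane is generic exactly when no denominator of the functions \<open>\<mu>(x, J)\<close> vanishes there.
\<close>

lemma f_hom_face_nonzero_iff: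
  assumes "ws \<in> rational_tuples N r"
  shows "generic ws \<longleftrightarrow> (\<forall>J\<in>Sk. f_hom N \<Delta> (b J) J (HT_face \<Delta> J) (plucker N r ws) \<noteq> 0)"
proof -
  have "wedge (\<iota> J i # b J) ws = \<iota> J i (line_vector J ws)" if "J \<in> Sk" for J i
    using that iota_linear [of J i] rational_tuples_length [OF that assms]
    by (intro wedge_line_vector) (auto simp: Sk_iff)
  moreover have "finite J" if "J \<in> Sk" for J using that complex(3) by (simp add: Sk_iff)
  ultimately show ?thesis
    using assms by (simp add: generic_def f_hom_face_plucker [OF _ assms])
qed

lemma mu_fraction:
  assumes "J \<in> Sk" "p \<in> carrier (poly_ring (vertices \<Delta>))" "poly_homogeneous k p"
  shows "(f_hom N \<Delta> (b J) J (HT_class \<Delta> p), f_hom N \<Delta> (b J) J (HT_face \<Delta> J)) \<in> fractions N r"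
proof -
  obtain ws where ws: "generic ws" using generic_exists ..
  have wsr: "ws \<in> rational_tuples N r" using ws by (simp add: generic_def)
  have "f_hom N \<Delta> (b J) J (HT_face \<Delta> J) (plucker N r ws) \<noteq> 0"
    using f_hom_face_nonzero_iff [OF wsr] ws assms(1) by blast
  then have nz: "poly_eval (\<lambda>i. plucker N r ws (f_var N \<Delta> (b J) J i)) (face J) \<noteq> 0"
    unfolding HT_face_def f_hom_class [OF assms(1) conjunct1 [OF face_in [OF assms(1)]]]
    by (simp add: plucker_in_dual_space [OF wsr])
  have "symmetric_function N r k (\<lambda>\<xi>. poly_eval (\<lambda>i. \<xi> (f_var N \<Delta> (b J) J i)) q)" if "poly_homogeneous k q" for q
    by (rule symmetric_function_poly_eval [OF that f_var_in_ext_power [OF assms(1)]])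
  from this [OF assms(3)] this [OF conjunct2 [OF face_in [OF assms(1)]]]
  have sym: "\<exists>d. symmetric_function N r d (\<lambda>\<xi>. poly_eval (\<lambda>i. \<xi> (f_var N \<Delta> (b J) J i)) p) \<and>
      symmetric_function N r d (\<lambda>\<xi>. poly_eval (\<lambda>i. \<xi> (f_var N \<Delta> (b J) J i)) (face J))"
    by (intro exI [of _ k] conjI)
  show ?thesis
    unfolding HT_face_def f_hom_class [OF assms(1,2)] f_hom_class [OF assms(1) conjunct1 [OF face_in [OF assms(1)]]]
      fractions_iff [OF lattice]
    using sym nz generic_in_grass_cone [OF ws] by blast
qed

text \<open>
  The set \<open>E\<close> indexes a basis of the span of the classes of the \<open>x\<^sub>J\<close>, and \<open>c\<close> and \<open>d\<close> hold the
  coordinates of \<open>p\<close> and of the \<open>x\<^sub>J\<close> in it. Comparing coordinates in the expansion at a generic plane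
  gives the identity between \<open>c\<close>, \<open>d\<close> and the values of \<open>\<mu>(p, J)\<close> that \<open>tensor_expansion\<close> requires.
\<close>

theorem localization:
  defines "F \<equiv> Rat_Grass N r" and "B \<equiv> H_deg N \<Delta> k"
  assumes p: "p \<in> carrier (poly_ring (vertices \<Delta>))" "poly_homogeneous k p"
  shows "tensor rat_ring F B \<one>\<^bsub>F\<^esub> (coh N \<Delta> p) = (\<Otimes>\<^bsub>tensor_product rat_ring F B\<^esub> J\<in>Sk.
    tensor rat_ring F B (mu N \<Delta> (b J) (HT_class \<Delta> p) J) (coh N \<Delta> (face J)))"
proof -
  let ?T = "tensor_product rat_ring F B" and ?tens = "tensor rat_ring F B"
  define P where "P J = f_hom N \<Delta> (b J) J (HT_class \<Delta> p)" for J
  define Q where "Q J = f_hom N \<Delta> (b J) J (HT_face \<Delta> J)" for J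
  let ?W = "coh_kernel N \<Delta>"
  have W_scale: "poly_const c * q \<in> ?W" if "q \<in> ?W" for c q
    using that poly_ring_const by (rule coh_kernel_mult)
  have W_sum: "sum h A \<in> ?W" if "\<And>z. z \<in> A \<Longrightarrow> h z \<in> ?W" for h :: "'v set \<Rightarrow> _" and A
    using that by (induction A rule: infinite_finite_induct) (auto intro: coh_kernel_0 coh_kernel_add)
  have "\<exists>E\<subseteq>Sk. (\<forall>e. (\<Sum>t\<in>E. poly_const (e t) * face t) \<in> ?W \<longrightarrow> (\<forall>t\<in>E. e t = 0)) \<and>
      (\<forall>J\<in>Sk. \<exists>d. face J - (\<Sum>t\<in>E. poly_const (d t) * face t) \<in> ?W)"
    by (rule basis_modulo_subspace [OF coh_kernel_add W_scale coh_kernel_0 finite_Sk])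
  then obtain E where E: "E \<subseteq> Sk" "\<forall>e. (\<Sum>t\<in>E. poly_const (e t) * face t) \<in> ?W \<longrightarrow> (\<forall>t\<in>E. e t = 0)"
    "\<forall>J\<in>Sk. \<exists>d. face J - (\<Sum>t\<in>E. poly_const (d t) * face t) \<in> ?W"
    by (elim exE conjE)
  have finE: "finite E" using E(1) finite_Sk by (rule finite_subset)
  from bchoice [OF E(3)] obtain d where
    d: "\<forall>J\<in>Sk. face J - (\<Sum>t\<in>E. poly_const (d J t) * face t) \<in> ?W" ..
  have combine: "p - (\<Sum>t\<in>E. poly_const (\<Sum>J\<in>Sk. m J * d J t) * face t) \<in> ?W"
    if m: "p - (\<Sum>J\<in>Sk. poly_const (m J) * face J) \<in> ?W" for m
  proof -
    have "(\<Sum>J\<in>Sk. poly_const (m J) * (face J - (\<Sum>t\<in>E. poly_const (d J t) * face t))) \<in> ?W"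
      by (rule W_sum, rule W_scale, rule bspec [OF d])
    from coh_kernel_add [OF m this] have
      "p - (\<Sum>J\<in>Sk. poly_const (m J) * (\<Sum>t\<in>E. poly_const (d J t) * face t)) \<in> ?W"
      by (simp add: right_diff_distrib sum_subtractf)
    also have "(\<Sum>J\<in>Sk. poly_const (m J) * (\<Sum>t\<in>E. poly_const (d J t) * face t)) =
        (\<Sum>J\<in>Sk. \<Sum>t\<in>E. poly_const (m J * d J t) * face t)"
      by (simp add: sum_distrib_left mult.assoc flip: poly_const_mult)
    also have "\<dots> = (\<Sum>t\<in>E. \<Sum>J\<in>Sk. poly_const (m J * d J t) * face t)" by (rule sum.swap)
    also have "\<dots> = (\<Sum>t\<in>E. poly_const (\<Sum>J\<in>Sk. m J * d J t) * face t)"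
      by (simp add: poly_const_sum sum_distrib_right)
    finally show ?thesis .
  qed
  \<comment> \<open>A single generic plane suffices to see that the class of p lies in the span.\<close>
  obtain ws0 where ws0: "generic ws0" using generic_exists ..
  from localization_at_generic_plane [OF ws0 p] obtain m0 where
    "p - (\<Sum>J\<in>Sk. poly_const (m0 J) * face J) \<in> ?W"
    by (elim exE conjE)
  then obtain c where c: "p - (\<Sum>t\<in>E. poly_const (c t) * face t) \<in> ?W"
    using combine by (intro that)
  have expand: "?tens a (coh N \<Delta> q) =
      (\<Otimes>\<^bsub>?T\<^esub> t\<in>E. ?tens (e t \<odot>\<^bsub>F\<^esub> a) (coh N \<Delta> (face t)))"
    if "a \<in> carrier F" "q \<in> carrier (poly_ring (vertices \<Delta>))" "q - (\<Sum>t\<in>E. poly_const (e t) * face t) \<in> ?W" for a q e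
  proof -
    have "(\<Sum>t\<in>E. poly_const (e t) * face t) \<in> carrier (poly_ring (vertices \<Delta>))"
      using face_in E(1) by (intro poly_ring_sum poly_ring_mult poly_ring_const) blast
    then have "coh N \<Delta> q = coh N \<Delta> (\<Sum>t\<in>E. poly_const (e t) * face t)"
      by (rule coh_eqI [OF that(2) _ that(3)])
    then show ?thesis
      using tensor_coh_sum [OF lattice finE, of face \<Delta> k a r e] face_in subsetD [OF E(1)] that(1)
      unfolding F_def B_def by simp
  qed
  have coeff: "of_rat (c t) = (\<Sum>J\<in>Sk. of_rat (d J t) * (P J \<xi> / Q J \<xi>))"
    if \<xi>: "\<xi> \<in> grass_cone N r" "\<And>J. J \<in> Sk \<Longrightarrow> Q J \<xi> \<noteq> 0" and t: "t \<in> E" for \<xi> t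
  proof -
    obtain ws where ws: "ws \<in> rational_tuples N r" "\<xi> = plucker N r ws"
      using \<xi>(1) unfolding grass_cone_iff by blast
    have "generic ws"
      unfolding f_hom_face_nonzero_iff [OF ws(1)] using \<xi>(2) by (simp add: Q_def ws(2))
    from localization_at_generic_plane [OF this p] obtain m where
      m: "\<forall>J\<in>Sk. of_rat (m J) * (\<Prod>j\<in>J. \<iota> J j (line_vector J ws)) = poly_eval (\<lambda>j. \<iota> J j (line_vector J ws)) p"
      "p - (\<Sum>J\<in>Sk. poly_const (m J) * face J) \<in> ?W"
      by (elim exE conjE)
    have mPQ: "of_rat (m J) = P J \<xi> / Q J \<xi>" if "J \<in> Sk" for J
      using bspec [OF m(1) that] \<xi>(2) [OF that] f_hom_plucker [OF that ws(1) p(1)] f_hom_face_plucker [OF that ws(1)]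
      by (simp add: P_def Q_def ws(2) nonzero_eq_divide_eq)
    let ?e = "\<lambda>t. (\<Sum>J\<in>Sk. m J * d J t) - c t"
    have "(p - (\<Sum>t\<in>E. poly_const (c t) * face t)) + poly_const (- 1) * (p - (\<Sum>t\<in>E. poly_const (\<Sum>J\<in>Sk. m J * d J t) * face t)) \<in> ?W"
      by (rule coh_kernel_add [OF c W_scale [OF combine [OF m(2)]]])
    also have "(p - (\<Sum>t\<in>E. poly_const (c t) * face t)) + poly_const (- 1) * (p - (\<Sum>t\<in>E. poly_const (\<Sum>J\<in>Sk. m J * d J t) * face t)) =
        (\<Sum>t\<in>E. poly_const (?e t) * face t)"
      unfolding poly_const_uminus poly_const_diff [symmetric]
      by (simp add: left_diff_distrib sum_subtractf)
    finally have "\<forall>t\<in>E. ?e t = 0" by (rule mp [OF spec [OF E(2)]])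
    then have "c t = (\<Sum>J\<in>Sk. m J * d J t)" using t by simp
    then have "of_rat (c t) = (\<Sum>J\<in>Sk. of_rat (d J t) * of_rat (m J) :: real)"
      by (simp add: of_rat_sum of_rat_mult mult.commute)
    then show ?thesis by (simp add: mPQ)
  qed
  have "?tens \<one>\<^bsub>F\<^esub> (coh N \<Delta> p) = (\<Otimes>\<^bsub>?T\<^esub> J\<in>Sk.
      ?tens (ratfun N r (P J) (Q J)) (coh N \<Delta> (face J)))"
    unfolding F_def
  proof (rule tensor_expansion [where c = c and d = d and E = E and y = "\<lambda>t. coh N \<Delta> (face t)"
        and ?\<xi>0.0 = "plucker N r ws0", OF lattice _ _ finite_Sk finE])
    show "X \<oplus>\<^bsub>B\<^esub> Y \<in> carrier B" if "X \<in> carrier B" "Y \<in> carrier B" for X Y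
      using that unfolding B_def by (rule H_deg_closed(1))
    show "c \<odot>\<^bsub>B\<^esub> X \<in> carrier B" if "X \<in> carrier B" for c X
      using that unfolding B_def by (rule H_deg_closed(2))
    show "(P J, Q J) \<in> fractions N r" if "J \<in> Sk" for J
      unfolding P_def Q_def by (rule mu_fraction [OF that p])
    show "coh N \<Delta> (face t) \<in> carrier B" if "t \<in> E" for t
      using face_in [OF subsetD [OF E(1) that]] unfolding B_def by (intro coh_in_H_deg) simp_all
    show "coh N \<Delta> p \<in> carrier B" unfolding B_def by (rule coh_in_H_deg [OF p])
    show "coh N \<Delta> (face J) \<in> carrier B" if "J \<in> Sk" for J
      using face_in [OF that] unfolding B_def by (intro coh_in_H_deg) simp_all
    show "plucker N r ws0 \<in> grass_cone N r" by (rule generic_in_grass_cone [OF ws0])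
    have "ws0 \<in> rational_tuples N r" using ws0 by (simp add: generic_def)
    then show "Q J (plucker N r ws0) \<noteq> 0" if "J \<in> Sk" for J
      using f_hom_face_nonzero_iff [of ws0] ws0 that by (simp add: Q_def)
    show "tensor rat_ring (Rat_Grass N r) B a (coh N \<Delta> p) =
        (\<Otimes>\<^bsub>tensor_product rat_ring (Rat_Grass N r) B\<^esub> t\<in>E.
          tensor rat_ring (Rat_Grass N r) B (c t \<odot>\<^bsub>Rat_Grass N r\<^esub> a) (coh N \<Delta> (face t)))"
      if "a \<in> carrier (Rat_Grass N r)" for a
      using expand [OF _ p(1) c] that unfolding F_def by simp
    show "tensor rat_ring (Rat_Grass N r) B a (coh N \<Delta> (face J)) =
        (\<Otimes>\<^bsub>tensor_product rat_ring (Rat_Grass N r) B\<^esub> t\<in>E.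
          tensor rat_ring (Rat_Grass N r) B (d J t \<odot>\<^bsub>Rat_Grass N r\<^esub> a) (coh N \<Delta> (face t)))"
      if "a \<in> carrier (Rat_Grass N r)" "J \<in> Sk" for a J
      using expand [OF _ conjunct1 [OF face_in [OF that(2)]] bspec [OF d that(2)]] that(1) unfolding F_def by simp
    show "of_rat (c t) = (\<Sum>J\<in>Sk. of_rat (d J t) * (P J \<xi> / Q J \<xi>))"
      if "\<xi> \<in> grass_cone N r" "\<And>J. J \<in> Sk \<Longrightarrow> Q J \<xi> \<noteq> 0" "t \<in> E" for \<xi> t
      using that by (rule coeff)
  qed
  also have "\<dots> = (\<Otimes>\<^bsub>?T\<^esub> J\<in>Sk.
      ?tens (mu N \<Delta> (b J) (HT_class \<Delta> p) J) (coh N \<Delta> (face J)))"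
  proof -
    note hyps = Rat_Grass_closed [OF lattice, of _ r, folded F_def]
      H_deg_closed [where N = N and \<Delta> = \<Delta> and k = k, folded B_def]
    interpret T: comm_group ?T
      by (rule comm_group_tensor [OF hyps])
    have mu: "mu N \<Delta> (b J) (HT_class \<Delta> p) J = ratfun N r (P J) (Q J)" if "J \<in> Sk" for J
      using that by (simp add: mu_def P_def Q_def Sk_iff r)
    have closed: "?tens (mu N \<Delta> (b J) (HT_class \<Delta> p) J) (coh N \<Delta> (face J)) \<in>
        carrier ?T" if "J \<in> Sk" for J
    proof (rule tensor_closed [OF hyps])
      show "mu N \<Delta> (b J) (HT_class \<Delta> p) J \<in> carrier F"
        unfolding mu [OF that] F_def P_def Q_def by (rule ratfun_carrier [OF lattice mu_fraction [OF that p]])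
      show "coh N \<Delta> (face J) \<in> carrier B"
        using face_in [OF that] unfolding B_def by (intro coh_in_H_deg) simp_all
    qed
    show ?thesis
    proof (rule T.finprod_cong' [OF refl])
      show "(\<lambda>J. ?tens (mu N \<Delta> (b J) (HT_class \<Delta> p) J) (coh N \<Delta> (face J))) \<in>
          Sk \<rightarrow> carrier ?T"
        using closed by (rule Pi_I)
    qed (simp only: mu)
  qed
  finally show ?thesis .
qed

end

theorem corollary5p3:
  fixes N :: "'a::euclidean_space set"
    and \<Delta> :: "('v, 'a) multifan"
    and k :: nat
    and x :: "'v rpoly set"
    and b :: "'v set \<Rightarrow> ('a \<Rightarrow> real) list"
  assumes "Q_Gorenstein_star_multifan N \<Delta>"
    and "1 \<le> k" and "k \<le> DIM('a)"
    and "x \<in> HT_deg \<Delta> k"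
    and "\<And>J. J \<in> simplices_of \<Delta> k \<Longrightarrow> annihilator_basis N \<Delta> J (b J)"
  defines "F \<equiv> Rat_Grass N (DIM('a) - k + 1)"
  shows "tensor rat_ring F (H_deg N \<Delta> k) \<one>\<^bsub>F\<^esub> (bar N \<Delta> x) =
    (\<Otimes>\<^bsub>tensor_product rat_ring F (H_deg N \<Delta> k)\<^esub> J \<in> simplices_of \<Delta> k.
       tensor rat_ring F (H_deg N \<Delta> k) (mu N \<Delta> (b J) x J) (bar N \<Delta> (HT_face \<Delta> J)))"
proof -
  interpret fan_with_annihilators N \<Delta> k "DIM('a) - k + 1" b
    using assms(1-3,5) by unfold_locales (auto simp: Q_Gorenstein_star_multifan_def)
  obtain p where p: "p \<in> carrier (poly_ring (vertices \<Delta>))" "poly_homogeneous k p" "x = HT_class \<Delta> p"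
    using assms(4) by (auto simp: HT_deg_def)
  show ?thesis
    using localization [OF p(1,2)] unfolding F_def p(3) coh_def HT_face_def by simp
qed

end
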